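(* Let $d,l\ge2$ be fixed integers. Let $\beta_*$ be the unique solution in $(0,1/d)$ of $(1-d\beta)^l=\beta(1-\beta)^{l-1}$, and let $$\Phi_{d,l}(\beta)=-\beta\log\beta+(l-1)(1-\beta)\log(1-\beta)-\frac ld(1-d\beta)\log(1-d\beta).$$ Let $Z$ be the total number of matchings (of all sizes) of the random $(d,l)$-regular hypergraph $\mathcal G_{m,d,l}$. If $$G_{\beta_*}(s)>0\qquad\text{for all }0<s<\beta_*-c_0(\beta_* ),$$ where $G_\beta$ and $c_0(\beta)$ are the explicit functions given in the context, then $$\frac1m\log Z\longrightarrow\Phi_{d,l}(\beta_* )$$ in probability as $m\to\infty$ through integers with $lm/d\in\mathbb N$.
   Context: Random hypergraph model. Let $d,l\ge2$ and let $m$ be such that $lm/d\in\mathbb N$. The hyperedge set is $[m]$, the half-edge set is $[lm]$, and half-edge $i$ belongs to hyperedge $\lceil i/l\rceil$. A $(d,l)$-regular hypergraph (configuration) is obtained by partitioning $[lm]$ into $lm/d$ classes of size $d$, called vertices; a half-edge is incident to the vertex that contains it. $\mathcal G_{m,d,l}$ is the configuration given by a uniformly random such partition. A set $M$ of hyperedges is a matching if all $l|M|$ half-edges contained in hyperedges of $M$ are incident to distinct vertices. Functions. For $0<\beta<1/d$ and $0<s<\beta$, $$t_\beta(s):=\frac{(\beta-s)^{1/l}s^{1-2/l}}{(1-\beta-s)^{(l-1)/l}},$$ $$c_0(\beta):=\frac{3\beta l-2l+1+\sqrt{9\beta^2l^2-8\beta^2l-12\beta l^2+10\beta l+4l^2-4l+1}}{2l}$$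 (this number lies in $(0,\beta)$), and $$\begin{aligned}G_\beta(s):={}&(1-(d-1)t_\beta(s))(d+l-dl)s^2+2\beta(1-\beta d)(1-\beta)\bigl(1-(d-1)(l-1)t_\beta(s)\bigr)\\&+s\Bigl[-t_\beta(s)(d-1)\bigl(\beta l-3\beta d-2l+2\beta^2d+3\beta dl-2\beta^2dl+1\bigr)\\&\qquad+2\beta^2d-\beta l-\beta d+\beta dl-1\Bigr].\end{aligned}$$ *)

theory Defs
  imports "HOL-Probability.Probability" "HOL-Library.Disjoint_Sets"
begin

definition hyperedge_of :: "nat \<Rightarrow> nat \<Rightarrow> nat" where
  "hyperedge_of l i = nat \<lceil>real i / real l\<rceil>"

text \<open>
  A configuration is the set of its vertices, each vertex being the set of the half-edges
  incident to it.
\<close>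

definition configurations :: "nat \<Rightarrow> nat \<Rightarrow> nat \<Rightarrow> nat set set set" where
  "configurations m d l =
     {P. partition_on {1..l * m} P \<and> card P = l * m div d \<and> (\<forall>V\<in>P. card V = d)}"

text \<open>
  Meaningful only for \<^prop>\<open>d dvd l * m\<close> (and \<^prop>\<open>d > 0\<close>), when the set of configurations is
  finite and nonempty; see \<open>finite_configurations\<close> and \<open>configurations_nonempty\<close> below.
\<close>

definition random_hypergraph :: "nat \<Rightarrow> nat \<Rightarrow> nat \<Rightarrow> nat set set pmf" where
  "random_hypergraph m d l = pmf_of_set (configurations m d l)"

definition vertex_of :: "nat set set \<Rightarrow> nat \<Rightarrow> nat set" where
  "vertex_of P i = (THE V. V \<in> P \<and> i \<in> V)"

definition half_edges_in :: "nat \<Rightarrow> nat \<Rightarrow> nat set \<Rightarrow> nat set" where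
  "half_edges_in m l M = {i \<in> {1..l * m}. hyperedge_of l i \<in> M}"

definition is_matching :: "nat \<Rightarrow> nat \<Rightarrow> nat set set \<Rightarrow> nat set \<Rightarrow> bool" where
  "is_matching m l P M \<longleftrightarrow> M \<subseteq> {1..m} \<and> inj_on (vertex_of P) (half_edges_in m l M)"

definition num_matchings :: "nat \<Rightarrow> nat \<Rightarrow> nat set set \<Rightarrow> nat" where
  "num_matchings m l P = card {M. is_matching m l P M}"

text \<open>Existence and uniqueness are \<open>beta_star_ex1\<close> below.\<close>

definition beta_star :: "nat \<Rightarrow> nat \<Rightarrow> real" where
  "beta_star d l =
     (THE \<beta>. 0 < \<beta> \<and> \<beta> < 1 / real d \<and> (1 - real d * \<beta>) ^ l = \<beta> * (1 - \<beta>) ^ (l - 1))"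

definition Phi :: "nat \<Rightarrow> nat \<Rightarrow> real \<Rightarrow> real" where
  "Phi d l \<beta> =
     - \<beta> * ln \<beta> + (real l - 1) * (1 - \<beta>) * ln (1 - \<beta>)
     - real l / real d * (1 - real d * \<beta>) * ln (1 - real d * \<beta>)"

definition t_fun :: "nat \<Rightarrow> real \<Rightarrow> real \<Rightarrow> real" where
  "t_fun l \<beta> s =
     (\<beta> - s) powr (1 / real l) * s powr (1 - 2 / real l)
       / (1 - \<beta> - s) powr ((real l - 1) / real l)"

definition c0 :: "nat \<Rightarrow> real \<Rightarrow> real" where
  "c0 l \<beta> = (let l = real l in
     (3 * \<beta> * l - 2 * l + 1
       + sqrt (9 * \<beta>^2 * l^2 - 8 * \<beta>^2 * l - 12 * \<beta> * l^2 + 10 * \<beta> * l + 4 * l^2 - 4 * l + 1))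
     / (2 * l))"

definition G_fun :: "nat \<Rightarrow> nat \<Rightarrow> real \<Rightarrow> real \<Rightarrow> real" where
  "G_fun d l \<beta> s = (let t = t_fun l \<beta> s; d = real d; l = real l in
     (1 - (d - 1) * t) * (d + l - d * l) * s^2
     + 2 * \<beta> * (1 - \<beta> * d) * (1 - \<beta>) * (1 - (d - 1) * (l - 1) * t)
     + s * (- t * (d - 1) *
               (\<beta> * l - 3 * \<beta> * d - 2 * l + 2 * \<beta>^2 * d + 3 * \<beta> * d * l - 2 * \<beta>^2 * d * l + 1)
            + 2 * \<beta>^2 * d - \<beta> * l - \<beta> * d + \<beta> * d * l - 1))"

lemma finite_configurations: "finite (configurations m d l)"
proof (rule finite_subset)
  show "configurations m d l \<subseteq> Pow (Pow {1..l * m})"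
    by (auto simp: configurations_def partition_on_def)
qed auto

lemma configurations_nonempty:
  assumes "d > 0" and "d dvd l * m"
  shows "configurations m d l \<noteq> {}"
proof -
  obtain k where k: "l * m = d * k" using assms(2) by blast
  define B where "B j = {d * j + 1..d * j + d}" for j
  have B_iff: "i \<in> B j \<longleftrightarrow> i > 0 \<and> (i - 1) div d = j" for i j
  proof (cases i)
    case (Suc i')
    have "i' div d = j \<longleftrightarrow> d * j \<le> i' \<and> i' < d * j + d"
    proof
      assume "i' div d = j"
      then show "d * j \<le> i' \<and> i' < d * j + d"
        using dividend_less_times_div[OF \<open>d > 0\<close>, of i'] times_div_less_eq_dividend[of d i']
        by (simp add: add.commute)
    next
      assume "d * j \<le> i' \<and> i' < d * j + d"
      then show "i' div d = j" by (intro div_nat_eqI) (simp_all add: add.commute mult.commute)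
    qed
    then show ?thesis using Suc by (auto simp: B_def)
  qed (simp add: B_def)
  have un: "(\<Union>j<k. B j) = {1..l * m}"
  proof (rule set_eqI)
    fix i
    have "(i - 1) div d < k \<longleftrightarrow> i - 1 < d * k"
      using \<open>d > 0\<close> by (simp add: div_less_iff_less_mult mult.commute)
    then show "i \<in> (\<Union>j<k. B j) \<longleftrightarrow> i \<in> {1..l * m}"
      unfolding k by (auto simp: B_iff)
  qed
  have ne: "B j \<noteq> {}" for j using \<open>d > 0\<close> by (auto simp: B_def)
  have dj: "B i \<inter> B j = {}" if "i \<noteq> j" for i j using that by (auto simp: B_iff)
  have "partition_on {1..l * m} (B ` {..<k})"
  proof (rule partition_onI)
    show "disjnt p q" if "p \<in> B ` {..<k}" "q \<in> B ` {..<k}" "p \<noteq> q" for p q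
      using that dj unfolding disjnt_def by (metis imageE)
    show "\<Union> (B ` {..<k}) = {1..l * m}" by (fact un)
    show "{} \<notin> B ` {..<k}"
      using ne by (metis imageE)
  qed
  moreover have "inj_on B {..<k}"
    by (rule inj_onI) (use dj ne in \<open>metis Int_absorb\<close>)
  then have "card (B ` {..<k}) = l * m div d"
    using \<open>d > 0\<close> k by (simp add: card_image)
  moreover have "\<forall>V\<in>B ` {..<k}. card V = d" by (auto simp: B_def)
  ultimately have "B ` {..<k} \<in> configurations m d l" by (simp add: configurations_def)
  then show ?thesis by blast
qed

lemma beta_star_ex1:
  assumes "d \<ge> 2" and "l \<ge> 2"
  shows "\<exists>!\<beta>::real. 0 < \<beta> \<and> \<beta> < 1 / real d \<and> (1 - real d * \<beta>) ^ l = \<beta> * (1 - \<beta>) ^ (l - 1)"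
proof -
  have d1: "1 / real d < 1" using assms by simp
  have less: "(1 - real d * y) ^ l * (x * (1 - x) ^ (l - 1)) < (1 - real d * x) ^ l * (y * (1 - y) ^ (l - 1))"
    if "0 < x" "x < y" "y < 1 / real d" for x y :: real
  proof -
    have dy: "real d * y < 1" using that assms by (simp add: field_simps)
    have dx: "real d * x < 1" using that assms dy by (smt (verit) mult_left_mono of_nat_0_le_iff)
    have y1: "y < 1" using that d1 by linarith
    have "(real d - 1) * x \<le> (real d - 1) * y" using that assms by (intro mult_left_mono) auto
    then have "(1 - real d * y) * (1 - x) \<le> (1 - real d * x) * (1 - y)"
      by (simp add: algebra_simps)
    then have "((1 - real d * y) * (1 - x)) ^ (l - 1) \<le> ((1 - real d * x) * (1 - y)) ^ (l - 1)"
      using dy y1 that by (intro power_mono) auto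
    moreover have "(1 - real d * y) * x < (1 - real d * x) * y"
      using that by (simp add: algebra_simps)
    ultimately have "((1 - real d * y) * (1 - x)) ^ (l - 1) * ((1 - real d * y) * x)
        < ((1 - real d * x) * (1 - y)) ^ (l - 1) * ((1 - real d * x) * y)"
    proof (rule mult_le_less_imp_less)
      show "0 < ((1 - real d * y) * (1 - x)) ^ (l - 1)" "0 \<le> (1 - real d * y) * x"
        using dy y1 that d1 by simp_all
    qed
    moreover have "l = Suc (l - 1)" using assms by simp
    ultimately show ?thesis
      using power_Suc[of "1 - real d * y" "l - 1"] power_Suc[of "1 - real d * x" "l - 1"]
      by (simp add: power_mult_distrib mult_ac)
  qed
  have "\<exists>\<beta>\<ge>0. \<beta> \<le> 1 / real d \<and> \<beta> * (1 - \<beta>) ^ (l - 1) - (1 - real d * \<beta>) ^ l = 0"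
    by (rule IVT') (use assms in \<open>auto intro!: continuous_intros mult_nonneg_nonneg simp: power_0_left\<close>)
  then obtain b where b: "0 \<le> b" "b \<le> 1 / real d"
      "(1 - real d * b) ^ l = b * (1 - b) ^ (l - 1)" by auto
  have "b \<noteq> 0" using b(3) by auto
  moreover have "b \<noteq> 1 / real d" using b(3) d1 assms by (auto simp: power_0_left)
  ultimately have b': "0 < b \<and> b < 1 / real d \<and> (1 - real d * b) ^ l = b * (1 - b) ^ (l - 1)"
    using b by auto
  show ?thesis
  proof (rule ex1I[of _ b])
    show "0 < b \<and> b < 1 / real d \<and> (1 - real d * b) ^ l = b * (1 - b) ^ (l - 1)" by (fact b')
  next
    fix c :: real
    assume c: "0 < c \<and> c < 1 / real d \<and> (1 - real d * c) ^ l = c * (1 - c) ^ (l - 1)"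
    show "c = b"
      using less[of b c] less[of c b] b' c by (cases "b < c"; cases "c < b") (auto simp: mult_ac)
  qed
qed

end

theory Submission
  imports Defs "HOL-Real_Asymp.Real_Asymp"
begin

text \<open>
  Concentration reduces the theorem to exponential-order moment estimates: a configuration is a
  uniformly random list of half-edges cut into blocks of length \<open>d\<close>, transposing two half-edges
  changes the number of matchings by a factor of at most 4, so by Azuma's inequality \<open>ln Z\<close> deviates
  from its mean by \<open>\<epsilon> m\<close> only with exponentially small probability. Hence it is enough that
  \<open>ln Z \<ge> (\<Phi> - \<epsilon>) m\<close> has probability \<open>exp (-o(m))\<close>, which follows from
  \<open>E Z\<^sub>k\<^sup>2 \<le> exp (o(m)) (E Z\<^sub>k)\<^sup>2\<close> for the number \<open>Z\<^sub>k\<close> of matchings of size \<open>k \<approx> \<beta> m\<close>; the upper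
  bound on \<open>Z\<close> is Markov's inequality.

  Let \<open>s m\<close> be the number of hyperedges of the first matching of a pair that are not in the second.
  The contribution of such pairs to \<open>E Z\<^sub>k\<^sup>2\<close> is bounded through the generating function
  \<open>1 + d x + 2 d y + d (d - 1) y\<^sup>2\<close> of one vertex, for arbitrary \<open>x, y > 0\<close>. The optimal \<open>x\<close> and \<open>s\<close>
  are rational functions of \<open>y\<close>, and along this curve the derivative of the exponent vanishes exactly
  where \<open>t\<^sub>\<beta>(s) = y / (1 + (d - 1) y)\<close>. At such a point the second derivative has the sign of
  \<open>-G\<^sub>\<beta>(s)\<close>, and \<open>G\<^sub>\<beta>(s) > 0\<close> is automatic for \<open>s \<ge> \<beta> - c\<^sub>0(\<beta>)\<close>. So there is only one critical
  point, the independent overlap \<open>s = \<beta> (1 - \<beta>)\<close>, where the exponent equals \<open>2 \<Phi>(\<beta>)\<close>.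
\<close>

section \<open>The overlap exponent\<close>

text \<open>The second moment is controlled only up to subexponential factors (rounding of the size,
  logarithmic errors of factorials, a coefficient bounded by its generating function), so
  Cauchy-Schwarz yields a probability that may tend to 0. Azuma's rate for a deviation proportional
  to \<open>m\<close> is linear in \<open>m\<close>, hence an event of probability exp(-o(m))
  already locates the mean. Concentration has to be applied to the total count: it is at least 1 by
  the empty matching and changes by a bounded factor, whereas the number of matchings of a
  prescribed size can vanish.

  Solving the stationarity conditions for \<open>y\<close> at a given overlap would bring in square
  roots; this is why the curve is parametrized by \<open>y\<close>. Uniqueness of the critical point
  requires no knowledge of the global shape of the exponent: a function all of whose zeros are
  downward crossings has at most one zero. The role of c_0 is that at a critical point G is a
  positive term plus a positive multiple of a quadratic in s, and this quadratic is nonnegative from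
  s = beta - c_0 on.\<close>

definition eta :: "real \<Rightarrow> real" where "eta x = x * ln x"

lemma eta_0 [simp]: "eta 0 = 0" and eta_1 [simp]: "eta 1 = 0"
  by (simp_all add: eta_def)

lemma eta_mult: "0 \<le> x \<Longrightarrow> 0 \<le> y \<Longrightarrow> eta (x * y) = x * eta y + y * eta x"
  by (cases "x = 0 \<or> y = 0") (auto simp: eta_def ln_mult algebra_simps)

lemma continuous_on_eta: "continuous_on {0..} eta"
proof (subst continuous_on_eq_continuous_within, rule ballI)
  fix x :: real assume "x \<in> {0..}"
  show "continuous (at x within {0..}) eta"
  proof (cases "x = 0")
    case True
    have "((\<lambda>x::real. x * ln x) \<longlongrightarrow> 0) (at_right 0)" by real_asymp
    then have "(eta \<longlongrightarrow> eta 0) (at 0 within {0<..})" by (simp add: eta_def[abs_def])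
    moreover have "at (0::real) within {0..} = at 0 within {0<..}"
      by (metis at_within_Ici_at_right)
    ultimately show ?thesis unfolding True continuous_within by simp
  next
    case False
    then have "isCont (\<lambda>x. x * ln x) x" using \<open>x \<in> {0..}\<close> by (intro continuous_intros) auto
    then show ?thesis
      unfolding eta_def[abs_def] by (rule continuous_at_imp_continuous_at_within)
  qed
qed

lemma continuous_on_eta' [continuous_intros]:
  assumes "continuous_on S f" "\<And>x. x \<in> S \<Longrightarrow> f x \<ge> 0"
  shows "continuous_on S (\<lambda>x. eta (f x))"
  by (rule continuous_on_compose2[OF continuous_on_eta assms(1)]) (use assms(2) in auto)

text \<open>Absorbs the rounding of a real density to \<open>k / m\<close>. The slope of
  \<open>eta\<close> is unbounded near 0, where the arguments end up for extreme overlaps, so a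
  Lipschitz bound would not do.\<close>

lemma eta_uniformly_continuous:
  assumes "e > 0"
  obtains \<delta> where "\<delta> > 0"
    "\<And>x y. 0 \<le> x \<Longrightarrow> x \<le> 1 \<Longrightarrow> 0 \<le> y \<Longrightarrow> y \<le> 1 \<Longrightarrow> \<bar>x - y\<bar> < \<delta> \<Longrightarrow> \<bar>eta x - eta y\<bar> < e"
proof -
  have "uniformly_continuous_on {0..1} eta"
    by (intro compact_uniformly_continuous continuous_on_subset[OF continuous_on_eta]) auto
  then obtain \<delta> where "\<delta> > 0" "\<And>x y. x \<in> {0..1} \<Longrightarrow> y \<in> {0..1} \<Longrightarrow> dist y x < \<delta> \<Longrightarrow> dist (eta y) (eta x) < e"
    unfolding uniformly_continuous_on_def using assms by meson
  then show ?thesis by (intro that[of \<delta>]) (auto simp: dist_real_def)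
qed

text \<open>
  For \<open>s m\<close> the size of both differences of a pair of matchings of size \<open>b m\<close>, this is the exponential
  rate, per hyperedge, of the generating function bound on the contribution of such pairs to the second moment.
\<close>

definition overlap_exponent :: "nat \<Rightarrow> nat \<Rightarrow> real \<Rightarrow> real \<Rightarrow> real \<Rightarrow> real \<Rightarrow> real" where
  "overlap_exponent d l b s x y =
     (real l - 1) * (eta (b - s) + 2 * eta s + eta (1 - b - s))
     + real l / real d * ln (1 + real d * x + 2 * real d * y + real (d * (d - 1)) * y\<^sup>2)
     - real l * (b - s) * ln x - 2 * real l * s * ln y"

text \<open>A negative derivative at every zero makes every zero a downward crossing, and to reach a
  second zero the function would first have to cross upwards. Only the sign of \<open>f'\<close> at
  zeros enters. It is applied to the derivative of the overlap exponent and to that of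
  \<open>Phi\<close>.\<close>

lemma positive_left_negative_right:
  fixes f f' :: "real \<Rightarrow> real"
  assumes ab: "a < z" "z < b" and fz: "f z = 0"
    and der: "\<And>x. a < x \<Longrightarrow> x < b \<Longrightarrow> (f has_real_derivative f' x) (at x)"
    and neg: "\<And>x. a < x \<Longrightarrow> x < b \<Longrightarrow> f x = 0 \<Longrightarrow> f' x < 0"
  shows "\<And>x. a < x \<Longrightarrow> x < z \<Longrightarrow> f x > 0" and "\<And>x. z < x \<Longrightarrow> x < b \<Longrightarrow> f x < 0"
proof -
  have cont: "continuous_on {u..v} f" if "a < u" "v < b" for u v
    using that by (intro continuous_at_imp_continuous_on ballI DERIV_isCont[OF der]) auto
  have left: "\<exists>w. u < w \<and> w < x \<and> f w > 0" if "a < u" "u < x" "x < b" "f x = 0" for u x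
  proof -
    have "a < x" "x < b" using that by auto
    then have d: "(f has_real_derivative f' x) (at x)" and n: "f' x < 0"
      using der neg that(4) by blast+
    obtain e where e: "e > 0" "\<forall>h>0. h < e \<longrightarrow> f x < f (x - h)" using DERIV_neg_dec_left[OF d n] by blast
    define h where "h = min (e / 2) ((x - u) / 2)"
    have "h > 0" "h < e" "h < x - u" using e that by (auto simp: h_def min_def)
    then show ?thesis using spec[OF e(2), of h] that by (intro exI[of _ "x - h"]) auto
  qed
  have right: "\<exists>w. x < w \<and> w < v \<and> f w < 0" if "v < b" "x < v" "a < x" "f x = 0" for v x
  proof -
    have "a < x" "x < b" using that by auto
    then have d: "(f has_real_derivative f' x) (at x)" and n: "f' x < 0"
      using der neg that(4) by blast+
    obtain e where e: "e > 0" "\<forall>h>0. h < e \<longrightarrow> f x > f (x + h)" using DERIV_neg_dec_right[OF d n] by blast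
    define h where "h = min (e / 2) ((v - x) / 2)"
    have "h > 0" "h < e" "h < v - x" using e that by (auto simp: h_def min_def)
    then show ?thesis using spec[OF e(2), of h] that by (intro exI[of _ "x + h"]) auto
  qed
  have only: False if uv: "a < u" "u < v" "v < b" "f u \<le> 0" "f v \<ge> 0" for u v
  proof -
    have "\<exists>u'\<ge>u. u' < v \<and> f u' < 0"
    proof (cases "f u = 0")
      case True
      then obtain w where "u < w" "w < v" "f w < 0" using right[of v u] uv by blast
      then show ?thesis by (intro exI[of _ w]) auto
    qed (use uv in \<open>auto intro!: exI[of _ u]\<close>)
    then obtain u' where u': "u \<le> u'" "u' < v" "f u' < 0" by blast
    have "\<exists>v'\<le>v. u' < v' \<and> f v' > 0"
    proof (cases "f v = 0")
      case True
      have "a < u'" using uv u' by simp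
      then obtain w where "u' < w" "w < v" "f w > 0" using left[of u' v] True uv u' by blast
      then show ?thesis by (intro exI[of _ w]) auto
    qed (use uv u' in \<open>auto intro!: exI[of _ v]\<close>)
    then obtain v' where v': "u' < v'" "v' \<le> v" "f v' > 0" by blast
    have ab': "a < u'" "v' < b" using uv u' v' by linarith+
    \<comment> \<open>\<open>Sup S\<close> is the last point of the interval where \<open>f\<close>
      is nonpositive. By continuity it is a zero, and \<open>f\<close> is positive to its right,
      which contradicts \<open>right\<close>.\<close>
    define S where "S = {x \<in> {u'..v'}. f x \<le> 0}"
    have "continuous_on {u'..v'} f" using cont ab' by blast
    then have "closed S" unfolding S_def
      by (intro continuous_on_closed_Collect_le continuous_intros) auto
    moreover have "u' \<in> S" "bdd_above S" using u' v' by (auto simp: S_def)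
    ultimately have "Sup S \<in> S" by (intro closed_contains_Sup) auto
    then have bd: "u' \<le> Sup S" "Sup S \<le> v'" "f (Sup S) \<le> 0" by (auto simp: S_def)
    then have lt: "Sup S < v'" using v'(3) by (cases "Sup S = v'") auto
    have pos: "f x > 0" if "Sup S < x" "x \<le> v'" for x
    proof (rule ccontr)
      assume "\<not> f x > 0"
      then have "x \<in> S" using that bd by (auto simp: S_def)
      then show False using cSup_upper[of x S] \<open>bdd_above S\<close> that by simp
    qed
    have ac: "a < Sup S" using ab' bd by linarith
    have "continuous_on {Sup S..v'} f" using cont ac ab' by blast
    then obtain x where x: "Sup S \<le> x" "x \<le> v'" "f x = 0"
      using IVT'[of f "Sup S" 0 v'] v'(3) bd(3) lt by force
    with pos[of x] have "x = Sup S" by (cases "Sup S < x") auto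
    with x have "f (Sup S) = 0" by simp
    then obtain w where "Sup S < w" "w < v'" "f w < 0" using right[of v' "Sup S"] ac ab' lt by blast
    then show False using pos[of w] by simp
  qed
  show "f x > 0" if "a < x" "x < z" for x
    by (rule ccontr) (use only[of x z] that ab fz in auto)
  show "f x < 0" if "z < x" "x < b" for x
    by (rule ccontr) (use only[of z x] that ab fz in auto)
qed

lemma eta_has_derivative: "x > 0 \<Longrightarrow> (eta has_real_derivative ln x + 1) (at x)"
  unfolding eta_def[abs_def] by (auto intro!: derivative_eq_intros)

lemma eta_has_derivative' [derivative_intros]:
  assumes "(f has_real_derivative f') (at x)" "f x > 0"
  shows "((\<lambda>x. eta (f x)) has_real_derivative (ln (f x) + 1) * f') (at x)"
  using DERIV_chain2[OF eta_has_derivative[OF assms(2)] assms(1)] .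

text \<open>In the variable \<open>x = b - s\<close> the expression is minus the quadratic
  \<open>l * x^2 - p * x - r\<close>, of which \<open>c0 l b\<close> is the larger root. Since
  \<open>b \<le> 1/2\<close> makes \<open>r\<close> nonnegative, the quadratic is nonpositive
  between 0 and that root.\<close>

lemma c0_quadratic:
  fixes b s :: real
  assumes "l \<ge> 1" "0 < b" "b \<le> 1/2" "s < b" "b - s \<le> c0 l b"
  shows "l * s * (1 - b - s) - (real l - 1) * (2 * b * (1 - b) - s) \<ge> 0"
proof -
  define p where "p = 3 * b * l - 2 * l + 1"
  define r where "r = b * (1 - 2 * b)"
  define x where "x = b - s"
  define c where "c = c0 l b"
  have r: "r \<ge> 0" using assms by (simp add: r_def)
  have disc: "9 * b^2 * (real l)^2 - 8 * b^2 * l - 12 * b * (real l)^2 + 10 * b * l + 4 * (real l)^2 - 4 * l + 1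
      = p\<^sup>2 + 4 * l * r"
    by (simp add: p_def r_def power2_eq_square algebra_simps)
  have "c = (p + sqrt (p\<^sup>2 + 4 * l * r)) / (2 * l)"
    unfolding c_def c0_def Let_def disc[symmetric] by (simp add: p_def)
  then have "2 * l * c - p = sqrt (p\<^sup>2 + 4 * l * r)" using assms(1) by simp
  then have "(2 * l * c - p)\<^sup>2 = p\<^sup>2 + 4 * l * r" using r by simp
  then have "4 * real l * (l * c\<^sup>2 - p * c - r) = 0" by (simp add: power2_eq_square algebra_simps)
  then have lc: "l * c\<^sup>2 = p * c + r" using assms(1) by simp
  have x: "0 < x" "x \<le> c" using assms by (auto simp: x_def c_def)
  \<comment> \<open>The combination \<open>c * quadratic(x) - x * quadratic(c)\<close> has the
    factor \<open>x - c\<close>; as the quadratic vanishes at \<open>c\<close>, this gives its sign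
    at \<open>x\<close> without the second root.\<close>
  have "c * (l * x\<^sup>2 - p * x - r) = (x - c) * (l * c * x + r) + x * (l * c\<^sup>2 - p * c - r)"
    by (simp add: power2_eq_square algebra_simps)
  also have "\<dots> = (x - c) * (l * c * x + r)" using lc by simp
  also have "\<dots> \<le> 0" using x r by (intro mult_nonpos_nonneg) auto
  finally have "l * x\<^sup>2 - p * x - r \<le> 0" using x by (simp add: mult_le_0_iff)
  moreover have "l * s * (1 - b - s) - (real l - 1) * (2 * b * (1 - b) - s) = - (l * x\<^sup>2 - p * x - r)"
    by (simp add: x_def p_def r_def power2_eq_square algebra_simps)
  ultimately show ?thesis by simp
qed

text \<open>A grouping that makes the sign of \<open>G_fun\<close> visible: at critical points both
  factors containing \<open>u\<close> turn out positive, and the factor in front of the last one is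
  the quadratic of \<open>c0_quadratic\<close>.\<close>

lemma G_fun_alt:
  fixes b s :: real
  assumes "u = (real d - 1) * t_fun l b s"
  shows "G_fun d l b s =
     l * (b - s) * (1 - b - s) * (2 * (1 - d * b) - d * s + d * s * u)
     + (l * s * (1 - b - s) - (real l - 1) * (2 * b * (1 - b) - s)) * (1 - d * b - d * s + u * (1 - d * b + d * s))"
  unfolding G_fun_def Let_def assms
  by (simp add: power2_eq_square algebra_simps)

section \<open>The exponent along the curve of stationary \<open>x\<close> and
  \<open>y\<close>\<close>

locale overlap =
  fixes d l :: nat and b :: real
  assumes d2: "d \<ge> 2" and l2: "l \<ge> 2" and b_pos: "0 < b" and b_less: "b < 1 / real d"
    and G_pos: "\<And>s. 0 < s \<Longrightarrow> s < b - c0 l b \<Longrightarrow> G_fun d l b s > 0"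
begin

text \<open>
  The values \<open>s = sy y\<close> and \<open>x = xy y\<close> solve the stationarity conditions of \<open>overlap_exponent\<close> in \<open>x\<close>
  and \<open>y\<close>. Hence only the explicit dependence on \<open>s\<close> contributes to the derivative of \<open>B\<close>, which is
  \<open>dsy y * K y\<close>; \<open>dK\<close> is the derivative of \<open>K\<close>. The point \<open>y0\<close> below is the one of independent overlap,
  and \<open>y1\<close> the one where the matchings are disjoint and \<open>xy\<close> vanishes.
\<close>

definition "c = 1 - real d * b"
definition "p y = 1 + (real d - 1) * y"
definition "q y = 1 + real d * y"
definition "S y = 1 + 2 * (real d - 1) * y + real d * (real d - 1) * y\<^sup>2"
definition "sy y = c * y * p y / q y"
definition "dsy y = c * S y / (q y)\<^sup>2"
definition "xy y = (b - sy y) * q y / c"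
definition "K y = ln (b - sy y) + (real l - 2) * ln (sy y) - (real l - 1) * ln (1 - b - sy y)
   - l * ln y + l * ln (p y)"
definition "N s = s * (l * b - (real l - 1)) + (real l - 2) * b * (1 - b)"
definition "dK y = dsy y * N (sy y) / (sy y * (b - sy y) * (1 - b - sy y)) - l / (y * p y)"
definition "B y = overlap_exponent d l b (sy y) (xy y) y"

lemma c_pos: "c > 0" using b_less d2 by (simp add: c_def field_simps)

lemma b_half: "b < 1/2"
proof -
  have "1 / real d \<le> 1 / 2" using d2 by (simp add: field_simps)
  then show ?thesis using b_less by linarith
qed

lemma pqS: assumes "y \<ge> 0" shows "p y > 0" "q y > 0" "S y > 0"
proof -
  have "(real d - 1) * y \<ge> 0" "real d * (real d - 1) * y\<^sup>2 \<ge> 0" "real d * y \<ge> 0" using assms d2 by auto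
  then show "p y > 0" "q y > 0" "S y > 0" unfolding p_def q_def S_def by linarith+
qed

lemma sy_deriv: assumes "y \<ge> 0" shows "(sy has_real_derivative dsy y) (at y)"
proof -
  have "(sy has_real_derivative ((c * p y + c * y * (real d - 1)) * q y - c * y * p y * d) / (q y * q y)) (at y)"
    unfolding sy_def[abs_def] p_def[abs_def] q_def[abs_def] using pqS(2)[OF assms]
    by (auto intro!: derivative_eq_intros simp: q_def algebra_simps)
  also have "((c * p y + c * y * (real d - 1)) * q y - c * y * p y * d) / (q y * q y) = dsy y"
    by (simp add: dsy_def p_def q_def S_def power2_eq_square) (simp add: algebra_simps)
  finally show ?thesis .
qed

lemma dsy_pos: "y \<ge> 0 \<Longrightarrow> dsy y > 0"
  unfolding dsy_def using c_pos pqS[of y] by simp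

lemma sy_less: "0 \<le> u \<Longrightarrow> u < v \<Longrightarrow> sy u < sy v"
  by (rule DERIV_pos_imp_increasing[of u v sy]) (auto intro!: exI sy_deriv dsy_pos)

lemma sy_cont: "u \<ge> 0 \<Longrightarrow> isCont sy u"
  using DERIV_isCont sy_deriv by blast

lemma sy_0 [simp]: "sy 0 = 0" by (simp add: sy_def)

lemma sy_pos: "y > 0 \<Longrightarrow> sy y > 0" using sy_less[of 0 y] by simp

lemma sy_ex: assumes "0 < s" obtains y where "y > 0" "sy y = s"
proof -
  \<comment> \<open>For \<open>d \<ge> 2\<close> the quotient \<open>p y / q y\<close> is at least
    1/2, so \<open>sy y\<close> is at least \<open>c * y / 2\<close>; this suggests the upper end
    point \<open>2 * s / c\<close> for the intermediate value theorem.\<close>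
  have "sy (2 * s / c) \<ge> s"
  proof -
    define y where "y = 2 * s / c"
    have y: "y > 0" using assms c_pos by (simp add: y_def)
    have "0 \<le> (real d - 2) * y" using d2 y by simp
    then have "2 * p y \<ge> q y"
      by (simp add: p_def q_def algebra_simps)
    then have "p y / q y \<ge> 1 / 2" using pqS[of y] y by (simp add: field_simps)
    then have "(c * y) * (p y / q y) \<ge> (c * y) * (1 / 2)"
      using c_pos y by (intro mult_left_mono) auto
    then have "sy y \<ge> c * y / 2" by (simp add: sy_def)
    then show ?thesis using c_pos by (simp add: y_def)
  qed
  moreover have "continuous_on {0..2 * s / c} sy"
    by (intro continuous_at_imp_continuous_on ballI sy_cont) auto
  ultimately obtain y where "0 \<le> y" "sy y = s"
    using IVT'[of sy 0 s "2 * s / c"] assms c_pos by auto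
  then show ?thesis using that[of y] assms by (cases "y = 0") auto
qed

definition "y0 = b / c"

lemma y0_pos: "y0 > 0" using b_pos c_pos by (simp add: y0_def)

lemma p_y0: "p y0 = (1 - b) / c" and q_y0: "q y0 = 1 / c"
  using c_pos by (simp_all add: p_def q_def y0_def field_simps) (simp_all add: c_def algebra_simps)

lemma sy_y0: "sy y0 = b * (1 - b)"
  using c_pos by (simp add: sy_def p_y0 q_y0) (simp add: y0_def)

definition "y1 = (SOME y. y > 0 \<and> sy y = b)"

lemma y1: "y1 > 0" "sy y1 = b"
proof -
  have "\<exists>y. y > 0 \<and> sy y = b" using sy_ex[OF b_pos] by blast
  then have "y1 > 0 \<and> sy y1 = b" unfolding y1_def by (rule someI_ex)
  then show "y1 > 0" "sy y1 = b" by auto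
qed

lemma sy_le_iff: "u \<ge> 0 \<Longrightarrow> v \<ge> 0 \<Longrightarrow> sy u < sy v \<longleftrightarrow> u < v"
  using sy_less[of u v] sy_less[of v u] by (cases "u = v") force+

lemma y0_less: "y0 < y1"
  using sy_le_iff[of y0 y1] y0_pos y1 b_pos b_half by (simp add: sy_y0)

lemma range: assumes "0 < y" "y < y1" shows "0 < sy y" "sy y < b" "sy y < 1 - b"
  using sy_pos[of y] sy_less[of y y1] assms y1 b_half by auto

text \<open>The critical equation gives \<open>1 - u = 1 / p y\<close>, and with
  \<open>s * q y = c * y * p y\<close> both \<open>u\<close>-factors of \<open>G_fun_alt\<close>
  become positive rational functions of \<open>y\<close>. Since the quadratic there equals
  \<open>- N s - Q\<close>, what remains is a negative multiple of \<open>dK y\<close>. Positivity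
  is the hypothesis on \<open>G_fun\<close> for small \<open>s\<close> and follows from
  \<open>c0_quadratic\<close> for the other \<open>s\<close>.\<close>

lemma G_sy:
  assumes y: "0 < y" "y < y1" and t: "t_fun l b (sy y) = y / p y"
  shows "G_fun d l b (sy y) = - dK y * (sy y * (b - sy y) * (1 - b - sy y) * q y / p y)"
    and "G_fun d l b (sy y) > 0"
proof -
  define s where "s = sy y"
  have pq: "p y > 0" "q y > 0" "S y > 0" using pqS y by auto
  note r = range[OF y, folded s_def]
  define u where "u = (real d - 1) * t_fun l b s"
  have u: "u = (real d - 1) * y / p y" using t by (simp add: u_def s_def)
  have u1: "1 - u = 1 / p y" using pq by (simp add: u field_simps) (simp add: p_def algebra_simps)
  have spq: "s * q y = c * y * p y" using pq by (simp add: s_def sy_def)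
  have e1: "2 * (1 - d * b) - d * s + d * s * u = c * (2 + d * y) / q y"
  proof -
    have "2 * (1 - d * b) - d * s + d * s * u = 2 * c - d * s * (1 - u)"
      by (simp add: c_def algebra_simps)
    also have "\<dots> = 2 * c - d * c * y / q y" using pq spq by (simp add: u1 field_simps)
    also have "\<dots> = c * (2 + d * y) / q y" using pq by (simp add: field_simps) (simp add: q_def algebra_simps)
    finally show ?thesis .
  qed
  have e2: "1 - d * b - d * s + u * (1 - d * b + d * s) = c * S y / (p y * q y)"
  proof -
    have "1 - d * b - d * s + u * (1 - d * b + d * s) = c * (1 + u) - d * s * (1 - u)"
      by (simp add: c_def algebra_simps)
    also have "\<dots> = c * (1 + u) - d * c * y / q y" using pq spq by (simp add: u1 field_simps)
    also have "1 + u = 2 - 1 / p y" using u1 by simp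
    also have "c * (2 - 1 / p y) - d * c * y / q y = c * ((2 - 1 / p y) - d * y / q y)" by (simp add: algebra_simps)
    also have "\<dots> = c * (((2 * p y - 1) * q y - d * y * p y) / (p y * q y))" using pq by (simp add: field_simps)
    also have "(2 * p y - 1) * q y - d * y * p y = S y"
      by (simp add: p_def q_def S_def power2_eq_square algebra_simps)
    finally show ?thesis by simp
  qed
  define Q where "Q = l * (b - s) * (1 - b - s)"
  define Bk where "Bk = l * s * (1 - b - s) - (real l - 1) * (2 * b * (1 - b) - s)"
  have G: "G_fun d l b s = Q * (c * (2 + d * y) / q y) + Bk * (c * S y / (p y * q y))"
    unfolding G_fun_alt[OF u_def] e1 e2 Q_def Bk_def by simp
  have Bk: "Bk = - N s - Q" by (simp add: Bk_def Q_def N_def algebra_simps)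
  have "G_fun d l b s = (c / (p y * q y)) * (Q * ((2 + d * y) * p y - S y) - N s * S y)"
    unfolding G Bk using pq by (simp add: field_simps)
  also have "(2 + d * y) * p y - S y = q y"
    by (simp add: p_def q_def S_def power2_eq_square algebra_simps)
  finally have G2: "G_fun d l b s = (c / (p y * q y)) * (Q * q y - N s * S y)" .
  define X where "X = s * (b - s) * (1 - b - s)"
  have X: "X > 0" using r by (simp add: X_def)
  have "dK y * X = dsy y * N s - l / (y * p y) * X"
    using X unfolding dK_def s_def[symmetric] X_def[symmetric] by (simp add: left_diff_distrib)
  also have "l / (y * p y) * X = Q * (s / (y * p y))" by (simp add: Q_def X_def)
  also have "s / (y * p y) = c / q y" using spq pq y by (simp add: field_simps)
  finally have dK: "dK y * X = - (c / (q y)\<^sup>2) * (Q * q y - N s * S y)"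
    using pq by (simp add: dsy_def power2_eq_square field_simps)
  have "- dK y * (X * q y / p y) = - (dK y * X) * (q y / p y)"
    by simp
  also have "\<dots> = G_fun d l b s" unfolding dK G2 using pq by (simp add: power2_eq_square field_simps)
  finally show "G_fun d l b (sy y) = - dK y * (sy y * (b - sy y) * (1 - b - sy y) * q y / p y)"
    by (simp add: s_def X_def)
  show "G_fun d l b (sy y) > 0"
  proof (cases "s < b - c0 l b")
    case True
    then show ?thesis using G_pos r by (simp add: s_def)
  next
    case False
    then have "Bk \<ge> 0" unfolding Bk_def using l2 b_pos b_half r by (intro c0_quadratic) auto
    moreover have "Q > 0" using r l2 by (simp add: Q_def)
    moreover have "c * (2 + d * y) / q y > 0" using c_pos pq y by (simp add: add_pos_nonneg)
    moreover have "c * S y / (p y * q y) > 0" using c_pos pq by simp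
    ultimately have "G_fun d l b s > 0" unfolding G
      by (intro add_pos_nonneg mult_pos_pos mult_nonneg_nonneg) (simp_all only: less_imp_le)
    then show ?thesis by (simp add: s_def)
  qed
qed


lemma ln_t_fun:
  assumes "0 < s" "s < b" "s < 1 - b"
  shows "t_fun l b s > 0"
    and "l * ln (t_fun l b s) = ln (b - s) + (real l - 2) * ln s - (real l - 1) * ln (1 - b - s)"
proof -
  have lin: "l * (1 / real l * x + (1 - 2 / real l) * y - (real l - 1) / real l * z)
      = x + (real l - 2) * y - (real l - 1) * z" for x y z
    using l2 by (simp add: field_simps)
  have "ln (t_fun l b s) = 1 / real l * ln (b - s) + (1 - 2 / real l) * ln s - (real l - 1) / real l * ln (1 - b - s)"
    unfolding t_fun_def using assms by (simp add: ln_div ln_mult ln_powr)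
  then show "l * ln (t_fun l b s) = ln (b - s) + (real l - 2) * ln s - (real l - 1) * ln (1 - b - s)"
    using lin by simp
  show "t_fun l b s > 0" unfolding t_fun_def using assms by simp
qed

lemma K_eq: assumes "0 < y" "y < y1" shows "K y = l * (ln (t_fun l b (sy y)) - ln (y / p y))"
  using ln_t_fun[OF range[OF assms]] pqS[of y] assms by (simp add: K_def ln_div algebra_simps)

lemma K_deriv: assumes y: "0 < y" "y < y1" shows "(K has_real_derivative dK y) (at y)"
proof -
  note r = range[OF y]
  have pq: "p y > 0" using pqS y by auto
  have pd: "(p has_real_derivative (real d - 1)) (at y)"
    unfolding p_def[abs_def] by (auto intro!: derivative_eq_intros)
  have sd: "(sy has_real_derivative dsy y) (at y)" using sy_deriv y by simp
  have "(K has_real_derivative - dsy y / (b - sy y) + (real l - 2) * (dsy y / sy y)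
     - (real l - 1) * (- dsy y / (1 - b - sy y)) - l * (1 / y) + l * ((real d - 1) / p y)) (at y)"
    unfolding K_def[abs_def] using r y pq
    by (auto intro!: derivative_eq_intros pd sd simp: mult_ac)
  also have "- dsy y / (b - sy y) + (real l - 2) * (dsy y / sy y)
     - (real l - 1) * (- dsy y / (1 - b - sy y)) - l * (1 / y) + l * ((real d - 1) / p y)
    = dsy y * (- 1 / (b - sy y) + (real l - 2) / sy y + (real l - 1) / (1 - b - sy y))
      - l * (1 / y - (real d - 1) / p y)"
    by (simp add: algebra_simps)
  also have "1 / y - (real d - 1) / p y = 1 / (y * p y)"
    using pq y by (simp add: field_simps) (simp add: p_def algebra_simps)
  also have "- 1 / (b - sy y) + (real l - 2) / sy y + (real l - 1) / (1 - b - sy y)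
      = N (sy y) / (sy y * (b - sy y) * (1 - b - sy y))"
    using r by (simp add: divide_simps) (simp add: N_def algebra_simps)
  finally show ?thesis by (simp add: dK_def)
qed

lemma K_y0: "K y0 = 0"
proof -
  have e: "(1 - b) - b * (1 - b) = (1 - b)\<^sup>2" "b - b * (1 - b) = b\<^sup>2"
    by (simp_all add: power2_eq_square algebra_simps)
  have lb: "ln (b * (1 - b)) = ln b + ln (1 - b)" using b_pos b_half by (simp add: ln_mult)
  have "p y0 / y0 = (1 - b) / b" using b_pos c_pos unfolding p_y0 by (simp add: y0_def)
  moreover have "ln (p y0 / y0) = ln (p y0) - ln y0" "ln ((1 - b) / b) = ln (1 - b) - ln b"
    using b_pos b_half y0_pos pqS(1)[of y0] by (simp_all add: ln_div)
  ultimately have "ln (p y0) - ln y0 = ln (1 - b) - ln b" by simp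
  then have lp: "ln (p y0) = ln y0 + ln (1 - b) - ln b" by simp
  show ?thesis
    unfolding K_def sy_y0 e lb lp using b_pos b_half by (simp add: ln_realpow) (simp add: algebra_simps)
qed

lemma K_sign: "0 < y \<Longrightarrow> y < y0 \<Longrightarrow> K y > 0" "y0 < y \<Longrightarrow> y < y1 \<Longrightarrow> K y < 0"
proof -
  have neg: "dK y < 0" if y: "0 < y" "y < y1" "K y = 0" for y
  proof -
    have "ln (t_fun l b (sy y)) = ln (y / p y)" using K_eq[OF y(1,2)] y(3) l2 by simp
    then have t: "t_fun l b (sy y) = y / p y"
      using ln_t_fun(1)[OF range[OF y(1,2)]] pqS(1)[of y] y by simp
    have "0 < - dK y * (sy y * (b - sy y) * (1 - b - sy y) * q y / p y)"
      using G_sy[OF y(1,2) t] by simp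
    moreover have "sy y * (b - sy y) * (1 - b - sy y) * q y / p y > 0"
      using range[OF y(1,2)] pqS[of y] y by simp
    ultimately show ?thesis by (metis neg_0_less_iff_less zero_less_mult_pos2)
  qed
  show "0 < y \<Longrightarrow> y < y0 \<Longrightarrow> K y > 0" "y0 < y \<Longrightarrow> y < y1 \<Longrightarrow> K y < 0"
    using positive_left_negative_right[OF y0_pos y0_less K_y0 K_deriv neg] by blast+
qed

lemma xy_pos: "0 < y \<Longrightarrow> y < y1 \<Longrightarrow> xy y > 0"
  using range[of y] pqS[of y] c_pos by (simp add: xy_def)

text \<open>Let W be the value of the generating function of one vertex. Stationarity of the
  exponent in \<open>x\<close> and \<open>y\<close> reads \<open>x = (b - s) * W\<close> and
  \<open>y * p y = s * W\<close>. With \<open>W = q y / c\<close> these are the definitions of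
  \<open>xy\<close> and \<open>sy\<close>, so the lemma closes the system.\<close>

lemma block_sum_eq:
  fixes y :: real
  assumes "y \<ge> 0"
  shows "1 + real d * xy y + 2 * real d * y + real (d * (d - 1)) * y\<^sup>2 = q y / c"
proof -
  have "sy y * q y = c * y * p y" using pqS(2)[OF assms] by (simp add: sy_def)
  then have x: "xy y = b * q y / c - y * p y" using c_pos by (simp add: xy_def field_simps)
  have "1 + real d * xy y + 2 * real d * y + real (d * (d - 1)) * y\<^sup>2
      = d * b * q y / c + (1 - d * y * p y + 2 * d * y + real d * (real d - 1) * y\<^sup>2)"
    using d2 by (simp add: x of_nat_diff algebra_simps)
  also have "1 - d * y * p y + 2 * d * y + real d * (real d - 1) * y\<^sup>2 = q y"
    by (simp add: p_def q_def power2_eq_square algebra_simps)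
  also have "d * b * q y / c + q y = (d * b + c) * q y / c" using c_pos by (simp add: field_simps)
  also have "d * b + c = 1" by (simp add: c_def)
  finally show ?thesis by simp
qed

text \<open>Substituting \<open>ln x = ln (b - s) + ln (q y / c)\<close> turns the coefficient
  \<open>l - 1\<close> of \<open>eta (b - s)\<close> into -1 and merges the remaining multiples of
  \<open>ln (q y / c)\<close>, so \<open>x\<close> disappears.\<close>

lemma B_eq: assumes "0 < y" "y < y1"
  shows "B y = (real l - 1) * (2 * eta (sy y) + eta (1 - b - sy y)) - eta (b - sy y)
    + real l / real d * (c + d * sy y) * ln (q y / c) - 2 * real l * sy y * ln y"
proof -
  have qc: "q y / c > 0" using pqS[of y] c_pos assms by simp
  have lx: "ln (xy y) = ln (b - sy y) + ln (q y / c)"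
    using range[OF assms] ln_mult_pos[OF _ qc, of "b - sy y"] by (simp add: xy_def)
  have e: "real l / real d * (c + d * sy y) = real l / real d - l * (b - sy y)"
    using d2 by (simp add: c_def field_simps)
  show ?thesis
    unfolding B_def overlap_exponent_def lx e block_sum_eq[OF less_imp_le[OF assms(1)]]
    by (simp add: eta_def algebra_simps)
qed

lemma B_deriv: assumes y: "0 < y" "y < y1" shows "(B has_real_derivative dsy y * K y) (at y)"
proof -
  define k where "k = real l / real d"
  have kd: "k * d = l" using d2 by (simp add: k_def)
  define B' where "B' y = (real l - 1) * (2 * eta (sy y) + eta (1 - b - sy y)) - eta (b - sy y)
    + k * (c + d * sy y) * ln (q y / c) - 2 * real l * sy y * ln y" for y
  note r = range[OF y]
  have pq: "p y > 0" "q y > 0" using pqS y by auto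
  have qd: "(q has_real_derivative d) (at y)"
    unfolding q_def[abs_def] by (auto intro!: derivative_eq_intros)
  have sd: "(sy has_real_derivative dsy y) (at y)" using sy_deriv y by simp
  have "(B' has_real_derivative
     (real l - 1) * (2 * ((ln (sy y) + 1) * dsy y) + (ln (1 - b - sy y) + 1) * (- dsy y))
     - (ln (b - sy y) + 1) * (- dsy y)
     + k * (d * dsy y * ln (q y / c) + (c + d * sy y) * (d / q y))
     - 2 * real l * (dsy y * ln y + sy y * (1 / y))) (at y)" (is "(B' has_real_derivative ?D) (at y)")
    unfolding B'_def[abs_def] using r y pq c_pos
    by (auto intro!: derivative_eq_intros qd sd) (simp add: algebra_simps add_divide_distrib)
  also have "?D = dsy y * (ln (b - sy y) + 2 * (real l - 1) * ln (sy y) - (real l - 1) * ln (1 - b - sy y)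
       + l * ln (q y / c) - 2 * real l * ln y)
     + l * (dsy y + (c + d * sy y) / q y - 2 * sy y / y)"
    
    by (simp add: kd[symmetric] algebra_simps add_divide_distrib)
  \<comment> \<open>The part of the derivative without logarithms vanishes identically on the curve.
    In the logarithmic part, \<open>q y / c = y * p y / sy y\<close> then produces
    \<open>K y\<close>.\<close>
  also have "dsy y + (c + d * sy y) / q y - 2 * sy y / y = 0"
  proof -
    have "dsy y + (c + d * sy y) / q y - 2 * sy y / y
       = c / (q y)\<^sup>2 * (S y + q y + d * y * p y - 2 * p y * q y)"
      using pq y by (simp add: dsy_def sy_def power2_eq_square field_simps)
    also have "S y + q y + d * y * p y - 2 * p y * q y = 0"
      by (simp add: p_def q_def S_def power2_eq_square algebra_simps)
    finally show ?thesis by simp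
  qed
  also have "ln (q y / c) = ln y + ln (p y) - ln (sy y)"
  proof -
    have "q y / c = y * p y / sy y" using pq c_pos y by (simp add: sy_def)
    then show ?thesis using y pq r by (simp add: ln_mult ln_div)
  qed
  finally have "(B' has_real_derivative dsy y * K y) (at y)"
    by (simp add: K_def algebra_simps)
  moreover have "eventually (\<lambda>y. y \<in> {0<..<y1}) (nhds y)"
    using y by (intro eventually_nhds_in_open) auto
  then have "eventually (\<lambda>y. B y = B' y) (nhds y)"
    by eventually_elim (simp add: B_eq B'_def k_def)
  ultimately show ?thesis by (subst DERIV_cong_ev[OF refl _ refl])
qed

text \<open>At \<open>s = b * (1 - b)\<close> the three fractions are the products
  \<open>b * b\<close>, \<open>b * (1 - b)\<close> and \<open>(1 - b) * (1 - b)\<close>, as for two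
  independent sets of density \<open>b\<close>; every \<open>eta\<close> splits and the sum
  collapses to twice the first moment exponent.\<close>

lemma B_y0: "B y0 = 2 * Phi d l b"
proof -
  have lq: "ln (q y0 / c) = - 2 * ln c" using c_pos by (simp add: q_y0 ln_div ln_mult)
  have ly: "ln y0 = ln b - ln c" using b_pos c_pos by (simp add: y0_def ln_div)
  have e: "1 - b - b * (1 - b) = (1 - b) * (1 - b)" "b - b * (1 - b) = b * b" by (simp_all add: algebra_simps)
  have "B y0 = (real l - 1) * (2 * eta (b * (1 - b)) + eta ((1 - b) * (1 - b))) - eta (b * b)
     + real l / real d * (c + d * (b * (1 - b))) * (- 2 * ln c) - 2 * l * (b * (1 - b)) * (ln b - ln c)"
    unfolding B_eq[OF y0_pos y0_less] sy_y0 lq ly e by simp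
  also have "2 * eta (b * (1 - b)) + eta ((1 - b) * (1 - b)) = 2 * b * (1 - b) * ln b + 2 * (1 - b) * ln (1 - b)"
    using b_pos b_half by (simp add: eta_mult) (simp add: eta_def algebra_simps)
  also have "eta (b * b) = 2 * b\<^sup>2 * ln b" using b_pos by (simp add: eta_def ln_mult power2_eq_square)
  also have "real l / real d * (c + d * (b * (1 - b))) = real l / real d * c + l * (b * (1 - b))"
    using d2 by (simp add: field_simps)
  finally show ?thesis
    unfolding Phi_def c_def[symmetric] by (simp add: power2_eq_square algebra_simps)
qed

lemma B_le: assumes "0 < y" "y < y1" shows "B y \<le> 2 * Phi d l b"
proof -
  have "B y \<le> B y0"
  proof (cases "y < y0")
    case True
    show ?thesis
    proof (rule DERIV_nonneg_imp_nondecreasing[of y y0 B])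
      fix z assume z: "y \<le> z" "z \<le> y0"
      then have "K z \<ge> 0" using K_sign(1)[of z] K_y0 assms by (cases "z = y0") auto
      then have "dsy z * K z \<ge> 0" using dsy_pos[of z] z assms by simp
      moreover have "(B has_real_derivative dsy z * K z) (at z)"
        using z assms y0_less by (intro B_deriv) auto
      ultimately show "\<exists>D. (B has_real_derivative D) (at z) \<and> 0 \<le> D" by blast
    qed (use True in simp)
  next
    case False
    show ?thesis
    proof (rule DERIV_nonpos_imp_nonincreasing[of y0 y B])
      fix z assume z: "y0 \<le> z" "z \<le> y"
      then have "K z \<le> 0" using K_sign(2)[of z] K_y0 assms by (cases "z = y0") auto
      then have "dsy z * K z \<le> 0" using dsy_pos[of z] z y0_pos by (simp add: mult_nonneg_nonpos)
      moreover have "(B has_real_derivative dsy z * K z) (at z)"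
        using z assms y0_pos by (intro B_deriv) auto
      ultimately show "\<exists>D. (B has_real_derivative D) (at z) \<and> D \<le> 0" by blast
    qed (use False in simp)
  qed
  then show ?thesis by (simp add: B_y0)
qed


section \<open>A bound uniform in the overlap, including both extreme overlaps\<close>

lemma xy_0: "xy 0 = b / c" by (simp add: xy_def q_def)

lemma xy_cont: "y \<ge> 0 \<Longrightarrow> isCont xy y"
  unfolding xy_def[abs_def] q_def[abs_def] using c_pos sy_cont by (intro continuous_intros) auto

definition "H s = eta (b - s) + 2 * eta s + eta (1 - b - s)"

lemma H_cont: "continuous_on {0..b} H"
  unfolding H_def[abs_def] using b_half by (intro continuous_intros) auto

text \<open>For fixed \<open>x\<close> and \<open>y\<close> the exponent is an affine function of
  \<open>s\<close> plus a multiple of the continuous function \<open>H\<close>. This transfers the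
  bound at a point of the curve to a nearby end point while \<open>x\<close> and \<open>y\<close>
  stay put.\<close>

lemma overlap_exponent_diff:
  "overlap_exponent d l b s x y - overlap_exponent d l b s' x y
    = (real l - 1) * (H s - H s') + real l * (s - s') * (ln x - 2 * ln y)"
  by (simp add: overlap_exponent_def H_def algebra_simps)

lemma H_sy_tendsto:
  assumes F: "F = at_right 0 \<and> z = 0 \<or> F = at_left y1 \<and> z = y1"
  shows "((\<lambda>y. H (sy y)) \<longlongrightarrow> H (sy z)) F"
proof -
  have "continuous_on {0..y1} sy" by (intro continuous_at_imp_continuous_on ballI sy_cont) auto
  moreover have "sy ` {0..y1} \<subseteq> {0..b}"
    using sy_pos sy_less[of _ y1] y1 b_pos by (force simp: le_less)
  ultimately have "continuous_on {0..y1} (\<lambda>y. H (sy y))"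
    by (intro continuous_on_compose2[OF H_cont])
  then have "((\<lambda>y. H (sy y)) \<longlongrightarrow> H (sy z)) (at z within {0..y1})"
    using F y1 by (auto simp: continuous_on)
  then show ?thesis
    using F at_within_Icc_at_right[of 0 y1] at_within_Icc_at_left[of 0 y1] y1 by auto
qed

text \<open>
  For \<open>s = 0\<close> and \<open>s = b\<close> the infimum over \<open>x, y > 0\<close> is not attained, so these two cases are
  approximated along the curve.
\<close>

lemma overlap_exponent_0:
  assumes "e > 0" obtains y where "0 < y" "y < y1" "overlap_exponent d l b 0 (xy y) y < 2 * Phi d l b + e"
proof -
  have "isCont (\<lambda>y. real l * sy y * ln (xy y)) 0"
    using xy_0 b_pos c_pos by (intro continuous_intros sy_cont xy_cont) auto
  then have "((\<lambda>y. real l * sy y * ln (xy y)) \<longlongrightarrow> 0) (at_right 0)"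
    unfolding continuous_at by (simp add: filterlim_at_split)
  then have "((\<lambda>y. (real l - 1) * (H 0 - H (sy y)) - real l * sy y * ln (xy y))
      \<longlongrightarrow> (real l - 1) * (H 0 - H 0) - 0) (at_right 0)"
    using H_sy_tendsto[of "at_right 0" 0] by (intro tendsto_intros) auto
  then have "eventually (\<lambda>y. (real l - 1) * (H 0 - H (sy y)) - real l * sy y * ln (xy y) < e) (at_right 0)"
    using assms by (intro order_tendstoD) auto
  moreover have "eventually (\<lambda>y. 0 < y \<and> y < min 1 y1) (at_right 0)"
    using y1 by (intro eventually_conj eventually_at_right_less eventually_at_rightI[of 0 "min 1 y1"]) auto
  ultimately obtain y where y: "0 < y" "y < 1" "y < y1"
      "(real l - 1) * (H 0 - H (sy y)) - real l * sy y * ln (xy y) < e"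
    using eventually_happens'[OF trivial_limit_at_right_real] eventually_conj by force
  have "real l * sy y * ln y \<le> 0" using range[of y] y by (simp add: mult_nonneg_nonpos)
  moreover have "overlap_exponent d l b 0 (xy y) y = B y + (real l - 1) * (H 0 - H (sy y))
      - real l * sy y * ln (xy y) + 2 * (real l * sy y * ln y)"
    using overlap_exponent_diff[of 0 "xy y" y "sy y"] by (simp add: B_def algebra_simps)
  ultimately show ?thesis using y B_le[of y] by (intro that[of y]) auto
qed

lemma overlap_exponent_b:
  assumes "e > 0" obtains y where "0 < y" "y < y1" "overlap_exponent d l b b (xy y) y < 2 * Phi d l b + e"
proof -
  have "isCont (\<lambda>y. 2 * (real l * (b - sy y) * ln y)) y1"
    using y1 by (intro continuous_intros sy_cont) auto
  then have "((\<lambda>y. 2 * (real l * (b - sy y) * ln y)) \<longlongrightarrow> 0) (at_left y1)"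
    unfolding continuous_at by (simp add: filterlim_at_split y1)
  then have "((\<lambda>y. (real l - 1) * (H b - H (sy y)) - 2 * (real l * (b - sy y) * ln y))
      \<longlongrightarrow> (real l - 1) * (H b - H b) - 0) (at_left y1)"
    using H_sy_tendsto[of "at_left y1" y1] y1 by (intro tendsto_intros) auto
  then have "eventually (\<lambda>y. (real l - 1) * (H b - H (sy y)) - 2 * (real l * (b - sy y) * ln y) < e) (at_left y1)"
    using assms by (intro order_tendstoD) auto
  moreover have "isCont xy y1" using y1 by (intro xy_cont) auto
  then have "(xy \<longlongrightarrow> 0) (at_left y1)"
    unfolding continuous_at by (simp add: filterlim_at_split y1 xy_def)
  then have "eventually (\<lambda>y. xy y < 1) (at_left y1)" by (intro order_tendstoD) auto
  moreover have "eventually (\<lambda>y. 0 < y \<and> y < y1) (at_left y1)"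
    using y1 by (intro eventually_at_leftI[of 0]) auto
  ultimately have "eventually (\<lambda>y. (real l - 1) * (H b - H (sy y)) - 2 * (real l * (b - sy y) * ln y) < e
      \<and> xy y < 1 \<and> 0 < y \<and> y < y1) (at_left y1)"
    by eventually_elim simp
  then obtain y where y: "0 < y" "y < y1" "xy y < 1"
      "(real l - 1) * (H b - H (sy y)) - 2 * (real l * (b - sy y) * ln y) < e"
    using eventually_happens'[OF trivial_limit_at_left_real] by blast
  have "real l * (b - sy y) * ln (xy y) \<le> 0"
    using range[of y] y xy_pos[of y] by (simp add: mult_nonneg_nonpos)
  moreover have "overlap_exponent d l b b (xy y) y = B y + (real l - 1) * (H b - H (sy y))
      - 2 * (real l * (b - sy y) * ln y) + real l * (b - sy y) * ln (xy y)"
    using overlap_exponent_diff[of b "xy y" y "sy y"] by (simp add: B_def algebra_simps)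
  ultimately show ?thesis using y B_le[of y] by (intro that[of y]) auto
qed

lemma xy_le: assumes "0 < y" "y < y1" shows "xy y \<le> q y1 / c"
proof -
  have "(b - sy y) * q y \<le> 1 * q y1"
    using range[OF assms] pqS(2)[of y] assms d2 b_half
    by (intro mult_mono) (auto simp: q_def)
  then show ?thesis using c_pos by (simp add: xy_def divide_right_mono)
qed

text \<open>The bound \<open>X\<close> does not depend on \<open>s\<close>. Replacing the density by
  a rounded one changes the exponent by a small positive multiple of \<open>ln x\<close>, so a
  common upper bound on \<open>x\<close> is what makes the rounding error uniform over all
  overlaps.\<close>

lemma overlap_exponent_bound:
  assumes "e > 0"
  obtains X where "X > 0"
    "\<And>s. 0 \<le> s \<Longrightarrow> s \<le> b \<Longrightarrow>
       \<exists>x y. 0 < x \<and> x \<le> X \<and> 0 < y \<and> overlap_exponent d l b s x y \<le> 2 * Phi d l b + e"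
proof (rule that[of "q y1 / c"])
  show "q y1 / c > 0" using pqS(2)[of y1] y1 c_pos by simp
  fix s :: real assume s: "0 \<le> s" "s \<le> b"
  have "\<exists>y. 0 < y \<and> y < y1 \<and> overlap_exponent d l b s (xy y) y \<le> 2 * Phi d l b + e"
  proof (cases "s = 0 \<or> s = b")
    case True
    then show ?thesis
      using overlap_exponent_0[OF assms] overlap_exponent_b[OF assms] by (metis less_imp_le)
  next
    case False
    then obtain y where y: "y > 0" "sy y = s" using sy_ex[of s] s by auto
    then have "y < y1" using sy_le_iff[of y y1] y1 False s by auto
    moreover have "B y \<le> 2 * Phi d l b + e" using B_le[of y] y calculation assms by simp
    ultimately show ?thesis using y by (auto simp: B_def)
  qed
  then show "\<exists>x y. 0 < x \<and> x \<le> q y1 / c \<and> 0 < y \<and> overlap_exponent d l b s x y \<le> 2 * Phi d l b + e"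
    using xy_pos xy_le by blast
qed

end

section \<open>Colour patterns of random permutations\<close>

primrec chunks :: "nat \<Rightarrow> nat \<Rightarrow> 'a list \<Rightarrow> 'a list list" where
  "chunks d 0 xs = []"
| "chunks d (Suc n) xs = take d xs # chunks d n (drop d xs)"

lemma chunks_map: "chunks d n (map f xs) = map (map f) (chunks d n xs)"
  by (induction n arbitrary: xs) (auto simp: take_map drop_map)

lemma length_chunks [simp]: "length (chunks d n xs) = n"
  by (induction n arbitrary: xs) auto

lemma concat_chunks: "length xs = n * d \<Longrightarrow> concat (chunks d n xs) = xs"
  by (induction n arbitrary: xs) auto

lemma length_chunk: "length xs = n * d \<Longrightarrow> ch \<in> set (chunks d n xs) \<Longrightarrow> length ch = d"
proof (induction n arbitrary: xs)
  case (Suc n)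
  then show ?case using Suc.IH[of "drop d xs"] by auto
qed simp

lemma chunks_concat:
  "(\<And>ch. ch \<in> set chs \<Longrightarrow> length ch = d) \<Longrightarrow> chunks d (length chs) (concat chs) = chs"
  by (induction chs) auto

lemma finite_lists_length: "finite {xs :: 'c :: finite list. length xs = n \<and> P xs}"
  using finite_lists_length_eq[of "UNIV :: 'c set" n] by (rule rev_finite_subset) auto

text \<open>The blocks are chosen independently and the weight is multiplicative, so the sum is the
  \<open>n\<close>-th power of the sum over one block. The weights lie in a semiring because both
  real and polynomial weights are used later.\<close>

lemma sum_prod_list_chunks:
  fixes w :: "'c :: finite \<Rightarrow> 'b :: comm_semiring_1"
  shows "(\<Sum>cs | length cs = n * d \<and> (\<forall>ch \<in> set (chunks d n cs). Q ch). prod_list (map w cs))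
    = (\<Sum>ch | length ch = d \<and> Q ch. prod_list (map w ch)) ^ n"
proof (induction n)
  case 0
  have "{cs :: 'c list. length cs = 0 * d \<and> (\<forall>ch \<in> set (chunks d 0 cs). Q ch)} = {[]}" by auto
  then show ?case by simp
next
  case (Suc n)
  define A where "A = {ch :: 'c list. length ch = d \<and> Q ch}"
  define B where "B = {cs :: 'c list. length cs = n * d \<and> (\<forall>ch \<in> set (chunks d n cs). Q ch)}"
  have "{cs :: 'c list. length cs = Suc n * d \<and> (\<forall>ch \<in> set (chunks d (Suc n) cs). Q ch)}
      = (\<lambda>(a, b). a @ b) ` (A \<times> B)" (is "?L = ?R")
  proof
    show "?L \<subseteq> ?R"
    proof
      fix cs assume "cs \<in> ?L"
      then have "(take d cs, drop d cs) \<in> A \<times> B" by (auto simp: A_def B_def)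
      then show "cs \<in> ?R" by (force intro: image_eqI[of _ _ "(take d cs, drop d cs)"])
    qed
  qed (auto simp: A_def B_def)
  moreover have "inj_on (\<lambda>(a, b). a @ b) (A \<times> B)" by (auto simp: inj_on_def A_def)
  ultimately have "(\<Sum>cs | length cs = Suc n * d \<and> (\<forall>ch \<in> set (chunks d (Suc n) cs). Q ch). prod_list (map w cs))
      = (\<Sum>(a, b)\<in>A \<times> B. prod_list (map w a) * prod_list (map w b))"
    by (simp add: sum.reindex case_prod_unfold)
  also have "\<dots> = (\<Sum>a\<in>A. prod_list (map w a)) * (\<Sum>b\<in>B. prod_list (map w b))"
    by (simp add: sum_product sum.cartesian_product)
  finally show ?case using Suc by (simp add: A_def B_def)
qed

lemma sum_lists_Suc:
  fixes f :: "'c :: finite list \<Rightarrow> 'b :: comm_monoid_add"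
  shows "(\<Sum>cs | length cs = Suc n \<and> P cs. f cs) = (\<Sum>c\<in>UNIV. \<Sum>cs | length cs = n \<and> P (c # cs). f (c # cs))"
proof -
  have "{cs. length cs = Suc n \<and> P cs} = (\<lambda>(c, cs). c # cs) ` (SIGMA c:UNIV. {cs. length cs = n \<and> P (c # cs)})"
    by (force simp: length_Suc_conv)
  moreover have "inj_on (\<lambda>(c, cs). c # cs) (SIGMA c:UNIV. {cs. length cs = n \<and> P (c # cs)})"
    by (auto simp: inj_on_def)
  ultimately have "(\<Sum>cs | length cs = Suc n \<and> P cs. f cs)
      = (\<Sum>(c, cs)\<in>(SIGMA c:UNIV. {cs. length cs = n \<and> P (c # cs)}). f (c # cs))"
    by (simp add: sum.reindex case_prod_unfold)
  then show ?thesis by (simp add: sum.Sigma finite_lists_length)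
qed

text \<open>A half-edge is coloured by the membership of its hyperedge in a first and in a second
  set; the predicate says that one vertex is compatible with both sets being matchings.\<close>

definition sparse_pair :: "(bool \<times> bool) list \<Rightarrow> bool" where
  "sparse_pair ch \<longleftrightarrow> length (filter fst ch) \<le> 1 \<and> length (filter snd ch) \<le> 1"

text \<open>The admissible blocks have no mark, one double mark, one single mark of either kind, or
  one single mark of each kind at two distinct positions, with \<open>d * (d - 1)\<close> choices.
  The recursion over positions keeps track in \<open>p\<close> and \<open>q\<close> of how many
  marks of each kind are still allowed.\<close>

lemma sum_sparse_pair:
  fixes w :: "bool \<times> bool \<Rightarrow> 'b :: comm_semiring_1"
  assumes "w (False, False) = 1"
  shows "(\<Sum>ch | length ch = d \<and> sparse_pair ch. prod_list (map w ch))
    = 1 + of_nat d * w (True, True) + of_nat d * w (True, False) + of_nat d * w (False, True)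
      + of_nat (d * (d - 1)) * (w (True, False) * w (False, True))"
proof -
  define s where "s d p q = (\<Sum>ch | length ch = d \<and> length (filter fst ch) \<le> p \<and> length (filter snd ch) \<le> q.
    prod_list (map w ch))" for d p q
  have U: "(UNIV :: (bool \<times> bool) set) = {(False, False), (False, True), (True, False), (True, True)}"
    by auto
  have s0: "s 0 p q = 1" for p q
  proof -
    have "{ch :: (bool \<times> bool) list. length ch = 0 \<and> length (filter fst ch) \<le> p \<and> length (filter snd ch) \<le> q} = {[]}"
      by auto
    then show ?thesis by (simp add: s_def)
  qed
  have z: "(\<Sum>ch | length ch = d \<and> \<not> True. f ch) = 0" for f :: "(bool \<times> bool) list \<Rightarrow> 'b" and d by simp
  have s00: "s d 0 0 = 1" for d
    by (induction d) (simp_all add: s0, simp add: s_def sum_lists_Suc U assms z)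
  have s10: "s d 1 0 = 1 + of_nat d * w (True, False)" for d
  proof (induction d)
    case (Suc d)
    have "s (Suc d) 1 0 = s d 1 0 + w (True, False) * s d 0 0"
      by (simp add: s_def sum_lists_Suc U assms z sum_distrib_left)
    then show ?case using Suc s00 by (simp add: algebra_simps)
  qed (simp add: s0)
  have s01: "s d 0 1 = 1 + of_nat d * w (False, True)" for d
  proof (induction d)
    case (Suc d)
    have "s (Suc d) 0 1 = s d 0 1 + w (False, True) * s d 0 0"
      by (simp add: s_def sum_lists_Suc U assms z sum_distrib_left)
    then show ?case using Suc s00 by (simp add: algebra_simps)
  qed (simp add: s0)
  have "s d 1 1 = 1 + of_nat d * w (True, True) + of_nat d * w (True, False) + of_nat d * w (False, True)
      + of_nat (d * (d - 1)) * (w (True, False) * w (False, True))"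
  proof (induction d)
    case (Suc d)
    have "s (Suc d) 1 1 = s d 1 1 + w (False, True) * s d 1 0 + w (True, False) * s d 0 1 + w (True, True) * s d 0 0"
      by (simp add: s_def sum_lists_Suc U assms z sum_distrib_left add_ac)
    moreover define k where "k = d * (d - 1)"
    have "Suc d * (Suc d - 1) = k + d + d" by (cases d) (auto simp: k_def)
    ultimately show ?case using Suc s00 s10 s01 unfolding k_def[symmetric] by (simp add: algebra_simps)
  qed (simp add: s0)
  then show ?thesis by (simp add: s_def sparse_pair_def)
qed

section \<open>Permutations with a prescribed colour pattern\<close>

lemma prod_list_count_list:
  fixes w :: "'c :: finite \<Rightarrow> 'b :: comm_semiring_1"
  shows "prod_list (map w cs) = (\<Prod>c\<in>UNIV. w c ^ count_list cs c)"
proof (induction cs)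
  case (Cons a cs)
  have "(\<Prod>c\<in>UNIV. w c ^ count_list (a # cs) c) = (\<Prod>c\<in>UNIV. (if c = a then w c else 1) * w c ^ count_list cs c)"
    by (intro prod.cong) auto
  then show ?case using Cons by (simp add: prod.distrib prod.delta)
qed simp

text \<open>A permutation with a given colour pattern amounts to an ordering of each colour class.
  In the induction the head is any element of the class of \<open>c\<close>, and the factor
  \<open>card Ac\<close> completes the factorial of that class.\<close>

lemma card_permutations_with_colours:
  fixes colour :: "'a \<Rightarrow> 'c :: finite"
  assumes "finite A" and "\<And>c. count_list cs c = card {a \<in> A. colour a = c}"
  shows "card {xs \<in> permutations_of_set A. map colour xs = cs} = (\<Prod>c\<in>UNIV. fact (card {a \<in> A. colour a = c}))"
  using assms
proof (induction cs arbitrary: A)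
  case Nil
  have "{a \<in> A. colour a = c} = {}" for c using Nil(1) Nil(2)[of c] by simp
  then have "A = {}" by blast
  then show ?case by simp
next
  case (Cons c cs)
  define Ac where "Ac = {a \<in> A. colour a = c}"
  have Ac: "finite Ac" "card Ac = Suc (count_list cs c)" using Cons(2) Cons(3)[of c] by (auto simp: Ac_def)
  define F where "F x = {xs \<in> permutations_of_set (A - {x}). map colour xs = cs}" for x
  have eq: "{xs \<in> permutations_of_set A. map colour xs = c # cs} = (\<Union>x\<in>Ac. (#) x ` F x)"
  proof (intro equalityI subsetI)
    fix xs assume xs: "xs \<in> {xs \<in> permutations_of_set A. map colour xs = c # cs}"
    then obtain x ys where e: "xs = x # ys" by (cases xs) auto
    with xs have "distinct ys" "x \<notin> set ys" "A = insert x (set ys)" "colour x = c" "map colour ys = cs"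
      by (simp_all add: permutations_of_set_def)
    then have "x \<in> Ac" "ys \<in> F x" by (simp_all add: Ac_def F_def permutations_of_set_def)
    then show "xs \<in> (\<Union>x\<in>Ac. (#) x ` F x)" using e by blast
  next
    fix xs assume "xs \<in> (\<Union>x\<in>Ac. (#) x ` F x)"
    then obtain x ys where e: "xs = x # ys" "x \<in> Ac" "ys \<in> F x" by blast
    then have "set ys = A - {x}" "distinct ys" "map colour ys = cs" "x \<in> A" "colour x = c"
      by (simp_all add: Ac_def F_def permutations_of_set_def)
    then show "xs \<in> {xs \<in> permutations_of_set A. map colour xs = c # cs}"
      using e by (simp add: permutations_of_set_def insert_absorb)
  qed
  have cF: "card (F x) = fact (count_list cs c) * (\<Prod>c'\<in>UNIV - {c}. fact (card {a \<in> A. colour a = c'}))"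
    if "x \<in> Ac" for x
  proof -
    have cnt: "count_list cs c' = card {a \<in> A - {x}. colour a = c'}" for c'
    proof (cases "c' = c")
      case True
      have "{a \<in> A - {x}. colour a = c} = Ac - {x}" by (auto simp: Ac_def)
      then show ?thesis using True Ac that by simp
    next
      case False
      have "{a \<in> A - {x}. colour a = c'} = {a \<in> A. colour a = c'}"
        using False that by (auto simp: Ac_def)
      then show ?thesis using Cons(3)[of c'] False by simp
    qed
    have "card (F x) = (\<Prod>c'\<in>UNIV. fact (card {a \<in> A - {x}. colour a = c'}))"
      unfolding F_def by (rule Cons.IH) (use Cons(2) cnt in auto)
    also have "\<dots> = (\<Prod>c'\<in>UNIV. fact (count_list cs c'))" by (simp only: cnt)
    also have "\<dots> = fact (count_list cs c) * (\<Prod>c'\<in>UNIV - {c}. fact (count_list cs c'))"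
      by (simp add: prod.remove[of UNIV c])
    also have "(\<Prod>c'\<in>UNIV - {c}. fact (count_list cs c'))
        = (\<Prod>c'\<in>UNIV - {c}. fact (card {a \<in> A. colour a = c'}) :: nat)"
    proof (intro prod.cong refl)
      fix c' assume "c' \<in> UNIV - {c}"
      then show "fact (count_list cs c') = fact (card {a \<in> A. colour a = c'})"
        using Cons(3)[of c'] by simp
    qed
    finally show ?thesis .
  qed
  have "card (\<Union>x\<in>Ac. (#) x ` F x) = (\<Sum>x\<in>Ac. card ((#) x ` F x))"
    using Ac by (intro card_UN_disjoint) (auto simp: F_def)
  also have "\<dots> = (\<Sum>x\<in>Ac. card (F x))" by (simp add: card_image)
  also have "\<dots> = card Ac * (fact (count_list cs c) * (\<Prod>c'\<in>UNIV - {c}. fact (card {a \<in> A. colour a = c'})))"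
    using cF by simp
  also have "\<dots> = fact (card Ac) * (\<Prod>c'\<in>UNIV - {c}. fact (card {a \<in> A. colour a = c'}))"
    by (simp add: Ac algebra_simps)
  also have "\<dots> = (\<Prod>c'\<in>UNIV. fact (card {a \<in> A. colour a = c'}))"
    by (simp add: prod.remove[of UNIV c] Ac_def)
  finally show ?case unfolding eq .
qed

lemma count_list_map_permutation:
  assumes "xs \<in> permutations_of_set A"
  shows "count_list (map colour xs) c = card {a \<in> A. colour a = c}"
proof -
  have xs: "set xs = A" "distinct xs" using assms by (auto simp: permutations_of_set_def)
  have "count_list (map colour xs) c = length (filter (\<lambda>a. colour a = c) xs)"
    by (induction xs) auto
  also have "\<dots> = card (set (filter (\<lambda>a. colour a = c) xs))"
    using xs by (intro distinct_card[symmetric]) simp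
  also have "set (filter (\<lambda>a. colour a = c) xs) = {a \<in> A. colour a = c}" using xs by auto
  finally show ?thesis .
qed

text \<open>Separates the two sources of permutations: the colour patterns, where the property is
  decided, and the orderings inside the colour classes, whose number is the same for all
  patterns.\<close>

lemma card_permutations_colour_property:
  fixes colour :: "'a \<Rightarrow> 'c :: finite"
  assumes "finite A"
  shows "card {xs \<in> permutations_of_set A. R (map colour xs)}
    = card {cs. length cs = card A \<and> R cs \<and> (\<forall>c. count_list cs c = card {a \<in> A. colour a = c})}
      * (\<Prod>c\<in>UNIV. fact (card {a \<in> A. colour a = c}))"
proof -
  define T where "T = {cs. length cs = card A \<and> R cs \<and> (\<forall>c. count_list cs c = card {a \<in> A. colour a = c})}"
  have "finite T" unfolding T_def by (rule finite_lists_length)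
  have "{xs \<in> permutations_of_set A. R (map colour xs)}
      = (\<Union>cs\<in>T. {xs \<in> permutations_of_set A. map colour xs = cs})"
    using count_list_map_permutation
    by (auto simp: T_def length_finite_permutations_of_set)
  then have "card {xs \<in> permutations_of_set A. R (map colour xs)}
      = (\<Sum>cs\<in>T. card {xs \<in> permutations_of_set A. map colour xs = cs})"
    using \<open>finite T\<close> by (simp only:) (rule card_UN_disjoint, auto)
  also have "\<dots> = (\<Sum>cs\<in>T. \<Prod>c\<in>UNIV. fact (card {a \<in> A. colour a = c}))"
    by (intro sum.cong refl card_permutations_with_colours[OF assms]) (auto simp: T_def)
  finally show ?thesis by (simp add: T_def)
qed

section \<open>Colour patterns of pairs of matchings\<close>

lemma hyperedge_of_iff:
  assumes "l > 0" "e > 0"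
  shows "hyperedge_of l i = e \<longleftrightarrow> l * (e - 1) < i \<and> i \<le> l * e"
proof -
  have "hyperedge_of l i = e \<longleftrightarrow> \<lceil>real i / real l\<rceil> = int e"
  proof -
    have "nat c = e \<longleftrightarrow> c = int e" for c
    proof
      assume *: "nat c = e"
      then have "0 < c" using assms(2) zero_less_nat_eq[of c] by metis
      then show "c = int e" using * by (metis int_nat_eq less_imp_le)
    qed simp
    then show ?thesis unfolding hyperedge_of_def .
  qed
  also have "\<dots> \<longleftrightarrow> real e - 1 < real i / real l \<and> real i / real l \<le> real e"
    by (simp add: ceiling_eq_iff)
  also have "\<dots> \<longleftrightarrow> real (l * (e - 1)) < real i \<and> real i \<le> real (l * e)"
  proof -
    have "real (l * (e - 1)) = real l * (real e - 1)" using assms by (simp add: of_nat_diff)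
    then show ?thesis using assms by (simp add: pos_less_divide_eq pos_divide_le_eq mult.commute)
  qed
  finally show ?thesis by (simp only: of_nat_less_iff of_nat_le_iff)
qed

lemma card_half_edges:
  assumes "l > 0" "M \<subseteq> {1..m}"
  shows "card {i \<in> {1..l * m}. hyperedge_of l i \<in> M} = l * card M"
proof -
  have fin: "finite M" using assms(2) by (rule finite_subset) simp
  have "card {i \<in> {1..l * m}. hyperedge_of l i = e} = l" if "e \<in> M" for e
  proof -
    have e: "e > 0" "e \<le> m" using that assms(2) by auto
    then have le: "l * e \<le> l * m" by simp
    have "i \<in> {1..l * m} \<and> l * (e - 1) < i \<and> i \<le> l * e \<longleftrightarrow> l * (e - 1) < i \<and> i \<le> l * e" for i
      using le unfolding atLeastAtMost_iff by linarith
    then have "{i \<in> {1..l * m}. hyperedge_of l i = e} = {l * (e - 1)<..l * e}"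
      unfolding hyperedge_of_iff[OF assms(1) e(1)] greaterThanAtMost_def greaterThan_def atMost_def
      by (simp only: Int_def mem_Collect_eq)
    then show ?thesis using e by (cases e) auto
  qed
  moreover have "{i \<in> {1..l * m}. hyperedge_of l i \<in> M} = (\<Union>e\<in>M. {i \<in> {1..l * m}. hyperedge_of l i = e})"
    by blast
  moreover have "card (\<Union>e\<in>M. {i \<in> {1..l * m}. hyperedge_of l i = e})
      = (\<Sum>e\<in>M. card {i \<in> {1..l * m}. hyperedge_of l i = e})"
    using fin by (intro card_UN_disjoint) auto
  ultimately show ?thesis by simp
qed

definition matches :: "nat \<Rightarrow> nat \<Rightarrow> nat \<Rightarrow> nat set \<Rightarrow> nat list \<Rightarrow> bool" where
  "matches d l n M xs \<longleftrightarrow> (\<forall>ch \<in> set (chunks d n xs). length (filter (\<lambda>i. hyperedge_of l i \<in> M) ch) \<le> 1)"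

lemma matches_pair_iff:
  "matches d l n M1 xs \<and> matches d l n M2 xs \<longleftrightarrow>
    (\<forall>ch \<in> set (chunks d n (map (\<lambda>i. (hyperedge_of l i \<in> M1, hyperedge_of l i \<in> M2)) xs)). sparse_pair ch)"
  by (auto simp: matches_def sparse_pair_def chunks_map filter_map comp_def)

context
  fixes d l m n :: nat and M1 M2 :: "nat set"
  assumes l: "l > 0" and dn: "d * n = l * m" and M: "M1 \<subseteq> {1..m}" "M2 \<subseteq> {1..m}"
begin

definition "colour i = (hyperedge_of l i \<in> M1, hyperedge_of l i \<in> M2)"

lemma card_colour:
  "card {i \<in> {1..l * m}. colour i = (True, True)} = l * card (M1 \<inter> M2)"
  "card {i \<in> {1..l * m}. colour i = (True, False)} = l * card (M1 - M2)"
  "card {i \<in> {1..l * m}. colour i = (False, True)} = l * card (M2 - M1)"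
  "card {i \<in> {1..l * m}. colour i = (False, False)} = l * card ({1..m} - (M1 \<union> M2))"
proof -
  have h: "hyperedge_of l i \<in> {1..m}" if "i \<in> {1..l * m}" for i
  proof -
    have "0 < real i / real l" "real i / real l \<le> real m"
      using that l by (auto simp: pos_divide_le_eq mult.commute simp flip: of_nat_mult)
    then show ?thesis by (auto simp: hyperedge_of_def le_nat_iff ceiling_le_iff nat_le_iff Suc_le_eq)
  qed
  show "card {i \<in> {1..l * m}. colour i = (True, True)} = l * card (M1 \<inter> M2)"
    using card_half_edges[OF l, of "M1 \<inter> M2" m] M by (simp add: colour_def Int_def subset_iff)
  show "card {i \<in> {1..l * m}. colour i = (True, False)} = l * card (M1 - M2)"
    using card_half_edges[OF l, of "M1 - M2" m] M by (simp add: colour_def subset_iff)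
  show "card {i \<in> {1..l * m}. colour i = (False, True)} = l * card (M2 - M1)"
    using card_half_edges[OF l, of "M2 - M1" m] M by (simp add: colour_def subset_iff conj_commute)
  have "{i \<in> {1..l * m}. colour i = (False, False)}
      = {i \<in> {1..l * m}. hyperedge_of l i \<in> {1..m} - (M1 \<union> M2)}"
    using h by (auto simp: colour_def)
  then show "card {i \<in> {1..l * m}. colour i = (False, False)} = l * card ({1..m} - (M1 \<union> M2))"
    using card_half_edges[OF l, of "{1..m} - (M1 \<union> M2)" m] by simp
qed

lemma prod_colours:
  fixes f :: "bool \<times> bool \<Rightarrow> 'b :: comm_monoid_mult"
  shows "(\<Prod>c\<in>UNIV. f c) = f (True, True) * f (True, False) * f (False, True) * f (False, False)"
proof -
  have U: "(UNIV :: (bool \<times> bool) set) = {(True, True), (True, False), (False, True), (False, False)}" by auto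
  show ?thesis unfolding U by (simp add: mult_ac)
qed

definition "patterns = {cs. length cs = n * d \<and> (\<forall>ch \<in> set (chunks d n cs). sparse_pair ch)
    \<and> (\<forall>c. count_list cs c = card {i \<in> {1..l * m}. colour i = c})}"

lemma card_all_half_edges: "card {1..l * m} = n * d"
  by (simp add: dn[symmetric])

lemma card_matches_pair:
  "card {xs \<in> permutations_of_set {1..l * m}. matches d l n M1 xs \<and> matches d l n M2 xs}
    = card patterns * (fact (l * card (M1 \<inter> M2)) * fact (l * card (M1 - M2)) * fact (l * card (M2 - M1))
        * fact (l * card ({1..m} - (M1 \<union> M2))))"
  unfolding matches_pair_iff colour_def[symmetric]
  using card_permutations_colour_property[OF finite_atLeastAtMost, of 1 "l * m" "\<lambda>cs. \<forall>ch \<in> set (chunks d n cs). sparse_pair ch" colour]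
  unfolding prod_colours card_colour card_all_half_edges patterns_def[symmetric] by (simp only: mult.assoc)

text \<open>All patterns carry the same monomial as weight, and they occur among the nonnegative
  terms of the \<open>n\<close>-th power of the generating function of one vertex. The two singly
  marked colours share the weight \<open>y\<close> because the two differences have equal
  size.\<close>

lemma card_patterns_le:
  fixes x y :: real
  assumes "x \<ge> 0" "y \<ge> 0" "card (M1 - M2) = b" "card (M2 - M1) = b"
  shows "card patterns * (x ^ (l * card (M1 \<inter> M2)) * y ^ (2 * l * b))
    \<le> (1 + real d * x + 2 * real d * y + real (d * (d - 1)) * y\<^sup>2) ^ n"
proof -
  define w where "w = (\<lambda>c :: bool \<times> bool. if fst c then if snd c then x else y else if snd c then y else 1)"
  have w: "w (True, True) = x" "w (True, False) = y" "w (False, True) = y" "w (False, False) = 1"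
    by (simp_all add: w_def)
  have w0: "w c \<ge> 0" for c using assms by (simp add: w_def)
  have fin: "finite {cs :: (bool \<times> bool) list. length cs = n * d \<and> (\<forall>ch \<in> set (chunks d n cs). sparse_pair ch)}"
    by (rule finite_lists_length)
  have "card patterns * (x ^ (l * card (M1 \<inter> M2)) * y ^ (2 * l * b))
      = (\<Sum>cs\<in>patterns. \<Prod>c\<in>UNIV. w c ^ count_list cs c)"
  proof -
    have "(\<Prod>c\<in>UNIV. w c ^ count_list cs c) = x ^ (l * card (M1 \<inter> M2)) * y ^ (2 * l * b)" if "cs \<in> patterns" for cs
    proof -
      have "count_list cs c = card {i \<in> {1..l * m}. colour i = c}" for c
        using that unfolding patterns_def by blast
      then show ?thesis
        by (simp only: prod_colours card_colour w assms)
          (simp add: power_mult power2_eq_square flip: power_mult_distrib)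
    qed
    then show ?thesis by simp
  qed
  also have "\<dots> = (\<Sum>cs\<in>patterns. prod_list (map w cs))" by (simp add: prod_list_count_list)
  also have "\<dots> \<le> (\<Sum>cs | length cs = n * d \<and> (\<forall>ch \<in> set (chunks d n cs). sparse_pair ch). prod_list (map w cs))"
    using fin w0 by (intro sum_mono2) (auto simp: patterns_def intro!: prod_list_nonneg)
  also have "\<dots> = (1 + real d * x + 2 * real d * y + real (d * (d - 1)) * y\<^sup>2) ^ n"
    unfolding sum_prod_list_chunks sum_sparse_pair[of w, OF w(4)] w
    by (simp add: power2_eq_square algebra_simps)
  finally show ?thesis .
qed

lemma card_patterns_single:
  assumes "M1 = M2"
  shows "card patterns = (n choose (l * card M1)) * d ^ (l * card M1)"
proof -
  \<comment> \<open>Weighting marked half-edges by an indeterminate turns the count into a coefficient of \<open>(1 + d X)\<^sup>n\<close>.\<close>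
  define w where "w = (\<lambda>c :: bool \<times> bool. if fst c then if snd c then [:0, 1 :: real:] else 0 else if snd c then 0 else 1)"
  have w: "w (True, True) = [:0, 1:]" "w (True, False) = 0" "w (False, True) = 0" "w (False, False) = 1"
    by (simp_all add: w_def)
  define k where "k = l * card M1"
  define A where "A = {cs :: (bool \<times> bool) list. length cs = n * d \<and> (\<forall>ch \<in> set (chunks d n cs). sparse_pair ch)}"
  have finA: "finite A" unfolding A_def by (rule finite_lists_length)
  have pat: "cs \<in> patterns \<longleftrightarrow> cs \<in> A \<and> count_list cs (True, True) = k \<and> count_list cs (True, False) = 0
      \<and> count_list cs (False, True) = 0" for cs
  proof -
    have eqs: "card {i \<in> {1..l * m}. colour i = (True, True)} = k"
        "card {i \<in> {1..l * m}. colour i = (True, False)} = 0"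
        "card {i \<in> {1..l * m}. colour i = (False, True)} = 0"
        "card {i \<in> {1..l * m}. colour i = (False, False)} = l * m - k"
      unfolding card_colour using assms finite_subset[OF M(1)] M(1)
      by (simp_all add: k_def card_Diff_subset diff_mult_distrib2)
    have U: "(UNIV :: (bool \<times> bool) set) = {(True, True), (True, False), (False, True), (False, False)}" by auto
    have "length cs = (\<Sum>c\<in>UNIV. count_list cs c)" by (rule sum_count_set[symmetric]) auto
    then have len: "length cs = count_list cs (True, True) + count_list cs (True, False)
        + count_list cs (False, True) + count_list cs (False, False)" by (simp add: U)
    have "card M1 \<le> m" using card_mono[OF _ M(1)] by simp
    then have "k \<le> l * m" by (simp add: k_def)
    moreover have all_colours: "(\<forall>c. P c) \<longleftrightarrow> P (True, True) \<and> P (True, False) \<and> P (False, True) \<and> P (False, False)"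
      for P :: "bool \<times> bool \<Rightarrow> bool" by (auto simp: split_paired_All all_bool_eq)
    ultimately show ?thesis
      using len unfolding patterns_def A_def mem_Collect_eq all_colours eqs
      by (auto simp: mult.commute[of n d] dn)
  qed
  have "(1 + of_nat d * [:0, 1:] :: real poly) ^ n = (\<Sum>cs\<in>A. prod_list (map w cs))"
    unfolding A_def sum_prod_list_chunks sum_sparse_pair[of w, OF w(4)] w by simp
  then have "coeff ((1 + of_nat d * [:0, 1:] :: real poly) ^ n) k = (\<Sum>cs\<in>A. coeff (prod_list (map w cs)) k)"
    by (simp add: coeff_sum)
  also have "\<dots> = (\<Sum>cs\<in>A. if cs \<in> patterns then 1 else 0)"
  proof (intro sum.cong refl)
    fix cs assume "cs \<in> A"
    have "[:0, 1 :: real:] ^ j = monom 1 j" for j by (simp add: monom_altdef)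
    then have "coeff ([:0, 1 :: real:] ^ j) k = (if j = k then 1 else 0)" for j by simp
    then show "coeff (prod_list (map w cs)) k = (if cs \<in> patterns then 1 else 0)"
      using \<open>cs \<in> A\<close> by (auto simp: prod_list_count_list prod_colours w pat power_0_left)
  qed
  also have "\<dots> = real (card patterns)"
  proof -
    have "A \<inter> {cs. cs \<in> patterns} = patterns" using pat by blast
    then show ?thesis using finA by (simp add: sum.If_cases del: Collect_mem_eq)
  qed
  also have "(1 + of_nat d * [:0, 1:] :: real poly) = [:1, real d:]" by (simp add: of_nat_poly one_pCons)
  also have "coeff ([:1, real d:] ^ n) k = real ((n choose k) * d ^ k)"
    
  proof (cases "k \<le> n")
    case False
    have "degree ([:1, real d:] ^ n) \<le> 1 * n"
      by (rule degree_power_le[THEN order_trans]) simp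
    then show ?thesis using False by (simp add: coeff_eq_0)
  qed (simp add: coeff_linear_poly_power)
  finally show ?thesis by (simp only: of_nat_eq_iff k_def)
qed

end

section \<open>Configurations as permutations, and concentration\<close>

lemma map_permutations_of_set:
  assumes "bij_betw \<sigma> A B" "xs \<in> permutations_of_set A"
  shows "map \<sigma> xs \<in> permutations_of_set B"
  using assms by (auto simp: permutations_of_set_def distinct_map bij_betw_def)

lemma inj_on_map_permutations_of_set:
  assumes "inj_on \<sigma> A"
  shows "inj_on (map \<sigma>) (permutations_of_set A)"
  using assms by (auto simp: inj_on_def[of "map \<sigma>"] permutations_of_set_def inj_on_map_eq_map)

lemma permutations_of_set_transitive:
  assumes "xs \<in> permutations_of_set A" "ys \<in> permutations_of_set A"
  obtains \<sigma> where "bij_betw \<sigma> A A" "map \<sigma> xs = ys"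
proof -
  define \<sigma> where "\<sigma> = the \<circ> map_of (zip xs ys)"
  have p: "set xs = A" "distinct xs" "set ys = A" "distinct ys"
    using assms by (auto simp: permutations_of_set_def)
  then have len: "length xs = length ys" using distinct_card by metis
  have m: "map \<sigma> xs = ys"
    using p len by (intro nth_equalityI) (auto simp: \<sigma>_def map_of_zip_nth)
  have "inj_on \<sigma> A" using p distinct_map[of \<sigma> xs] unfolding m by simp
  moreover have "\<sigma> ` A = A" using p set_map[of \<sigma> xs] unfolding m by simp
  ultimately show ?thesis using m by (intro that[of \<sigma>]) (auto simp: bij_betw_def)
qed

definition config :: "nat \<Rightarrow> nat \<Rightarrow> nat list \<Rightarrow> nat set set" where
  "config d n xs = set ` set (chunks d n xs)"

lemma config_map: "config d n (map \<sigma> xs) = (`) \<sigma> ` config d n xs"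
  by (simp add: config_def chunks_map image_image)

context
  fixes d l m n :: nat
  assumes d: "d > 0" and dn: "d * n = l * m"
begin

lemma chunks_permutation:
  assumes "xs \<in> permutations_of_set {1..l * m}"
  shows "concat (chunks d n xs) = xs" "set xs = {1..l * m}" "distinct xs"
    "\<And>ch. ch \<in> set (chunks d n xs) \<Longrightarrow> distinct ch \<and> length ch = d"
    "\<And>ch ch'. ch \<in> set (chunks d n xs) \<Longrightarrow> ch' \<in> set (chunks d n xs) \<Longrightarrow> ch \<noteq> ch' \<Longrightarrow> set ch \<inter> set ch' = {}"
    "distinct (chunks d n xs)"
proof -
  show xs: "set xs = {1..l * m}" "distinct xs" using assms by (auto simp: permutations_of_set_def)
  have "length xs = card {1..l * m}" using distinct_card[OF xs(2)] xs(1) by simp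
  also have "\<dots> = n * d" by (simp add: dn[symmetric])
  finally have len: "length xs = n * d" .
  show cc: "concat (chunks d n xs) = xs" by (rule concat_chunks[OF len])
  have dc: "distinct (concat (chunks d n xs))" using cc xs by simp
  show "distinct ch \<and> length ch = d" if "ch \<in> set (chunks d n xs)" for ch
    using that dc length_chunk[OF len that] by (simp add: distinct_concat_iff)
  show "set ch \<inter> set ch' = {}" if "ch \<in> set (chunks d n xs)" "ch' \<in> set (chunks d n xs)" "ch \<noteq> ch'" for ch ch'
    using that dc by (simp add: distinct_concat_iff)
  have "[] \<notin> set (chunks d n xs)" using length_chunk[OF len, of "[]"] d by auto
  then show "distinct (chunks d n xs)" using dc by (simp add: distinct_concat_iff removeAll_id)
qed

lemma config_in_configurations:
  assumes "xs \<in> permutations_of_set {1..l * m}"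
  shows "config d n xs \<in> configurations m d l"
proof -
  note c = chunks_permutation[OF assms]
  have "partition_on {1..l * m} (config d n xs)"
  proof (rule partition_onI)
    show "\<Union> (config d n xs) = {1..l * m}" using c(1,2) by (metis config_def set_concat)
    show "disjnt p q" if pq: "p \<in> config d n xs" "q \<in> config d n xs" "p \<noteq> q" for p q
    proof -
      obtain a b where "p = set a" "q = set b" "a \<in> set (chunks d n xs)" "b \<in> set (chunks d n xs)"
        using pq unfolding config_def by blast
      then show ?thesis using c(5)[of a b] pq(3) by (auto simp: disjnt_def)
    qed
    show "{} \<notin> config d n xs" using c(4) d by (auto simp: config_def)
  qed
  moreover have "inj_on set (set (chunks d n xs))"
  proof (rule inj_onI, rule ccontr)
    fix a b assume ab: "a \<in> set (chunks d n xs)" "b \<in> set (chunks d n xs)" "set a = set b" "a \<noteq> b"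
    then have "set a = {}" using c(5)[of a b] by simp
    then show False using c(4)[of a] ab d by simp
  qed
  then have "card (config d n xs) = n"
    using distinct_card[OF c(6)] by (simp add: config_def card_image)
  moreover have "l * m div d = n" using d by (simp flip: dn)
  moreover have "\<forall>V\<in>config d n xs. card V = d"
    using c(4) by (auto simp: config_def distinct_card)
  ultimately show ?thesis by (simp add: configurations_def)
qed

lemma config_surj:
  assumes "P \<in> configurations m d l"
  obtains xs where "xs \<in> permutations_of_set {1..l * m}" "config d n xs = P"
proof -
  have P: "partition_on {1..l * m} P" "card P = n" "\<And>V. V \<in> P \<Longrightarrow> card V = d"
    using assms d by (auto simp: configurations_def simp flip: dn)
  have Un: "\<Union> P = {1..l * m}" using P(1) by (simp add: partition_on_def)
  have finP: "finite P" using P(1) by (rule finite_elements[rotated]) simp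
  have finV: "finite V" if "V \<in> P" for V
    using that Un by (metis Union_upper finite_atLeastAtMost rev_finite_subset)
  obtain Ps where Ps: "set Ps = P" "distinct Ps" using finite_distinct_list[OF finP] by blast
  have "\<exists>f. \<forall>V\<in>P. set (f V) = V \<and> distinct (f V)"
    using finite_distinct_list finV by (intro bchoice) blast
  then obtain f where f: "\<And>V. V \<in> P \<Longrightarrow> set (f V) = V" "\<And>V. V \<in> P \<Longrightarrow> distinct (f V)" by blast
  define xs where "xs = concat (map f Ps)"
  have "length (f V) = d" if "V \<in> P" for V using that f P(3) distinct_card by metis
  then have "chunks d (length (map f Ps)) (concat (map f Ps)) = map f Ps"
    using Ps by (intro chunks_concat) auto
  moreover have "length (map f Ps) = n" using Ps P(2) distinct_card by fastforce
  ultimately have ch: "chunks d n xs = map f Ps" by (simp add: xs_def)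
  have "config d n xs = P" using f Ps by (force simp: config_def ch)
  moreover have "inj_on f P" using f by (intro inj_onI) metis
  then have "distinct (map f Ps)" using Ps by (simp add: distinct_map)
  then have "distinct xs"
    unfolding xs_def distinct_concat_iff using f Ps partition_onD2[OF P(1)]
    by (auto simp: distinct_removeAll disjoint_def) (metis disjoint_iff)+
  moreover have "set xs = {1..l * m}" using Un Ps f by (auto simp: xs_def)
  ultimately show ?thesis by (intro that[of xs]) (auto simp: permutations_of_set_def)
qed

text \<open>Relabelling the half-edges by a bijection that carries a listing of \<open>P\<close> to
  a listing of \<open>P'\<close> embeds one fibre into the other. By symmetry all fibres have the
  same size, so a uniform permutation induces a uniform configuration, and the fibre size itself
  never has to be computed.\<close>

lemma card_config_fibre:
  assumes "P \<in> configurations m d l" "P' \<in> configurations m d l"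
  shows "card {xs \<in> permutations_of_set {1..l * m}. config d n xs = P}
    \<le> card {xs \<in> permutations_of_set {1..l * m}. config d n xs = P'}"
proof -
  obtain xs ys where x: "xs \<in> permutations_of_set {1..l * m}" "config d n xs = P"
    and y: "ys \<in> permutations_of_set {1..l * m}" "config d n ys = P'"
    using config_surj assms by metis
  obtain \<sigma> where \<sigma>: "bij_betw \<sigma> {1..l * m} {1..l * m}" "map \<sigma> xs = ys"
    using permutations_of_set_transitive[OF x(1) y(1)] .
  have P': "P' = (`) \<sigma> ` P" using config_map[of d n \<sigma> xs] \<sigma>(2) x(2) y(2) by simp
  show ?thesis
  proof (rule card_inj_on_le)
    show "inj_on (map \<sigma>) {xs \<in> permutations_of_set {1..l * m}. config d n xs = P}"
      using \<sigma>(1) by (intro inj_on_subset[OF inj_on_map_permutations_of_set]) (auto simp: bij_betw_def)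
    show "map \<sigma> ` {xs \<in> permutations_of_set {1..l * m}. config d n xs = P}
        \<subseteq> {xs \<in> permutations_of_set {1..l * m}. config d n xs = P'}"
      using map_permutations_of_set[OF \<sigma>(1)] by (auto simp: config_map P')
  qed simp
qed

lemma prob_random_hypergraph:
  "measure_pmf.prob (random_hypergraph m d l) {P. Q P}
    = card {xs \<in> permutations_of_set {1..l * m}. Q (config d n xs)} / fact (l * m)"
proof -
  define C where "C = configurations m d l"
  define F where "F P = {xs \<in> permutations_of_set {1..l * m}. config d n xs = P}" for P
  have finC: "finite C" unfolding C_def by (rule finite_configurations)
  have "d dvd l * m" using dn by (metis dvd_triv_left)
  then have "C \<noteq> {}" unfolding C_def by (rule configurations_nonempty[OF d])
  then obtain P0 where P0: "P0 \<in> C" by blast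
  define k where "k = card (F P0)"
  have k: "card (F P) = k" if "P \<in> C" for P
    using card_config_fibre[of P P0] card_config_fibre[of P0 P] that P0 by (simp add: F_def C_def k_def)
  have count: "card {xs \<in> permutations_of_set {1..l * m}. R (config d n xs)} = card {P \<in> C. R P} * k" for R
  proof -
    have "{xs \<in> permutations_of_set {1..l * m}. R (config d n xs)} = (\<Union>P\<in>{P \<in> C. R P}. F P)"
      using config_in_configurations by (auto simp: F_def C_def)
    moreover have "card (\<Union>P\<in>{P \<in> C. R P}. F P) = (\<Sum>P\<in>{P \<in> C. R P}. card (F P))"
      using finC by (intro card_UN_disjoint) (auto simp: F_def)
    ultimately show ?thesis using k by simp
  qed
  have tot: "fact (l * m) = card C * k" using count[of "\<lambda>_. True"] by simp
  then have "card C * k > 0" by (metis fact_gt_zero)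
  then have kC: "k > 0" "card C > 0" by simp_all
  have "measure_pmf.prob (random_hypergraph m d l) {P. Q P} = card (C \<inter> {P. Q P}) / card C"
    unfolding random_hypergraph_def C_def[symmetric] using finC \<open>C \<noteq> {}\<close> by (simp add: measure_pmf_of_set)
  also have "C \<inter> {P. Q P} = {P \<in> C. Q P}" by auto
  also have "card {P \<in> C. Q P} / card C = (card {P \<in> C. Q P} * k) / (card C * k)" using kC by simp
  also have "real (card C * k) = fact (l * m)" using tot by (metis of_nat_fact)
  finally show ?thesis by (simp only: count of_nat_mult)
qed

lemma is_matching_config:
  assumes "xs \<in> permutations_of_set {1..l * m}"
  shows "is_matching m l (config d n xs) M \<longleftrightarrow> M \<subseteq> {1..m} \<and> matches d l n M xs"
proof -
  note c = chunks_permutation[OF assms]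
  have vertex: "vertex_of (config d n xs) i = set ch" if "ch \<in> set (chunks d n xs)" "i \<in> set ch" for i ch
    unfolding vertex_of_def config_def using that c(5) by (intro the_equality) auto
  have mem: "i \<in> {1..l * m} \<longleftrightarrow> (\<exists>ch\<in>set (chunks d n xs). i \<in> set ch)" for i
    using c(1,2) by (metis UN_iff set_concat)
  have len: "length (filter (\<lambda>i. hyperedge_of l i \<in> M) ch) \<le> 1 \<longleftrightarrow>
      (\<forall>i\<in>set ch. \<forall>j\<in>set ch. hyperedge_of l i \<in> M \<longrightarrow> hyperedge_of l j \<in> M \<longrightarrow> i = j)"
    if "ch \<in> set (chunks d n xs)" for ch
  proof -
    have "length (filter (\<lambda>i. hyperedge_of l i \<in> M) ch) = card (set (filter (\<lambda>i. hyperedge_of l i \<in> M) ch))"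
      using c(4)[OF that] by (intro distinct_card[symmetric]) simp
    also have "\<dots> \<le> 1 \<longleftrightarrow> (\<forall>i\<in>set (filter (\<lambda>i. hyperedge_of l i \<in> M) ch).
        \<forall>j\<in>set (filter (\<lambda>i. hyperedge_of l i \<in> M) ch). i = j)"
      unfolding One_nat_def by (rule card_le_Suc0_iff_eq) simp
    finally show ?thesis by auto
  qed
  have "inj_on (vertex_of (config d n xs)) (half_edges_in m l M) \<longleftrightarrow> matches d l n M xs"
  proof
    assume inj: "inj_on (vertex_of (config d n xs)) (half_edges_in m l M)"
    show "matches d l n M xs" unfolding matches_def
    proof
      fix ch assume ch: "ch \<in> set (chunks d n xs)"
      have "i = j" if "i \<in> set ch" "j \<in> set ch" "hyperedge_of l i \<in> M" "hyperedge_of l j \<in> M" for i j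
      proof (rule inj_onD[OF inj])
        show "vertex_of (config d n xs) i = vertex_of (config d n xs) j" using vertex ch that by simp
        show "i \<in> half_edges_in m l M" "j \<in> half_edges_in m l M"
          unfolding half_edges_in_def using mem ch that by blast+
      qed
      then show "length (filter (\<lambda>i. hyperedge_of l i \<in> M) ch) \<le> 1" using len[OF ch] by blast
    qed
  next
    assume mt: "matches d l n M xs"
    show "inj_on (vertex_of (config d n xs)) (half_edges_in m l M)"
    proof (rule inj_onI)
      fix i j assume ij: "i \<in> half_edges_in m l M" "j \<in> half_edges_in m l M"
        "vertex_of (config d n xs) i = vertex_of (config d n xs) j"
      then obtain a b where a: "a \<in> set (chunks d n xs)" "i \<in> set a" and b: "b \<in> set (chunks d n xs)" "j \<in> set b"
        and h: "hyperedge_of l i \<in> M" "hyperedge_of l j \<in> M"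
        unfolding half_edges_in_def using mem by blast
      then have "j \<in> set a" using ij(3) vertex by metis
      then show "i = j" using len[OF a(1)] mt a h unfolding matches_def by blast
    qed
  qed
  then show ?thesis by (simp add: is_matching_def)
qed

end

section \<open>Bounded differences and Azuma's inequality\<close>

definition matching_count :: "nat \<Rightarrow> nat \<Rightarrow> nat \<Rightarrow> nat \<Rightarrow> nat list \<Rightarrow> nat" where
  "matching_count d l m n xs = card {M. M \<subseteq> {1..m} \<and> matches d l n M xs}"

lemma num_matchings_config:
  assumes "d > 0" "d * n = l * m" "xs \<in> permutations_of_set {1..l * m}"
  shows "num_matchings m l (config d n xs) = matching_count d l m n xs"
  unfolding num_matchings_def matching_count_def is_matching_config[OF assms] ..

text \<open>The empty matching is always counted, so the logarithm of the count is never taken at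
  0.\<close>

lemma matching_count_pos: "matching_count d l m n xs > 0"
proof -
  have "{} \<in> {M. M \<subseteq> {1..m} \<and> matches d l n M xs}" by (simp add: matches_def)
  then show ?thesis unfolding matching_count_def by (intro card_gt_0_iff[THEN iffD2]) auto
qed

lemma matches_mono:
  assumes "matches d l n M xs" "M' \<subseteq> M"
  shows "matches d l n M' xs"
  unfolding matches_def
proof
  fix ch assume "ch \<in> set (chunks d n xs)"
  then have "length (filter (\<lambda>i. hyperedge_of l i \<in> M) ch) \<le> 1" using assms(1) by (simp add: matches_def)
  moreover have "length (filter (\<lambda>i. hyperedge_of l i \<in> M') ch) \<le> length (filter (\<lambda>i. hyperedge_of l i \<in> M) ch)"
    using assms(2) by (induction ch) auto
  ultimately show "length (filter (\<lambda>i. hyperedge_of l i \<in> M') ch) \<le> 1" by linarith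
qed

text \<open>Removing the at most two hyperedges of the half-edges \<open>i\<close> and
  \<open>j\<close> from a matching leaves one that the transposition does not affect. The original
  is recovered from the reduced matching and the removed subset of these hyperedges, of which there
  are at most \<open>2 ^ 2\<close>.\<close>

lemma matching_count_transpose:
  "matching_count d l m n xs \<le> 4 * matching_count d l m n (map (Transposition.transpose i j) xs)"
proof -
  define E where "E = {hyperedge_of l i, hyperedge_of l j}"
  define A where "A = {M. M \<subseteq> {1..m} \<and> matches d l n M xs}"
  define B where "B = {M. M \<subseteq> {1..m} \<and> matches d l n M (map (Transposition.transpose i j) xs)}"
  have "hyperedge_of l (Transposition.transpose i j a) \<in> M - E \<longleftrightarrow> hyperedge_of l a \<in> M - E" for a M
    by (auto simp: Transposition.transpose_def E_def)
  then have good: "M - E \<in> B" if "M \<in> A" for M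
    using that matches_mono[of d l n M xs "M - E"]
    by (auto simp: A_def B_def matches_def chunks_map filter_map comp_def)
  have fB: "finite B" unfolding B_def by (rule finite_subset[of _ "Pow {1..m}"]) auto
  have "card A \<le> card (B \<times> Pow E)"
  proof (rule card_inj_on_le)
    show "inj_on (\<lambda>M. (M - E, M \<inter> E)) A" by (rule inj_onI) blast
    show "(\<lambda>M. (M - E, M \<inter> E)) ` A \<subseteq> B \<times> Pow E" using good by auto
    show "finite (B \<times> Pow E)" using fB by (simp add: E_def)
  qed
  also have "\<dots> = card B * 2 ^ card E" by (simp add: card_cartesian_product card_Pow E_def)
  also have "\<dots> \<le> card B * 2 ^ 2"
    using card_insert_le_m1[of 2 "{hyperedge_of l j}" "hyperedge_of l i"]
    by (intro mult_left_mono power_increasing) (auto simp: E_def)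
  finally show ?thesis by (simp add: matching_count_def A_def B_def)
qed

text \<open>Averaged over a centred variable, the linear term disappears and a bound by the
  exponential of the squared range remains; this is the one-step estimate of Azuma's inequality. The
  cases rest on \<open>exp x \<le> 1 + x + x^2\<close> for \<open>x\<close> between -1 and
  1.\<close>

lemma exp_le_add_exp_square: "exp x \<le> x + exp (x\<^sup>2)" for x :: real
proof -
  have sq: "1 + x\<^sup>2 \<le> exp (x\<^sup>2)" by (rule exp_ge_add_one_self)
  consider "x > 1" | "0 \<le> x" "x \<le> 1" | "-1 \<le> x" "x < 0" | "x < -1" by linarith
  then show ?thesis
  proof cases
    case 1
    then have "x \<le> x\<^sup>2" using mult_left_mono[of 1 x x] by (simp add: power2_eq_square)
    then have "exp x \<le> exp (x\<^sup>2)" by simp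
    then show ?thesis using 1 by linarith
  next
    case 2
    then have "exp x \<le> 1 + x + x\<^sup>2" by (rule exp_bound)
    then show ?thesis using sq by linarith
  next
    case 3
    have "1 - x \<le> exp (- x)" using exp_ge_add_one_self[of "- x"] by simp
    then have "exp x * (1 - x) \<le> exp x * exp (- x)" by (intro mult_left_mono) auto
    then have "exp x * (1 - x) \<le> 1" by (simp flip: exp_add)
    also have "1 \<le> 1 - x ^ 3" using 3 by (simp add: power_le_zero_eq)
    also have "\<dots> = (1 + x + x\<^sup>2) * (1 - x)" by (simp add: power2_eq_square power3_eq_cube algebra_simps)
    finally have "exp x \<le> 1 + x + x\<^sup>2" using 3 by simp
    then show ?thesis using sq by linarith
  next
    case 4
    then have "- x \<le> x\<^sup>2" using mult_left_mono[of 1 "- x" "- x"] by (simp add: power2_eq_square)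
    moreover have "exp x \<le> 1" using 4 by simp
    ultimately show ?thesis using sq by linarith
  qed
qed

lemma sum_permutations_of_set:
  assumes "finite A" "A \<noteq> {}"
  shows "(\<Sum>xs\<in>permutations_of_set A. f xs) = (\<Sum>x\<in>A. \<Sum>ys\<in>permutations_of_set (A - {x}). f (x # ys))"
proof -
  have "(\<Sum>xs\<in>permutations_of_set A. f xs) = (\<Sum>x\<in>A. \<Sum>xs\<in>(#) x ` permutations_of_set (A - {x}). f xs)"
    unfolding permutations_of_set_nonempty[OF assms(2)] using assms(1)
    by (intro sum.UNION_disjoint) auto
  then show ?thesis by (simp add: sum.reindex)
qed

text \<open>
  Azuma's inequality for the martingale that reveals the permutation entry by entry; the
  transposition of \<open>x\<close> and \<open>y\<close> couples the permutations starting with \<open>x\<close> and with \<open>y\<close>.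
\<close>

lemma permutation_exp_moment:
  fixes f :: "'a list \<Rightarrow> real" and c :: real
  assumes "finite A"
    and "\<And>xs x y. xs \<in> permutations_of_set A \<Longrightarrow> x \<in> A \<Longrightarrow> y \<in> A
      \<Longrightarrow> \<bar>f xs - f (map (Transposition.transpose x y) xs)\<bar> \<le> c"
  shows "(\<Sum>xs\<in>permutations_of_set A. exp (t * (f xs - (\<Sum>xs\<in>permutations_of_set A. f xs) / fact (card A))))
    \<le> fact (card A) * exp (t\<^sup>2 * c\<^sup>2 * card A)"
  using assms
proof (induction "card A" arbitrary: A f)
  case 0
  then have "A = {}" by simp
  then show ?case by simp
next
  case (Suc n)
  have ne: "A \<noteq> {}" using Suc.hyps(2) by auto
  have cA: "card (A - {x}) = n" if "x \<in> A" for x using that Suc.hyps(2) Suc.prems(1) by simp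
  define P where "P x = permutations_of_set (A - {x})" for x
  define a where "a x = (\<Sum>ys\<in>P x. f (x # ys)) / fact n" for x
  define M where "M = (\<Sum>xs\<in>permutations_of_set A. f xs) / fact (Suc n)"
  have cP: "card (P x) = fact n" if "x \<in> A" for x
    using that cA Suc.prems(1) by (simp add: P_def)
  have Cons: "x # ys \<in> permutations_of_set A" if "x \<in> A" "ys \<in> P x" for x ys
    using that by (auto simp: P_def permutations_of_set_def)
  have M: "M = (\<Sum>x\<in>A. a x) / real (Suc n)"
    unfolding M_def a_def sum_permutations_of_set[OF Suc.prems(1) ne] P_def
    by (simp add: sum_divide_distrib[symmetric] divide_simps)
  have diff: "a x - a y \<le> c" if xy: "x \<in> A" "y \<in> A" for x y
  proof -
    define \<tau> where "\<tau> = Transposition.transpose x y"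
    have bij: "bij_betw \<tau> (A - {x}) (A - {y})"
      unfolding bij_betw_def \<tau>_def using xy by (auto simp: inj_on_def transpose_eq_iff image_iff
        Transposition.transpose_def split: if_splits)
    have "bij_betw (map \<tau>) (P x) (P y)"
      unfolding bij_betw_def
    proof
      show inj: "inj_on (map \<tau>) (P x)"
        unfolding P_def using bij by (intro inj_on_map_permutations_of_set) (simp add: bij_betw_def)
      show "map \<tau> ` P x = P y"
      proof (rule card_subset_eq)
        show "map \<tau> ` P x \<subseteq> P y" unfolding P_def using map_permutations_of_set[OF bij] by blast
        show "card (map \<tau> ` P x) = card (P y)" using inj cP xy by (simp add: card_image)
      qed (simp add: P_def)
    qed
    then have "(\<Sum>ys\<in>P y. f (y # ys)) = (\<Sum>ys\<in>P x. f (y # map \<tau> ys))"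
      by (rule sum.reindex_bij_betw[symmetric])
    also have "\<dots> = (\<Sum>ys\<in>P x. f (map \<tau> (x # ys)))" by (simp add: \<tau>_def)
    finally have "a x - a y = (\<Sum>ys\<in>P x. f (x # ys) - f (map \<tau> (x # ys))) / fact n"
      by (simp add: a_def sum_subtractf diff_divide_distrib)
    also have "\<dots> \<le> (\<Sum>ys\<in>P x. c) / fact n"
      using Suc.prems(2) Cons xy unfolding \<tau>_def
      by (intro divide_right_mono sum_mono) (force dest: abs_le_D1 simp del: list.map)+
    finally show ?thesis using cP xy by simp
  qed
  have dev: "\<bar>a x - M\<bar> \<le> c" if x: "x \<in> A" for x
  proof -
    have "a x - M = (\<Sum>y\<in>A. a x - a y) / real (Suc n)"
      using Suc.hyps(2) by (simp add: M sum_subtractf field_simps)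
    then have "\<bar>a x - M\<bar> = \<bar>\<Sum>y\<in>A. a x - a y\<bar> / real (Suc n)" by (simp add: abs_divide)
    also have "\<dots> \<le> (\<Sum>y\<in>A. \<bar>a x - a y\<bar>) / real (Suc n)"
      by (intro divide_right_mono sum_abs) simp
    also have "\<dots> \<le> (\<Sum>y\<in>A. c) / real (Suc n)"
      using diff x by (intro divide_right_mono sum_mono) (auto simp: abs_le_iff)
    also have "\<dots> = c" using Suc.hyps(2) by (simp add: field_simps)
    finally show ?thesis .
  qed
  have IH: "(\<Sum>ys\<in>P x. exp (t * (f (x # ys) - a x))) \<le> fact n * exp (t\<^sup>2 * c\<^sup>2 * n)" if x: "x \<in> A" for x
  proof -
    have "\<bar>f (x # ys) - f (x # map (Transposition.transpose u v) ys)\<bar> \<le> c"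
      if "ys \<in> permutations_of_set (A - {x})" "u \<in> A - {x}" "v \<in> A - {x}" for ys u v
    proof -
      have "Transposition.transpose u v x = x" using that by (intro transpose_apply_other) auto
      then show ?thesis using Suc.prems(2)[of "x # ys" u v] that Cons[OF x, of ys] by (simp add: P_def)
    qed
    then show ?thesis
      using Suc.hyps(1)[of "A - {x}" "\<lambda>ys. f (x # ys)"] cA[OF x] Suc.prems(1) by (simp add: P_def a_def)
  qed
  have "(\<Sum>xs\<in>permutations_of_set A. exp (t * (f xs - M)))
      = (\<Sum>x\<in>A. exp (t * (a x - M)) * (\<Sum>ys\<in>P x. exp (t * (f (x # ys) - a x))))"
    unfolding sum_permutations_of_set[OF Suc.prems(1) ne] P_def
    by (simp add: sum_distrib_left algebra_simps flip: exp_add)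
  also have "\<dots> \<le> (\<Sum>x\<in>A. exp (t * (a x - M)) * (fact n * exp (t\<^sup>2 * c\<^sup>2 * n)))"
    using IH by (intro sum_mono mult_left_mono) auto
  also have "\<dots> = (\<Sum>x\<in>A. exp (t * (a x - M))) * (fact n * exp (t\<^sup>2 * c\<^sup>2 * n))"
    by (simp add: sum_distrib_right)
  also have "(\<Sum>x\<in>A. exp (t * (a x - M))) \<le> (\<Sum>x\<in>A. t * (a x - M) + exp (t\<^sup>2 * c\<^sup>2))"
  proof (rule sum_mono)
    fix x assume x: "x \<in> A"
    have "(t * (a x - M))\<^sup>2 \<le> t\<^sup>2 * c\<^sup>2"
      unfolding power_mult_distrib using dev[OF x] by (intro mult_left_mono) (auto simp: abs_le_square_iff[symmetric])
    then have "exp ((t * (a x - M))\<^sup>2) \<le> exp (t\<^sup>2 * c\<^sup>2)" by simp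
    then show "exp (t * (a x - M)) \<le> t * (a x - M) + exp (t\<^sup>2 * c\<^sup>2)"
      using exp_le_add_exp_square[of "t * (a x - M)"] by linarith
  qed
  also have "(\<Sum>x\<in>A. t * (a x - M) + exp (t\<^sup>2 * c\<^sup>2)) = t * ((\<Sum>x\<in>A. a x) - real (Suc n) * M) + real (Suc n) * exp (t\<^sup>2 * c\<^sup>2)"
    using Suc.hyps(2) by (simp add: sum.distrib sum_subtractf flip: sum_distrib_left)
  \<comment> \<open>\<open>M\<close> is the average of the conditional means \<open>a x\<close>, so
    the linear terms cancel.\<close>
  also have "(\<Sum>x\<in>A. a x) - real (Suc n) * M = 0" by (simp add: M)
  finally have "(\<Sum>xs\<in>permutations_of_set A. exp (t * (f xs - M)))
      \<le> real (Suc n) * exp (t\<^sup>2 * c\<^sup>2) * (fact n * exp (t\<^sup>2 * c\<^sup>2 * n))"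
    by (simp add: mult_right_mono)
  also have "\<dots> = fact (Suc n) * exp (t\<^sup>2 * c\<^sup>2 * Suc n)"
    by (simp add: algebra_simps flip: exp_add)
  finally show ?case unfolding M_def Suc.hyps(2)[symmetric] .
qed

lemma permutation_tail:
  fixes f :: "'a list \<Rightarrow> real" and c r :: real
  assumes "finite A" "A \<noteq> {}" "c > 0" "r \<ge> 0"
    and "\<And>xs x y. xs \<in> permutations_of_set A \<Longrightarrow> x \<in> A \<Longrightarrow> y \<in> A
      \<Longrightarrow> \<bar>f xs - f (map (Transposition.transpose x y) xs)\<bar> \<le> c"
  defines "\<mu> \<equiv> (\<Sum>xs\<in>permutations_of_set A. f xs) / fact (card A)"
  shows "card {xs \<in> permutations_of_set A. f xs - \<mu> \<ge> r} \<le> fact (card A) * exp (- r\<^sup>2 / (4 * c\<^sup>2 * card A))"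
proof -
  define N where "N = real (card A)"
  have N: "N > 0" using assms(1,2) by (simp add: N_def card_gt_0_iff)
  \<comment> \<open>The minimizer of the exponent \<open>t^2 * c^2 * N - t * r\<close>.\<close>
  define t where "t = r / (2 * c\<^sup>2 * N)"
  have t: "t \<ge> 0" using assms N by (simp add: t_def)
  have "card {xs \<in> permutations_of_set A. f xs - \<mu> \<ge> r} * exp (t * r)
      = (\<Sum>xs\<in>{xs \<in> permutations_of_set A. f xs - \<mu> \<ge> r}. exp (t * r))" by simp
  also have "\<dots> \<le> (\<Sum>xs\<in>{xs \<in> permutations_of_set A. f xs - \<mu> \<ge> r}. exp (t * (f xs - \<mu>)))"
    using t by (intro sum_mono) (auto intro!: mult_left_mono)
  also have "\<dots> \<le> (\<Sum>xs\<in>permutations_of_set A. exp (t * (f xs - \<mu>)))"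
    by (intro sum_mono2) auto
  also have "\<dots> \<le> fact (card A) * exp (t\<^sup>2 * c\<^sup>2 * N)"
    unfolding \<mu>_def N_def using assms(1,5) by (rule permutation_exp_moment)
  finally have "card {xs \<in> permutations_of_set A. f xs - \<mu> \<ge> r} \<le> fact (card A) * exp (t\<^sup>2 * c\<^sup>2 * N) / exp (t * r)"
    by (simp add: pos_le_divide_eq)
  also have "\<dots> = fact (card A) * exp (t\<^sup>2 * c\<^sup>2 * N - t * r)" by (simp add: exp_diff)
  also have "t\<^sup>2 * c\<^sup>2 * N - t * r = - r\<^sup>2 / (4 * c\<^sup>2 * N)"
    using N assms(3) by (simp add: t_def field_simps power2_eq_square)
  finally show ?thesis by (simp add: N_def)
qed

section \<open>Moments\<close>

text \<open>Stirling's formula up to a logarithmic error, which is harmless on the exponential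
  scale. The induction steps are the two bounds
  \<open>(1 + 1/n)^n \<le> e \<le> (1 + 1/n)^(n+1)\<close> in logarithmic form.\<close>

lemma ln_fact_bounds:
  "eta n - n \<le> ln (fact n)" "ln (fact n) \<le> eta n - n + (1 + ln (real n + 1))"
proof -
  have step: "real n * ln (1 + 1 / real n) \<le> 1" "(real n + 1) * ln (1 + 1 / real n) \<ge> 1"
    "eta (Suc n) = eta n + ln (real n + 1) + n * ln (1 + 1 / real n)" 
    "ln (real n + 1) = ln (real n) + ln (1 + 1 / real n)" if "n > 0" for n
  proof -
    have n: "real n > 0" using that by simp
    have "ln (1 + 1 / real n) \<le> 1 / real n" using n by (intro ln_add_one_self_le_self) auto
    then show "real n * ln (1 + 1 / real n) \<le> 1" using n by (simp add: field_simps)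
    have "ln (real n / (real n + 1)) \<le> real n / (real n + 1) - 1" using n by (intro ln_le_minus_one) auto
    also have "ln (real n / (real n + 1)) = - ln (1 + 1 / real n)"
      using n by (simp add: ln_div add_divide_distrib[symmetric] field_simps)
    also have "real n / (real n + 1) - 1 = - (1 / (real n + 1))" using n by (simp add: field_simps)
    finally show "(real n + 1) * ln (1 + 1 / real n) \<ge> 1" using n by (simp add: field_simps)
    have e: "1 + 1 / real n = (real n + 1) / real n" using n by (simp add: field_simps)
    then show *: "ln (real n + 1) = ln (real n) + ln (1 + 1 / real n)" using n by (simp add: ln_div)
    show "eta (Suc n) = eta n + ln (real n + 1) + n * ln (1 + 1 / real n)"
      using * by (simp add: eta_def algebra_simps)
  qed
  show "eta n - n \<le> ln (fact n)"
  proof (induction n)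
    case (Suc n)
    show ?case
    proof (cases "n = 0")
      case False
      then show ?thesis using Suc step[of n] by (simp add: ln_mult add.commute[of 1])
    qed simp
  qed simp
  \<comment> \<open>The induction closes with \<open>ln n\<close> in the error term, for positive
    \<open>n\<close>; the weaker \<open>ln (n + 1)\<close> of the statement also covers
    \<open>n = 0\<close>.\<close>
  have "ln (fact n) \<le> eta n - n + (1 + ln (real n))" if "n > 0" for n
    using that
  proof (induction n)
    case (Suc n)
    show ?case
    proof (cases "n = 0")
      case False
      then have n: "n > 0" by simp
      have "ln (fact (Suc n)) = ln (real n + 1) + ln (fact n)" by (simp add: ln_mult add.commute)
      moreover have "(real n + 1) * ln (1 + 1 / real n) = n * ln (1 + 1 / real n) + ln (1 + 1 / real n)"
        by (simp add: distrib_right)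
      moreover have "real (Suc n) = real n + 1" "ln (real (Suc n)) = ln (real n + 1)"
        by (simp_all add: add.commute)
      ultimately show ?thesis using Suc.IH[OF n] step[OF n] by linarith
    qed simp
  qed simp
  note upper = this
  show "ln (fact n) \<le> eta n - n + (1 + ln (real n + 1))"
  proof (cases "n = 0")
    case False
    then have "n > 0" "ln (real n) \<le> ln (real n + 1)" by simp_all
    then show ?thesis using upper[of n] by linarith
  qed simp
qed

section \<open>The first moment and the density that maximizes its exponent\<close>

lemma Phi_eta: "Phi d l b = - eta b + (real l - 1) * eta (1 - b) - real l / real d * eta (1 - real d * b)"
  by (simp add: Phi_def eta_def)

lemma ln_fact_error:
  assumes "a \<le> N"
  obtains e where "ln (fact a) = eta a - a + e" "0 \<le> e" "e \<le> 1 + ln (real N + 1)"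
proof -
  have "ln (real a + 1) \<le> ln (real N + 1)" using assms by simp
  then show ?thesis
    using that[of "ln (fact a) - (eta a - a)"] ln_fact_bounds[of a] by linarith
qed

text \<open>The expected number of matchings of size \<open>k\<close>. For a fixed set of
  \<open>k\<close> hyperedges, the covered half-edges occupy positions in distinct blocks, in
  \<open>(n choose (l * k)) * d ^ (l * k)\<close> ways; covered and uncovered half-edges are then
  ordered separately, relative to all orderings.\<close>

definition first_moment :: "nat \<Rightarrow> nat \<Rightarrow> nat \<Rightarrow> nat \<Rightarrow> nat \<Rightarrow> real" where
  "first_moment d l m n k = real (m choose k) * real (n choose (l * k)) * real d ^ (l * k)
     * fact (l * k) * fact (l * (m - k)) / fact (l * m)"

text \<open>After cancellation seven factorials remain, each with a logarithmic error between 0 and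
  \<open>R\<close>, so the total error is well within \<open>9 * R\<close>. The main terms combine
  to \<open>Phi\<close> by the rule for \<open>eta\<close> of a product.\<close>

lemma first_moment_estimate:
  assumes dl: "d > 0" "l > 0" "m > 0" and dn: "d * n = l * m" and k: "k \<le> m" "l * k \<le> n"
  shows "first_moment d l m n k > 0"
    "\<bar>ln (first_moment d l m n k) - m * Phi d l (k / m)\<bar> \<le> 9 * (1 + ln (real (l * m) + 1))"
proof -
  define R where "R = 1 + ln (real (l * m) + 1)"
  have pos: "m choose k > 0" "n choose (l * k) > 0" using k by (simp_all add: zero_less_binomial)
  then show "first_moment d l m n k > 0" using dl by (simp add: first_moment_def)
  have n: "n > 0" using dn dl by (metis mult_is_0 neq0_conv)
  have "1 * m \<le> l * m" "1 * n \<le> d * n" using dl by (intro mult_right_mono; simp)+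
  then have le: "m \<le> l * m" "n \<le> l * m" by (simp_all add: dn)
  define f where "f a = ln (fact a :: real)" for a
  have err: "\<exists>e. f a = eta a - a + e \<and> 0 \<le> e \<and> e \<le> R" if "a \<le> l * m" for a
    using ln_fact_error[OF that] unfolding f_def R_def by blast
  have bounds: "k \<le> l * m" "m - k \<le> l * m" "n - l * k \<le> l * m" "l * (m - k) \<le> l * m"
    using order_trans[OF k(1) le(1)] order_trans[OF diff_le_self[of m k] le(1)]
      order_trans[OF diff_le_self[of n "l * k"] le(2)] mult_le_mono2[OF diff_le_self[of m k], of l] by blast+
  obtain e1 where e1: "f m = eta m - m + e1" "0 \<le> e1" "e1 \<le> R"
    using err[OF le(1)] by blast
  obtain e2 where e2: "f k = eta k - k + e2" "0 \<le> e2" "e2 \<le> R"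
    using err[OF bounds(1)] by blast
  obtain e3 where e3: "f (m - k) = eta (m - k) - (m - k) + e3" "0 \<le> e3" "e3 \<le> R"
    using err[OF bounds(2)] by blast
  obtain e4 where e4: "f n = eta n - n + e4" "0 \<le> e4" "e4 \<le> R"
    using err[OF le(2)] by blast
  obtain e5 where e5: "f (n - l * k) = eta (n - l * k) - (n - l * k) + e5" "0 \<le> e5" "e5 \<le> R"
    using err[OF bounds(3)] by blast
  obtain e6 where e6: "f (l * (m - k)) = eta (l * (m - k)) - (l * (m - k)) + e6" "0 \<le> e6" "e6 \<le> R"
    using err[OF bounds(4)] by blast
  obtain e7 where e7: "f (l * m) = eta (l * m) - (l * m) + e7" "0 \<le> e7" "e7 \<le> R"
    using err[OF order_refl] by blast
  have "first_moment d l m n k = (fact m / (fact k * fact (m - k))) * (fact n / fact (n - l * k))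
     * real d ^ (l * k) * fact (l * (m - k)) / fact (l * m)"
    using k by (simp add: first_moment_def binomial_fact)
  also have "ln \<dots> = f m - (f k + f (m - k)) + (f n - f (n - l * k)) + l * k * ln d + f (l * (m - k)) - f (l * m)"
    using dl by (simp add: f_def ln_mult ln_div ln_realpow)
  also have "\<dots> = eta m - eta k - eta (m - k) + eta n - eta (n - l * k) + l * k * ln d + eta (l * (m - k)) - eta (l * m)
      + (e1 - e2 - e3 + e4 - e5 + e6 - e7)"
  proof -
    have "real (m - k) = real m - real k" "real (n - l * k) = real n - real (l * k)"
      using k by (simp_all only: of_nat_diff)
    moreover have "real (l * (m - k)) = real (l * m) - real (l * k)"
      using k by (simp add: of_nat_diff algebra_simps)
    ultimately show ?thesis using e1(1) e2(1) e3(1) e4(1) e5(1) e6(1) e7(1) by linarith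
  qed
  also have "eta m - eta k - eta (m - k) + eta n - eta (n - l * k) + l * k * ln d + eta (l * (m - k)) - eta (l * m)
     = m * Phi d l (k / m)"
  proof -
    define b where "b = real k / real m"
    have kb: "real k = m * b" using dl by (simp add: b_def)
    have b: "0 \<le> b" "b \<le> 1" using k dl by (auto simp: b_def)
    have nn: "real n = real l / real d * m" using dn dl by (simp add: field_simps flip: of_nat_mult)
    have mk: "real (m - k) = m * (1 - b)" using k by (simp add: of_nat_diff kb algebra_simps)
    have lk: "real (l * k) = n * (d * b)" using dl by (simp add: kb nn field_simps)
    have nlk: "real (n - l * k) = n * (1 - d * b)"
      using k lk by (simp add: of_nat_diff algebra_simps del: of_nat_mult)
    have "real n * (1 - d * b) \<ge> 0" by (simp flip: nlk)
    then have db: "1 - d * b \<ge> 0" using n by (simp add: zero_le_mult_iff)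
    have lnn: "ln (real n) = ln l + ln m - ln d" using dl by (simp add: nn ln_mult ln_div)
    have a1: "eta k = m * eta b + k * ln m" using b by (simp add: kb eta_mult) (simp add: eta_def algebra_simps)
    have a2: "eta (m - k) = m * eta (1 - b) + (real m - k) * ln m"
      using b by (simp only: mk) (simp add: eta_mult kb, simp add: eta_def algebra_simps)
    have a3: "eta (n - l * k) = n * eta (1 - d * b) + (real n - l * k) * (ln l + ln m - ln d)"
      unfolding nlk using db by (simp add: eta_mult lk[simplified]) (simp add: eta_def lnn algebra_simps)
    have a4: "eta (l * (m - k)) = l * eta (m - k) + (real m - k) * (l * ln l)"
      using k by (simp add: eta_mult of_nat_diff eta_def[of "real l"])
    have a5: "eta (l * m) = l * eta m + m * (l * ln l)"
      by (simp add: eta_mult eta_def[of "real l"])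
    have a6: "eta n = n * (ln l + ln m - ln d)" "eta m = m * ln m" by (simp_all add: eta_def lnn)
    show ?thesis
      unfolding Phi_eta a4 a1 a2 a3 a5 a6 b_def[symmetric] 
      by (simp add: nn) (simp add: algebra_simps diff_divide_distrib)
  qed
  finally have "ln (first_moment d l m n k) - m * Phi d l (k / m) = e1 - e2 - e3 + e4 - e5 + e6 - e7" by simp
  then show "\<bar>ln (first_moment d l m n k) - m * Phi d l (k / m)\<bar> \<le> 9 * (1 + ln (real (l * m) + 1))"
    unfolding R_def[symmetric] using e1 e2 e3 e4 e5 e6 e7 by (auto simp: abs_le_iff)
qed

lemma beta_star_props:
  assumes "d \<ge> 2" "l \<ge> 2"
  shows "0 < beta_star d l" "beta_star d l < 1 / real d"
    "(1 - real d * beta_star d l) ^ l = beta_star d l * (1 - beta_star d l) ^ (l - 1)"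
  using theI'[OF beta_star_ex1[OF assms]] unfolding beta_star_def by blast+

text \<open>The derivative of \<open>Phi\<close> is \<open>g\<close>, and \<open>g x = 0\<close> is
  the logarithm of the equation defining \<open>beta_star\<close>. Since \<open>g'\<close> is
  negative throughout, \<open>Phi\<close> increases up to \<open>beta_star\<close> and decreases
  afterwards; continuity includes the end points.\<close>

lemma Phi_le:
  assumes dl: "d \<ge> 2" "l \<ge> 2" and b: "0 \<le> b" "b \<le> 1 / real d"
  shows "Phi d l b \<le> Phi d l (beta_star d l)"
proof -
  define z where "z = beta_star d l"
  note zp = beta_star_props[OF dl, folded z_def]
  have d1: "1 / real d < 1" using dl by simp
  have db: "real d * x < 1" if "x < 1 / real d" for x using that dl by (simp add: field_simps)
  define g where "g x = l * ln (1 - d * x) - ln x - (real l - 1) * ln (1 - x)" for x :: real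
  define g' where "g' x = - (real l * d / (1 - d * x)) - 1 / x + (real l - 1) / (1 - x)" for x :: real
  have g0: "g z = 0"
  proof -
    have "z < 1" using zp d1 by linarith
    then have "ln (z * (1 - z) ^ (l - 1)) = ln z + real (l - 1) * ln (1 - z)"
      using zp(1) by (simp add: ln_mult ln_realpow del: of_nat_diff)
    moreover have "ln ((1 - real d * z) ^ l) = real l * ln (1 - d * z)"
      using db[OF zp(2)] by (simp add: ln_realpow)
    ultimately have "l * ln (1 - d * z) = ln z + real (l - 1) * ln (1 - z)"
      unfolding zp(3) by simp
    then show ?thesis using dl by (simp add: g_def of_nat_diff)
  qed
  have gd: "(g has_real_derivative g' x) (at x)" if x: "0 < x" "x < 1 / real d" for x
  proof -
    have "(g has_real_derivative real l * (- real d / (1 - real d * x)) - 1 / x - (real l - 1) * (- 1 / (1 - x))) (at x)"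
      unfolding g_def[abs_def] using x d1 db[OF x(2)]
      by (auto intro!: derivative_eq_intros simp: mult_ac)
    then show ?thesis by (simp add: g'_def)
  qed
  have g'neg: "g' x < 0" if x: "0 < x" "x < 1 / real d" for x
  proof -
    have "(real l - 1) / (1 - x) \<le> l / (1 - x)" using x d1 by (intro divide_right_mono) auto
    also have "\<dots> \<le> l * d / (1 - d * x)"
    proof -
      have "l * (1 - d * x) \<le> l * (d * (1 - x))" using dl by (intro mult_left_mono) (auto simp: algebra_simps)
      then show ?thesis using x d1 db[OF x(2)] by (simp add: field_simps)
    qed
    finally have "(real l - 1) / (1 - x) \<le> l * d / (1 - d * x)" .
    moreover have "1 / x > 0" using x by simp
    ultimately show ?thesis unfolding g'_def of_nat_mult by linarith
  qed
  note sign = positive_left_negative_right[OF zp(1,2) g0 gd g'neg]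
  have cont: "continuous_on {0..1 / real d} (Phi d l)"
  proof -
    have "x \<le> 1 \<and> real d * x \<le> 1" if "x \<in> {0..1 / real d}" for x
      proof
      show "x \<le> 1" using that d1 by simp
      show "real d * x \<le> 1" using that dl by (simp add: field_simps)
    qed
    then show ?thesis
      unfolding Phi_eta[abs_def] by (intro continuous_intros) auto
  qed
  have der: "(Phi d l has_real_derivative g x) (at x)" if x: "0 < x" "x < 1 / real d" for x
  proof -
    define k where "k = real l / real d"
    have kd: "k * d = l" using dl by (simp add: k_def)
    have "0 < 1 - x" "0 < 1 - real d * x" using x d1 db[OF x(2)] by simp_all
    then have "((\<lambda>x. - eta x + (real l - 1) * eta (1 - x) - k * eta (1 - real d * x)) has_real_derivative
        - (ln x + 1) + (real l - 1) * ((ln (1 - x) + 1) * (- 1)) - k * ((ln (1 - real d * x) + 1) * (- real d))) (at x)"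
      using x(1) by (auto intro!: derivative_eq_intros eta_has_derivative)
    also have "- (ln x + 1) + (real l - 1) * ((ln (1 - x) + 1) * (- 1)) - k * ((ln (1 - real d * x) + 1) * (- real d)) = g x"
      by (simp add: g_def kd[symmetric] algebra_simps)
    finally have "((\<lambda>x. - eta x + (real l - 1) * eta (1 - x) - k * eta (1 - real d * x)) has_real_derivative g x) (at x)" .
    then show ?thesis by (simp add: Phi_eta[abs_def] k_def)
  qed
  show ?thesis
  proof (cases "b \<le> z")
    case True
    have "Phi d l b \<le> Phi d l z"
    proof (rule DERIV_nonneg_imp_increasing_open[OF True])
      show "continuous_on {b..z} (Phi d l)" using b zp by (intro continuous_on_subset[OF cont]) auto
      show "\<exists>y. (Phi d l has_real_derivative y) (at x) \<and> 0 \<le> y" if "b < x" "x < z" for x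
        using der[of x] sign(1)[of x] that b zp by (intro exI[of _ "g x"]) auto
    qed
    then show ?thesis by (simp add: z_def)
  next
    case False
    then have zb: "z \<le> b" by simp
    have "- Phi d l z \<le> - Phi d l b"
    proof (rule DERIV_nonneg_imp_increasing_open[OF zb, of "\<lambda>x. - Phi d l x"])
      show "continuous_on {z..b} (\<lambda>x. - Phi d l x)"
        using b zp by (intro continuous_intros continuous_on_subset[OF cont]) auto
      show "\<exists>y. ((\<lambda>x. - Phi d l x) has_real_derivative y) (at x) \<and> 0 \<le> y" if "z < x" "x < b" for x
        using DERIV_minus[OF der[of x]] sign(2)[of x] that b zp by (intro exI[of _ "- g x"]) auto
    qed
    then show ?thesis by (simp add: z_def)
  qed
qed

section \<open>Moments as sums over sets and over pairs with given overlap\<close>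

lemma sum_card_swap:
  assumes "finite A" "finite B"
  shows "(\<Sum>x\<in>A. card {y \<in> B. R x y}) = (\<Sum>y\<in>B. card {x \<in> A. R x y})"
proof -
  have "card {y \<in> B. R x y} = (\<Sum>y\<in>B. if R x y then 1 else 0)" for x
    using assms(2) by (simp add: sum.If_cases Int_def)
  moreover have "card {x \<in> A. R x y} = (\<Sum>x\<in>A. if R x y then 1 else 0)" for y
    using assms(1) by (simp add: sum.If_cases Int_def)
  ultimately show ?thesis using sum.swap[of "\<lambda>x y. if R x y then 1 else 0 :: nat" B A] by simp
qed

definition subsets :: "nat \<Rightarrow> nat \<Rightarrow> nat set set" where
  "subsets m k = {M. M \<subseteq> {1..m} \<and> card M = k}"

lemma finite_subsets [simp]: "finite (subsets m k)"
  unfolding subsets_def by (rule finite_subset[of _ "Pow {1..m}"]) auto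

lemma card_subsets: "card (subsets m k) = m choose k"
  using n_subsets[of "{1..m}" k] by (simp add: subsets_def)

definition size_count :: "nat \<Rightarrow> nat \<Rightarrow> nat \<Rightarrow> nat \<Rightarrow> nat \<Rightarrow> nat list \<Rightarrow> nat" where
  "size_count d l m n k xs = card {M \<in> subsets m k. matches d l n M xs}"

lemma matching_count_eq_sum: "matching_count d l m n xs = (\<Sum>k\<le>m. size_count d l m n k xs)"
proof -
  have "card M \<le> m" if "M \<subseteq> {1..m}" for M using card_mono[OF _ that] by simp
  then have "{M. M \<subseteq> {1..m} \<and> matches d l n M xs} = (\<Union>k\<in>{..m}. {M \<in> subsets m k. matches d l n M xs})"
    by (auto simp: subsets_def)
  moreover have "card (\<Union>k\<in>{..m}. {M \<in> subsets m k. matches d l n M xs})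
      = (\<Sum>k\<le>m. card {M \<in> subsets m k. matches d l n M xs})"
    by (intro card_UN_disjoint) (auto simp: subsets_def)
  ultimately show ?thesis by (simp add: matching_count_def size_count_def)
qed

lemma size_count_le: "size_count d l m n k xs \<le> matching_count d l m n xs"
  unfolding size_count_def matching_count_def
  by (intro card_mono finite_subset[of "{M. M \<subseteq> {1..m} \<and> matches d l n M xs}" "Pow {1..m}"])
    (auto simp: subsets_def)

text \<open>Linearity of expectation. A single set \<open>M\<close> is treated as the pair
  \<open>(M, M)\<close>, so the count for pairs together with \<open>card_patterns_single\<close>
  gives its exact probability of being a matching.\<close>

lemma sum_size_count:
  assumes l: "l > 0" and dn: "d * n = l * m"
  shows "(\<Sum>xs\<in>permutations_of_set {1..l * m}. real (size_count d l m n k xs))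
    = first_moment d l m n k * fact (l * m)"
proof -
  have one: "card {xs \<in> permutations_of_set {1..l * m}. matches d l n M xs}
      = (n choose (l * k)) * d ^ (l * k) * fact (l * k) * fact (l * (m - k))" if "M \<in> subsets m k" for M
  proof -
    have M: "M \<subseteq> {1..m}" "card M = k" using that by (auto simp: subsets_def)
    have "card ({1..m} - M) = m - k" using M finite_subset[OF M(1)] by (simp add: card_Diff_subset)
    then show ?thesis
      using card_matches_pair[OF l dn M(1) M(1)] card_patterns_single[OF l dn M(1) M(1) refl] M(2) by simp
  qed
  have "(\<Sum>xs\<in>permutations_of_set {1..l * m}. size_count d l m n k xs)
      = (\<Sum>M\<in>subsets m k. card {xs \<in> permutations_of_set {1..l * m}. matches d l n M xs})"
    unfolding size_count_def by (rule sum_card_swap) auto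
  also have "\<dots> = (m choose k) * ((n choose (l * k)) * d ^ (l * k) * fact (l * k) * fact (l * (m - k)))"
    using one by (simp add: card_subsets)
  finally have "(\<Sum>xs\<in>permutations_of_set {1..l * m}. size_count d l m n k xs)
      = (m choose k) * ((n choose (l * k)) * d ^ (l * k) * fact (l * k) * fact (l * (m - k)))" .
  from arg_cong[OF this, of real] show ?thesis
    by (simp add: first_moment_def)
qed

lemma card_diff_swap:
  assumes "M \<in> subsets m k" "M' \<in> subsets m k"
  shows "card (M' - M) = card (M - M')" "card (M \<inter> M') = k - card (M - M')" "card (M - M') \<le> k"
    "card ({1..m} - (M \<union> M')) = m - k - card (M - M')" "k + card (M - M') \<le> m"
proof -
  have f: "finite M" "finite M'" "M \<subseteq> {1..m}" "M' \<subseteq> {1..m}" "card M = k" "card M' = k"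
    using assms finite_subset by (auto simp: subsets_def)
  show 1: "card (M' - M) = card (M - M')"
    using card_Diff_subset_Int[of M' M] card_Diff_subset_Int[of M M'] f by (simp add: Int_commute)
  have 2: "card (M - M') + card (M \<inter> M') = k" using card_Diff_subset_Int[of M M'] card_mono[of M "M \<inter> M'"] f by simp
  then show "card (M \<inter> M') = k - card (M - M')" "card (M - M') \<le> k" by simp_all
  have 3: "card (M \<union> M') = k + card (M - M')" using card_Un_Int[of M M'] f 2 by simp
  then show "card ({1..m} - (M \<union> M')) = m - k - card (M - M')"
    using card_Diff_subset[of "M \<union> M'" "{1..m}"] f by simp
  show "k + card (M - M') \<le> m" using card_mono[of "{1..m}" "M \<union> M'"] f 3 by simp
qed

text \<open>\<open>M'\<close> is determined by the part removed from \<open>M\<close> and the part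
  added outside \<open>M\<close>, and both have size \<open>b\<close> because \<open>M\<close> and
  \<open>M'\<close> have equal size.\<close>

lemma card_pairs_le:
  assumes M: "M \<in> subsets m k"
  shows "card {M' \<in> subsets m k. card (M - M') = b} \<le> (k choose b) * ((m - k) choose b)"
proof -
  have M': "M \<subseteq> {1..m}" "card M = k" "finite M" using M finite_subset by (auto simp: subsets_def)
  define A where "A = {X. X \<subseteq> M \<and> card X = b}"
  define B where "B = {X. X \<subseteq> {1..m} - M \<and> card X = b}"
  have cAB: "card A = k choose b" "card B = (m - k) choose b"
    using n_subsets[of M b] n_subsets[of "{1..m} - M" b] M' by (simp_all add: A_def B_def card_Diff_subset)
  have "card {M' \<in> subsets m k. card (M - M') = b} \<le> card (A \<times> B)"
  proof (rule card_inj_on_le)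
    show "inj_on (\<lambda>M'. (M - M', M' - M)) {M' \<in> subsets m k. card (M - M') = b}"
      by (rule inj_onI) blast
    show "(\<lambda>M'. (M - M', M' - M)) ` {M' \<in> subsets m k. card (M - M') = b} \<subseteq> A \<times> B"
    proof
      fix p assume "p \<in> (\<lambda>M'. (M - M', M' - M)) ` {M' \<in> subsets m k. card (M - M') = b}"
      then obtain X where X: "X \<subseteq> {1..m}" "card X = k" "card (M - X) = b" "p = (M - X, X - M)"
        by (auto simp: subsets_def)
      have "card (X - M) = b"
        using card_diff_swap(1)[OF M, of X] X by (simp add: subsets_def)
      then show "p \<in> A \<times> B" using X by (auto simp: A_def B_def)
    qed
    show "finite (A \<times> B)" using M'(3) by (auto simp: A_def B_def)
  qed
  then show ?thesis by (simp add: card_cartesian_product cAB)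
qed

text \<open>
  The binomial coefficients count the pairs of matchings with differences of size \<open>b\<close>; the remaining
  factor bounds the probability that both members of such a pair are matchings.
\<close>

definition pair_bound :: "nat \<Rightarrow> nat \<Rightarrow> nat \<Rightarrow> nat \<Rightarrow> nat \<Rightarrow> nat \<Rightarrow> real \<Rightarrow> real \<Rightarrow> real" where
  "pair_bound d l m n k b x y = real (m choose k) * real (k choose b) * real ((m - k) choose b)
     * (1 + real d * x + 2 * real d * y + real (d * (d - 1)) * y\<^sup>2) ^ n
     * fact (l * (k - b)) * fact (l * b) * fact (l * b) * fact (l * (m - k - b))
     / (x ^ (l * (k - b)) * y ^ (2 * l * b) * fact (l * m))"

text \<open>The square counts ordered pairs. They are sorted by the size \<open>b\<close> of the
  difference, with at most \<open>m + 1\<close> values; the weights \<open>x\<close> and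
  \<open>y\<close> may be chosen separately for each \<open>b\<close>, and values of
  \<open>b\<close> that no pair realizes contribute empty classes.\<close>

lemma sum_size_count_square_le:
  assumes l: "l > 0" and dn: "d * n = l * m" and k: "k \<le> m"
    and E: "\<And>b. b \<le> k \<Longrightarrow> k + b \<le> m \<Longrightarrow> \<exists>x y. 0 < x \<and> 0 < y \<and> pair_bound d l m n k b x y \<le> E"
    and E0: "E \<ge> 0"
  shows "(\<Sum>xs\<in>permutations_of_set {1..l * m}. (real (size_count d l m n k xs))\<^sup>2)
    \<le> real (m + 1) * E * fact (l * m)"
proof -
  define \<Omega> where "\<Omega> = permutations_of_set {1..l * m}"
  define F where "F = subsets m k"
  define J where "J M M' = card {xs \<in> \<Omega>. matches d l n M xs \<and> matches d l n M' xs}" for M M'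
  have finF: "finite F" by (simp add: F_def)
  have sq: "(size_count d l m n k xs)\<^sup>2 = card {p \<in> F \<times> F. matches d l n (fst p) xs \<and> matches d l n (snd p) xs}" for xs
  proof -
    have "{p \<in> F \<times> F. matches d l n (fst p) xs \<and> matches d l n (snd p) xs}
        = {M \<in> F. matches d l n M xs} \<times> {M \<in> F. matches d l n M xs}" by auto
    then show ?thesis by (simp add: size_count_def F_def card_cartesian_product power2_eq_square)
  qed
  have "(\<Sum>xs\<in>\<Omega>. (size_count d l m n k xs)\<^sup>2) = (\<Sum>p\<in>F \<times> F. J (fst p) (snd p))"
    unfolding sq J_def using finF by (intro sum_card_swap) (auto simp: \<Omega>_def)
  also have "\<dots> = (\<Sum>M\<in>F. \<Sum>M'\<in>F. J M M')" by (simp add: sum.cartesian_product case_prod_unfold)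
  \<comment> \<open>For each \<open>M\<close> the factor \<open>m choose k\<close> contained in
    \<open>pair_bound\<close> is divided out; summing over the \<open>m choose k\<close> sets
    \<open>M\<close> restores it.\<close>
  also have "real \<dots> \<le> real (\<Sum>M\<in>F. 1) * (real (m + 1) * (E * fact (l * m) / real (m choose k)))"
    unfolding of_nat_sum sum_distrib_right
  proof (rule sum_mono)
    fix M assume M: "M \<in> F"
    define Fb where "Fb b = {M' \<in> F. card (M - M') = b}" for b
    have Fb_empty: "b \<le> k \<and> k + b \<le> m" if "M' \<in> Fb b" for M' b
      using card_diff_swap[of M m k M'] M that by (auto simp: F_def Fb_def)
    have "(\<Sum>M'\<in>F. real (J M M')) = (\<Sum>b\<le>m. \<Sum>M'\<in>Fb b. real (J M M'))"
    proof -
      have "F = (\<Union>b\<in>{..m}. Fb b)" using card_diff_swap(3)[of M m k] M k by (force simp: F_def Fb_def)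
      moreover have "(\<Sum>M'\<in>(\<Union>b\<in>{..m}. Fb b). real (J M M')) = (\<Sum>b\<le>m. \<Sum>M'\<in>Fb b. real (J M M'))"
        using finF by (intro sum.UNION_disjoint) (auto simp: Fb_def)
      ultimately show ?thesis by simp
    qed
    also have "\<dots> \<le> (\<Sum>b\<le>m. E * fact (l * m) / real (m choose k))"
    proof (rule sum_mono)
      fix b
      have mk: "real (m choose k) > 0" using k by (simp add: zero_less_binomial)
      show "(\<Sum>M'\<in>Fb b. real (J M M')) \<le> E * fact (l * m) / real (m choose k)"
      proof (cases "Fb b = {}")
        case True
        then show ?thesis using E0 by simp
      next
        case False
        then have b: "b \<le> k" "k + b \<le> m" using Fb_empty by auto
        obtain x y where xy: "0 < x" "0 < y" "pair_bound d l m n k b x y \<le> E" using E[OF b] by blast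
        define W where "W = 1 + real d * x + 2 * real d * y + real (d * (d - 1)) * y\<^sup>2"
        define X where "X = x ^ (l * (k - b)) * y ^ (2 * l * b)"
        define T where "T = (fact (l * (k - b)) * fact (l * b) * fact (l * b) * fact (l * (m - k - b)) :: real)"
        have X: "X > 0" using xy by (simp add: X_def)
        have T: "T > 0" by (simp add: T_def)
        have W: "W > 0" using xy by (simp add: W_def add_pos_nonneg)
        have J: "real (J M M') \<le> W ^ n / X * T" if M': "M' \<in> Fb b" for M'
        proof -
          have MM: "M \<subseteq> {1..m}" "M' \<subseteq> {1..m}" "M \<in> subsets m k" "M' \<in> subsets m k"
            using M M' by (auto simp: F_def Fb_def subsets_def)
          have cb: "card (M - M') = b" using M' by (simp add: Fb_def)
          note cs = card_diff_swap[OF MM(3,4), unfolded cb]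
          define p where "p = real (card (patterns d l m n M M'))"
          have "p * X \<le> W ^ n"
            using card_patterns_le[OF l dn MM(1,2), of x y b] xy cb cs unfolding p_def X_def W_def by simp
          then have p: "p \<le> W ^ n / X" using X by (simp add: pos_le_divide_eq)
          have "real (J M M') = p * T"
            unfolding J_def \<Omega>_def card_matches_pair[OF l dn MM(1,2)] cb cs p_def T_def by simp
          also have "\<dots> \<le> W ^ n / X * T" using p T by (intro mult_right_mono) auto
          finally show ?thesis .
        qed
        have "(\<Sum>M'\<in>Fb b. real (J M M')) \<le> real (card (Fb b)) * (W ^ n / X * T)"
          using sum_mono[OF J] by simp
        also have "\<dots> \<le> real ((k choose b) * ((m - k) choose b)) * (W ^ n / X * T)"
          using card_pairs_le[of M m k b] M X T W
          by (intro mult_right_mono) (simp_all only: Fb_def F_def of_nat_le_iff, simp)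
        also have "\<dots> = pair_bound d l m n k b x y * fact (l * m) / real (m choose k)"
          using mk unfolding pair_bound_def W_def[symmetric] X_def[symmetric] by (simp add: T_def)
        also have "\<dots> \<le> E * fact (l * m) / real (m choose k)"
          using xy mk by (intro divide_right_mono mult_right_mono) auto
        finally show ?thesis .
      qed
    qed
    also have "\<dots> = real 1 * (real (m + 1) * (E * fact (l * m) / real (m choose k)))" by simp
    finally show "(\<Sum>M'\<in>F. real (J M M')) \<le> real 1 * (real (m + 1) * (E * fact (l * m) / real (m choose k)))" .
  qed
  also have "\<dots> = real (m + 1) * E * fact (l * m)"
    using k by (simp add: F_def card_subsets zero_less_binomial)
  finally show ?thesis by (simp add: \<Omega>_def)
qed

text \<open>Once the binomials are expanded, five factorials stand in the numerator and cost one
  logarithmic error each; those in the denominator are bounded below without error. The factorials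
  of multiples of \<open>l\<close> give \<open>l\<close> times the entropy sum and the binomials
  remove it once, which leaves the factor \<open>l - 1\<close>.\<close>

lemma ln_pair_bound:
  fixes x y :: real
  assumes dl: "d > 0" "l > 0" "m > 0" and dn: "d * n = l * m" and k: "b \<le> k" "k + b \<le> m"
    and xy: "0 < x" "0 < y"
  shows "pair_bound d l m n k b x y > 0"
    "ln (pair_bound d l m n k b x y) \<le> m * ((real l - 1) * (eta (real (k - b) / m) + 2 * eta (real b / m) + eta (real (m - k - b) / m))
      + real l / real d * ln (1 + real d * x + 2 * real d * y + real (d * (d - 1)) * y\<^sup>2)
      - real l * (real (k - b) / m) * ln x - 2 * real l * (real b / m) * ln y)
      + 5 * (1 + ln (real (l * m) + 1))"
proof -
  define R where "R = 1 + ln (real (l * m) + 1)"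
  define W where "W = 1 + real d * x + 2 * real d * y + real (d * (d - 1)) * y\<^sup>2"
  define a where "a = k - b"
  define q where "q = m - k - b"
  have W: "W > 0" using xy by (simp add: W_def add_pos_nonneg)
  have sum: "real a + 2 * real b + real q = m" using k by (simp add: a_def q_def)
  have le: "a \<le> m" "b \<le> m" "q \<le> m" using k by (auto simp: a_def q_def)
  have lm: "m \<le> l * m" using dl by simp
  define f where "f a = ln (fact a :: real)" for a
  have upper: "f a \<le> eta a - a + R" if "a \<le> l * m" for a
    using ln_fact_error[OF that] unfolding f_def R_def by (metis add_le_cancel_left)
  have lower: "f a \<ge> eta a - a" for a using ln_fact_bounds(1) by (simp add: f_def)
  have "real (m choose k) * real (k choose b) * real ((m - k) choose b) = fact m / (fact a * fact b * fact b * fact q)"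
    using k by (simp add: binomial_fact a_def q_def)
  then have eq: "pair_bound d l m n k b x y = fact m / (fact a * fact b * fact b * fact q) * W ^ n
     * fact (l * a) * fact (l * b) * fact (l * b) * fact (l * q)
     / (x ^ (l * a) * y ^ (2 * l * b) * fact (l * m))"
    unfolding pair_bound_def W_def a_def q_def by simp
  show "pair_bound d l m n k b x y > 0" unfolding eq using W xy by simp
  have nn: "real n = m * (real l / real d)" using dn dl by (simp add: field_simps flip: of_nat_mult)
  have "ln (pair_bound d l m n k b x y) = f m - (f a + f b + f b + f q) + n * ln W
      + f (l * a) + f (l * b) + f (l * b) + f (l * q) - (real (l * a) * ln x + real (2 * l * b) * ln y + f (l * m))"
    unfolding eq using W xy by (simp add: f_def ln_mult ln_div ln_realpow)
  also have "\<dots> \<le> (eta m - (eta a + 2 * eta b + eta q)) + n * ln W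
      + eta (l * a) + 2 * eta (l * b) + eta (l * q) - (real (l * a) * ln x + real (2 * l * b) * ln y + eta (l * m)) + 5 * R"
  proof -
    have "real (l * a) + 2 * real (l * b) + real (l * q) = real (l * m)"
    proof -
      have "real (l * a) + 2 * real (l * b) + real (l * q) = l * (real a + 2 * real b + real q)"
        by (simp add: algebra_simps)
      then show ?thesis by (simp add: sum)
    qed
    moreover have "l * a \<le> l * m" "l * b \<le> l * m" "l * q \<le> l * m" using le by auto
    ultimately show ?thesis
      using upper[OF lm] lower[of a] lower[of b] lower[of q] upper[of "l * a"] upper[of "l * b"] upper[of "l * q"]
        lower[of "l * m"] sum by linarith
  qed
  also have "(eta m - (eta a + 2 * eta b + eta q)) + n * ln W
      + eta (l * a) + 2 * eta (l * b) + eta (l * q) - (real (l * a) * ln x + real (2 * l * b) * ln y + eta (l * m))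
    = m * ((real l - 1) * (eta (a / m) + 2 * eta (b / m) + eta (q / m)) + real l / real d * ln W
      - real l * (a / m) * ln x - 2 * real l * (b / m) * ln y)"
  proof -
    have e: "eta (real c) = m * eta (real c / m) + (real c / m) * eta m" for c
      using eta_mult[of "real m" "real c / m"] dl by simp
    have el: "eta (real (l * c)) = l * eta c + c * eta l" for c by (simp add: eta_mult)
    have "eta (l * a) + 2 * eta (l * b) + eta (l * q) - eta (l * m)
        = l * (eta a + 2 * eta b + eta q - eta m) + (real a + 2 * real b + real q - m) * eta l"
      unfolding el by (simp add: algebra_simps)
    then have h: "eta (l * a) + 2 * eta (l * b) + eta (l * q) - eta (l * m) = l * (eta a + 2 * eta b + eta q - eta m)"
      using sum by simp
    have "eta a + 2 * eta b + eta q = m * (eta (a / m) + 2 * eta (b / m) + eta (q / m))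
        + (real a + 2 * real b + real q) / m * eta m"
      unfolding e[of a] e[of b] e[of q] by (simp add: algebra_simps add_divide_distrib)
    then have "eta a + 2 * eta b + eta q - eta m = m * (eta (a / m) + 2 * eta (b / m) + eta (q / m))"
      using sum dl by simp
    then have "(real l - 1) * (eta a + 2 * eta b + eta q - eta m)
        = (real l - 1) * (m * (eta (a / m) + 2 * eta (b / m) + eta (q / m)))" by simp
    moreover have "n * ln W = m * (real l / real d * ln W)" by (simp add: nn)
    moreover have "real (l * a) * ln x = m * (real l * (a / m) * ln x)"
      "real (2 * l * b) * ln y = m * (2 * real l * (b / m) * ln y)" using dl by simp_all
    ultimately show ?thesis using h by (simp only: ring_distribs) (simp add: algebra_simps)
  qed
  finally show "ln (pair_bound d l m n k b x y) \<le> m * ((real l - 1) * (eta (real (k - b) / m) + 2 * eta (real b / m) + eta (real (m - k - b) / m))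
      + real l / real d * ln (1 + real d * x + 2 * real d * y + real (d * (d - 1)) * y\<^sup>2)
      - real l * (real (k - b) / m) * ln x - 2 * real l * (real b / m) * ln y)
      + 5 * (1 + ln (real (l * m) + 1))"
    unfolding a_def q_def W_def R_def .
qed

section \<open>Tools for passing to exponential order\<close>

lemma log_term_negligible:
  assumes "l > 0" "\<gamma> > 0"
  shows "eventually (\<lambda>m. A + B * (1 + ln (real (l * m) + 1)) + ln (real m + 1) \<le> \<gamma> * real m) sequentially"
proof -
  define L where "L = real l"
  have "L > 0" using assms(1) by (simp add: L_def)
  then have "((\<lambda>m. (A + B * (1 + ln (L * real m + 1)) + ln (real m + 1)) / real m) \<longlongrightarrow> 0) sequentially"
    by real_asymp
  then have "eventually (\<lambda>m. (A + B * (1 + ln (L * real m + 1)) + ln (real m + 1)) / real m < \<gamma>) sequentially"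
    using assms(2) by (rule order_tendstoD)
  then show ?thesis
    using eventually_gt_at_top[of 0]
    by eventually_elim (simp add: L_def field_simps)
qed

text \<open>The Paley-Zygmund inequality at half the mean, in counting form: values below
  \<open>a / 2\<close> make up at most half of the sum, and Cauchy-Schwarz bounds the contribution
  of the others.\<close>

lemma second_moment_method:
  fixes Z :: "'a \<Rightarrow> real" and a b :: real
  assumes fin: "finite \<Omega>" and Z: "\<And>x. x \<in> \<Omega> \<Longrightarrow> Z x \<ge> 0" and a: "a > 0"
    and first: "(\<Sum>x\<in>\<Omega>. Z x) = a * card \<Omega>" and second: "(\<Sum>x\<in>\<Omega>. (Z x)\<^sup>2) \<le> b * card \<Omega>"
  shows "a\<^sup>2 / 4 * card \<Omega> \<le> card {x \<in> \<Omega>. Z x \<ge> a / 2} * b"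
proof (cases "\<Omega> = {}")
  case False
  then have c: "real (card \<Omega>) > 0" using fin by (simp add: card_gt_0_iff)
  define U where "U = {x \<in> \<Omega>. Z x \<ge> a / 2}"
  have U: "U \<subseteq> \<Omega>" "finite U" using fin by (auto simp: U_def)
  have "a * card \<Omega> = (\<Sum>x\<in>U. Z x) + (\<Sum>x\<in>\<Omega> - U. Z x)"
    using first sum.subset_diff[OF U(1) fin, of Z] by simp
  also have "(\<Sum>x\<in>\<Omega> - U. Z x) \<le> (\<Sum>x\<in>\<Omega> - U. a / 2)" by (intro sum_mono) (auto simp: U_def)
  also have "\<dots> \<le> a / 2 * card \<Omega>"
    using a card_mono[OF fin, of "\<Omega> - U"] by simp
  finally have lower: "a / 2 * card \<Omega> \<le> (\<Sum>x\<in>U. Z x)" by simp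
  have "(a / 2 * card \<Omega>)\<^sup>2 \<le> (\<Sum>x\<in>U. Z x)\<^sup>2" using lower a by (intro power_mono) auto
  also have "\<dots> = (\<Sum>x\<in>U. Z x * 1)\<^sup>2" by simp
  also have "\<dots> \<le> (\<Sum>x\<in>U. (Z x)\<^sup>2) * (\<Sum>x\<in>U. 1\<^sup>2)" by (rule Cauchy_Schwarz_ineq_sum)
  also have "\<dots> \<le> (b * card \<Omega>) * card U"
  proof -
    have "(\<Sum>x\<in>U. (Z x)\<^sup>2) \<le> (\<Sum>x\<in>\<Omega>. (Z x)\<^sup>2)" using fin U(1) by (intro sum_mono2) auto
    then have "(\<Sum>x\<in>U. (Z x)\<^sup>2) \<le> b * card \<Omega>" using second by linarith
    then show ?thesis by (simp add: mult_right_mono)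
  qed
  finally have "(a\<^sup>2 / 4 * card \<Omega>) * card \<Omega> \<le> (card U * b) * card \<Omega>"
    by (simp add: power2_eq_square algebra_simps)
  then show ?thesis using c by (simp add: U_def)
qed simp

section \<open>The model at the optimal density\<close>

locale matching_model =
  fixes d l :: nat
  assumes dl: "d \<ge> 2" "l \<ge> 2"
    and G: "\<And>s. 0 < s \<Longrightarrow> s < beta_star d l - c0 l (beta_star d l) \<Longrightarrow> G_fun d l (beta_star d l) s > 0"
begin

abbreviation "\<beta> \<equiv> beta_star d l"
abbreviation "\<Phi> \<equiv> Phi d l \<beta>"
abbreviation "size_of m \<equiv> nat \<lfloor>\<beta> * real m\<rfloor>"
abbreviation "perms m \<equiv> permutations_of_set {1..l * m}"

lemma beta_half: "\<beta> < 1 / 2"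
proof -
  have "1 / real d \<le> 1 / 2" using dl by (simp add: field_simps)
  then show ?thesis using beta_star_props(2)[OF dl] by linarith
qed

lemma size_of_bounds: "real (size_of m) \<le> \<beta> * m" "\<beta> * m < real (size_of m) + 1"
  using beta_star_props(1)[OF dl] by (simp_all add: of_nat_nat)

lemma size_of_le:
  assumes dn: "d * n = l * m"
  shows "l * size_of m \<le> n" "size_of m \<le> m"
proof -
  have "real (size_of m) \<le> 1 / real d * m"
    using size_of_bounds(1)[of m] mult_right_mono[OF less_imp_le[OF beta_star_props(2)[OF dl]], of "real m"] by simp
  then have "real (d * size_of m) \<le> real m" using dl by (simp add: field_simps)
  then have "d * size_of m \<le> m" by (simp only: of_nat_le_iff)
  then have "l * (d * size_of m) \<le> l * m" "1 * size_of m \<le> d * size_of m"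
    using dl by (auto intro: mult_right_mono)
  then have "d * (l * size_of m) \<le> d * n" by (simp add: dn mult.left_commute)
  then show "l * size_of m \<le> n" using dl by simp
  show "size_of m \<le> m" using \<open>d * size_of m \<le> m\<close> \<open>1 * size_of m \<le> d * size_of m\<close> by linarith
qed

text \<open>Compares the exponent at the rounded density \<open>size_of m / m\<close> with the one
  at \<open>\<beta>\<close>, where the overlap analysis applies. The overlap \<open>b / m\<close> is
  kept exact, so rounding affects only two \<open>eta\<close> terms and the coefficient of
  \<open>ln x\<close>. The threshold for \<open>m\<close> has to be the same for all
  \<open>b\<close>, hence the quantifiers inside \<open>eventually\<close>.\<close>

lemma eventually_pair_bound:
  assumes "e > 0"
  shows "eventually (\<lambda>m. \<forall>n b. d * n = l * m \<longrightarrow> b \<le> size_of m \<longrightarrow> size_of m + b \<le> m \<longrightarrow>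
     (\<exists>x y. 0 < x \<and> 0 < y \<and> pair_bound d l m n (size_of m) b x y \<le> exp (m * (2 * \<Phi> + e)))) sequentially"
proof -
  interpret overlap d l \<beta>
    using dl beta_star_props[OF dl] G by unfold_locales auto
  have "e / 4 > 0" using assms by simp
  then obtain X where X: "X > 0"
    "\<And>s. 0 \<le> s \<Longrightarrow> s \<le> \<beta> \<Longrightarrow>
       \<exists>x y. 0 < x \<and> x \<le> X \<and> 0 < y \<and> overlap_exponent d l \<beta> s x y \<le> 2 * \<Phi> + e / 4"
    using overlap_exponent_bound by blast
  \<comment> \<open>The maximum with 0 makes \<open>r * L \<le> L / m\<close> valid also when
    \<open>X < 1\<close>.\<close>
  define L where "L = max 0 (ln X)"
  have L: "0 \<le> L" "ln X \<le> L" by (auto simp: L_def)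
  \<comment> \<open>Two \<open>eta\<close> terms with error \<open>e'\<close> each, multiplied by
    \<open>l - 1\<close>, cost at most \<open>e / 4\<close>. Further quarters of \<open>e\<close> go
    to the approximation of the overlap exponent and to the logarithmic terms.\<close>
  define e' where "e' = e / (8 * real l)"
  have e': "e' > 0" "(real l - 1) * (2 * e') \<le> e / 4"
    using assms dl by (auto simp: e'_def field_simps)
  obtain \<delta> where \<delta>: "\<delta> > 0"
    "\<And>x y. 0 \<le> x \<Longrightarrow> x \<le> 1 \<Longrightarrow> 0 \<le> y \<Longrightarrow> y \<le> 1 \<Longrightarrow> \<bar>x - y\<bar> < \<delta> \<Longrightarrow> \<bar>eta x - eta y\<bar> < e'"
    using eta_uniformly_continuous[OF e'(1)] by metis
  have "eventually (\<lambda>m. 1 / \<delta> < real m) sequentially"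
    using filterlim_real_sequentially by (simp add: filterlim_at_top_dense)
  moreover have "l > 0" "e / 4 > 0" using dl assms by auto
  note log_term_negligible[OF this, of "l * L" 5]
  ultimately show ?thesis
    using eventually_gt_at_top[of 0]
  proof eventually_elim
    case (elim m)
    show ?case
    proof (intro allI impI)
      fix n b assume dn: "d * n = l * m" and b: "b \<le> size_of m" "size_of m + b \<le> m"
      define k where "k = size_of m"
      have bk: "b \<le> k" "k + b \<le> m" using b by (simp_all only: k_def)
      define s where "s = real b / m"
      define r where "r = \<beta> - k / m"
      have m: "real m > 0" using elim by simp
      have "r * m \<ge> 0" "r * m \<le> 1" 
      proof -
        have "r * m = \<beta> * m - k" using m by (simp add: r_def left_diff_distrib)
        then show "r * m \<ge> 0" "r * m \<le> 1" using size_of_bounds[of m] unfolding k_def by linarith+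
      qed
      then have r: "0 \<le> r" "r \<le> 1 / m" using m by (auto simp: field_simps zero_le_mult_iff)
      have "1 / m < \<delta>" using elim(1) \<delta>(1) m by (simp add: field_simps)
      then have rd: "r < \<delta>" using r by linarith
      have kb: "real (k - b) / m = \<beta> - s - r" "real (m - k - b) / m = 1 - \<beta> - s + r"
      proof -
        have "real (k - b) = real k - b" "real (m - k - b) = real m - k - b"
          using bk by (simp_all add: of_nat_diff)
        then show "real (k - b) / m = \<beta> - s - r" "real (m - k - b) / m = 1 - \<beta> - s + r"
          using m by (simp_all add: s_def r_def diff_divide_distrib)
      qed
      have s0: "0 \<le> s" "s \<le> \<beta>" 
      proof -
        show "0 \<le> s" by (simp add: s_def)
        have "real (k - b) / m \<ge> 0" by simp
        then show "s \<le> \<beta>" using kb(1) r by linarith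
      qed
      obtain x y where xy: "0 < x" "x \<le> X" "0 < y" "overlap_exponent d l \<beta> s x y \<le> 2 * \<Phi> + e / 4"
        using X(2)[OF s0] by blast
      define W where "W = 1 + real d * x + 2 * real d * y + real (d * (d - 1)) * y\<^sup>2"
      have lx: "ln x \<le> L" using xy L X(1) ln_le_cancel_iff[of x X] by linarith
      have "0 \<le> real (k - b) / m" "real (k - b) / m \<le> 1" "0 \<le> real (m - k - b) / m" "real (m - k - b) / m \<le> 1"
        using bk m by (auto simp: divide_le_eq)
      then have rng: "0 \<le> \<beta> - s - r" "\<beta> - s - r \<le> 1" "0 \<le> 1 - \<beta> - s + r" "1 - \<beta> - s + r \<le> 1"
        unfolding kb by auto
      have eta1: "eta (\<beta> - s - r) \<le> eta (\<beta> - s) + e'"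
        using \<delta>(2)[of "\<beta> - s - r" "\<beta> - s"] rng r rd s0 beta_half by (simp add: abs_le_iff abs_less_iff)
      have eta2: "eta (1 - \<beta> - s + r) \<le> eta (1 - \<beta> - s) + e'"
        using \<delta>(2)[of "1 - \<beta> - s + r" "1 - \<beta> - s"] rng r rd s0 beta_half beta_star_props(1)[OF dl]
        by (simp add: abs_less_iff)
      have "ln (pair_bound d l m n k b x y) \<le> m * ((real l - 1) * (eta (\<beta> - s - r) + 2 * eta s + eta (1 - \<beta> - s + r))
          + real l / real d * ln W - real l * (\<beta> - s - r) * ln x - 2 * real l * s * ln y)
          + 5 * (1 + ln (real (l * m) + 1))"
        using ln_pair_bound(2)[of d l m n b k x y] dn bk xy dl elim
        unfolding kb s_def[symmetric] W_def[symmetric] by simp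
      also have "\<dots> \<le> m * (overlap_exponent d l \<beta> s x y + e / 4 + l * (1 / m * L)) + 5 * (1 + ln (real (l * m) + 1))"
      proof (intro add_right_mono mult_left_mono)
        have "(real l - 1) * (eta (\<beta> - s - r) + 2 * eta s + eta (1 - \<beta> - s + r))
            \<le> (real l - 1) * ((eta (\<beta> - s) + 2 * eta s + eta (1 - \<beta> - s)) + 2 * e')"
          using eta1 eta2 dl by (intro mult_left_mono) auto
        also have "\<dots> \<le> (real l - 1) * (eta (\<beta> - s) + 2 * eta s + eta (1 - \<beta> - s)) + e / 4"
          using e'(2) by (simp add: distrib_left)
        finally have t1: "(real l - 1) * (eta (\<beta> - s - r) + 2 * eta s + eta (1 - \<beta> - s + r))
            \<le> (real l - 1) * (eta (\<beta> - s) + 2 * eta s + eta (1 - \<beta> - s)) + e / 4" .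
        have "r * ln x \<le> r * L" using lx r by (intro mult_left_mono)
        also have "\<dots> \<le> 1 / m * L" using L r by (intro mult_right_mono)
        finally have "real l * (r * ln x) \<le> l * (1 / m * L)" by (intro mult_left_mono) auto
        moreover have "real l * (\<beta> - s - r) * ln x = real l * (\<beta> - s) * ln x - real l * (r * ln x)"
          by (simp add: algebra_simps)
        ultimately show "(real l - 1) * (eta (\<beta> - s - r) + 2 * eta s + eta (1 - \<beta> - s + r))
          + real l / real d * ln W - real l * (\<beta> - s - r) * ln x - 2 * real l * s * ln y
          \<le> overlap_exponent d l \<beta> s x y + e / 4 + l * (1 / m * L)"
          using t1 unfolding overlap_exponent_def W_def by linarith
      qed simp
      also have "\<dots> \<le> m * (2 * \<Phi> + e / 4 + e / 4 + l * (1 / m * L)) + 5 * (1 + ln (real (l * m) + 1))"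
        using xy(4) by (intro add_right_mono mult_left_mono) auto
      also have "\<dots> = m * (2 * \<Phi> + e / 2) + (l * L + 5 * (1 + ln (real (l * m) + 1)))"
        using m by (simp add: field_simps)
      also have "\<dots> \<le> m * (2 * \<Phi> + e)"
      proof -
        have "ln (real m + 1) \<ge> 0" by simp
        then have "l * L + 5 * (1 + ln (real (l * m) + 1)) \<le> e / 4 * m" using elim(2) by linarith
        moreover have "e * m \<ge> 0" using assms by simp
        ultimately show ?thesis by (simp add: algebra_simps)
      qed
      finally have "ln (pair_bound d l m n k b x y) \<le> m * (2 * \<Phi> + e)" .
      moreover have "pair_bound d l m n k b x y > 0"
        using ln_pair_bound(1)[of d l m n b k x y] dn bk xy dl elim by simp
      ultimately have "pair_bound d l m n k b x y \<le> exp (m * (2 * \<Phi> + e))"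
        using exp_le_cancel_iff[of "ln (pair_bound d l m n k b x y)"] by simp
      then show "\<exists>x y. 0 < x \<and> 0 < y \<and> pair_bound d l m n (size_of m) b x y \<le> exp (m * (2 * \<Phi> + e))"
        using xy unfolding k_def by blast
    qed
  qed
qed

end

section \<open>Convergence in probability\<close>

context matching_model
begin

lemma tendsto_size_of: "(\<lambda>m. size_of m / m) \<longlonglongrightarrow> \<beta>"
proof (rule tendsto_sandwich)
  have "(\<lambda>m. \<beta> - 1 / real m) \<longlonglongrightarrow> \<beta> - 0" by (intro tendsto_intros lim_1_over_n)
  then show "(\<lambda>m. \<beta> - 1 / real m) \<longlonglongrightarrow> \<beta>" by simp
  show "eventually (\<lambda>m. \<beta> - 1 / real m \<le> size_of m / m) sequentially"
    using eventually_gt_at_top[of 0]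
  proof eventually_elim
    case (elim m)
    then have "(\<beta> - 1 / real m) * m \<le> size_of m" using size_of_bounds(2)[of m] by (simp add: left_diff_distrib)
    then show ?case using elim by (simp add: pos_le_divide_eq)
  qed
  show "eventually (\<lambda>m. size_of m / m \<le> \<beta>) sequentially"
    using eventually_gt_at_top[of 0]
    by eventually_elim (use size_of_bounds(1) in \<open>simp add: pos_divide_le_eq\<close>)
qed simp

lemma tendsto_Phi_size_of: "(\<lambda>m. Phi d l (size_of m / m)) \<longlonglongrightarrow> \<Phi>"
proof -
  note b = beta_star_props[OF dl]
  have "real d * \<beta> < 1" using b(2) dl by (simp add: field_simps)
  then have "isCont (Phi d l) \<beta>"
    unfolding Phi_def[abs_def] using b(1) beta_half dl by (intro continuous_intros) auto
  then show ?thesis using tendsto_size_of by (rule isCont_tendsto_compose)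
qed

lemma first_moment_lower:
  fixes e :: real
  assumes "e > 0"
  shows "eventually (\<lambda>m. \<forall>n. d * n = l * m \<longrightarrow> first_moment d l m n (size_of m) > 0 \<and>
    ln (first_moment d l m n (size_of m)) \<ge> m * (\<Phi> - e) - 9 * (1 + ln (real (l * m) + 1))) sequentially"
proof -
  have "eventually (\<lambda>m. Phi d l (size_of m / m) > \<Phi> - e) sequentially"
    using tendsto_Phi_size_of assms by (intro order_tendstoD) auto
  then show ?thesis using eventually_gt_at_top[of 0]
  proof eventually_elim
    case (elim m)
    show ?case
    proof (intro allI impI)
      fix n assume dn: "d * n = l * m"
      have "d > 0" "l > 0" using dl by auto
      note f = first_moment_estimate[OF this elim(2) dn size_of_le(2,1)[OF dn]]
      have "m * (\<Phi> - e) \<le> m * Phi d l (size_of m / m)" using elim by (intro mult_left_mono) auto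
      then show "first_moment d l m n (size_of m) > 0 \<and>
          ln (first_moment d l m n (size_of m)) \<ge> m * (\<Phi> - e) - 9 * (1 + ln (real (l * m) + 1))"
        using f by linarith
    qed
  qed
qed

text \<open>Paley-Zygmund for the matchings of size \<open>size_of m\<close>, whose number is a
  lower bound for the total count.\<close>

lemma matching_count_large:
  fixes e :: real
  assumes "e > 0"
  shows "eventually (\<lambda>m. \<forall>n. d * n = l * m \<longrightarrow>
    card {xs \<in> perms m. ln (matching_count d l m n xs) \<ge> m * (\<Phi> - e)} \<ge> exp (- (e * m)) * fact (l * m)) sequentially"
proof -
  \<comment> \<open>The squared first moment loses \<open>2 * e'\<close> and the second moment
    \<open>e'\<close> in the exponent, together \<open>e / 2\<close>; the other half of
    \<open>e\<close> absorbs the logarithmic terms.\<close>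
  define e' where "e' = e / 6"
  have e': "e' > 0" using assms by (simp add: e'_def)
  have l: "l > 0" using dl by simp
  have "e / 2 > 0" using assms by simp
  from log_term_negligible[OF l this, of "2 * ln 2" 18] first_moment_lower[OF e'] eventually_pair_bound[OF e']
  show ?thesis
  proof eventually_elim
    case (elim m)
    show ?case
    proof (intro allI impI)
      fix n assume dn: "d * n = l * m"
      define k where "k = size_of m"
      define f where "f = first_moment d l m n k"
      define E where "E = exp (m * (2 * \<Phi> + e'))"
      define R where "R = 1 + ln (real (l * m) + 1)"
      define B where "B = {xs \<in> perms m. real (size_count d l m n k xs) \<ge> f / 2}"
      have k: "k \<le> m" unfolding k_def by (rule size_of_le(2)[OF dn])
      have f: "f > 0" "ln f \<ge> m * (\<Phi> - e') - 9 * R" using elim(2) dn by (auto simp: f_def k_def R_def)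
      have R: "R \<ge> 0" by (simp add: R_def)
      have err: "2 * ln 2 + 18 * R + ln (real m + 1) \<le> e / 2 * m" using elim(1) by (simp add: R_def)
      have card_perms: "real (card (perms m)) = fact (l * m)" by simp
      have "f\<^sup>2 / 4 * card (perms m) \<le> card B * (real (m + 1) * E)"
        unfolding B_def
      proof (rule second_moment_method)
        show "(\<Sum>xs\<in>perms m. real (size_count d l m n k xs)) = f * card (perms m)"
          unfolding card_perms f_def by (rule sum_size_count[OF l dn])
        show "(\<Sum>xs\<in>perms m. (real (size_count d l m n k xs))\<^sup>2) \<le> real (m + 1) * E * card (perms m)"
          unfolding card_perms
          using elim(3) dn by (intro sum_size_count_square_le[OF l dn k]) (auto simp: E_def k_def)
      qed (use f in auto)
      then have B1: "f\<^sup>2 / 4 / (real (m + 1) * E) * fact (l * m) \<le> card B"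
      proof -
        have "0 < real (m + 1) * E" by (simp add: E_def)
        moreover have "f\<^sup>2 / 4 / (real (m + 1) * E) * fact (l * m) = f\<^sup>2 / 4 * fact (l * m) / (real (m + 1) * E)"
          by simp
        ultimately show ?thesis
          using \<open>f\<^sup>2 / 4 * card (perms m) \<le> _\<close> unfolding card_perms by (simp only: pos_divide_le_eq)
      qed
      have "exp (- (e * m)) \<le> f\<^sup>2 / 4 / (real (m + 1) * E)"
      proof -
        have "ln (f\<^sup>2 / 4 / (real (m + 1) * E)) = 2 * ln f - 2 * ln 2 - (ln (real m + 1) + m * (2 * \<Phi> + e'))"
          using f(1) ln_mult[of 2 "2 :: real"] by (simp add: ln_div ln_mult ln_realpow E_def add.commute)
        also have "\<dots> \<ge> 2 * (m * (\<Phi> - e') - 9 * R) - 2 * ln 2 - (ln (real m + 1) + m * (2 * \<Phi> + e'))"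
          by (intro diff_right_mono mult_left_mono f(2)) simp
        also have "2 * (m * (\<Phi> - e') - 9 * R) - 2 * ln 2 - (ln (real m + 1) + m * (2 * \<Phi> + e'))
            = - (e / 2 * m) - (2 * ln 2 + 18 * R + ln (real m + 1))"
          by (simp add: e'_def algebra_simps)
        finally have "- (e * m) \<le> ln (f\<^sup>2 / 4 / (real (m + 1) * E))" using err by linarith
        then have "exp (- (e * m)) \<le> exp (ln (f\<^sup>2 / 4 / (real (m + 1) * E)))" by (simp only: exp_le_cancel_iff)
        also have "\<dots> = f\<^sup>2 / 4 / (real (m + 1) * E)" using f(1) by (simp add: E_def)
        finally show ?thesis .
      qed
      then have "exp (- (e * m)) * fact (l * m) \<le> f\<^sup>2 / 4 / (real (m + 1) * E) * fact (l * m)"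
        by (intro mult_right_mono) auto
      also note B1
      also have "real (card B) \<le> card {xs \<in> perms m. ln (matching_count d l m n xs) \<ge> m * (\<Phi> - e)}"
      proof (intro of_nat_mono card_mono)
        show "B \<subseteq> {xs \<in> perms m. ln (matching_count d l m n xs) \<ge> m * (\<Phi> - e)}"
        proof (intro subsetI CollectI conjI)
          fix xs assume xs: "xs \<in> B"
          then show "xs \<in> perms m" by (simp add: B_def)
          have "f / 2 \<le> real (size_count d l m n k xs)" using xs by (simp add: B_def)
          also have "\<dots> \<le> matching_count d l m n xs" by (simp add: size_count_le)
          finally have "f / 2 \<le> matching_count d l m n xs" .
          then have "ln (f / 2) \<le> ln (matching_count d l m n xs)" using f(1) by (intro ln_mono) auto
          moreover have "ln (f / 2) = ln f - ln 2" using f(1) by (simp add: ln_div)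
          moreover have "m * (\<Phi> - e') - 9 * R - ln 2 \<ge> m * (\<Phi> - e)"
          proof -
            have "ln (real m + 1) \<ge> 0" "ln 2 \<ge> (0 :: real)" "e * m \<ge> 0" using assms by simp_all
            moreover have "m * (\<Phi> - e') = m * (\<Phi> - e) + 5 / 6 * (e * m)" by (simp add: e'_def algebra_simps)
            ultimately show ?thesis using err R by linarith
          qed
          ultimately show "ln (matching_count d l m n xs) \<ge> m * (\<Phi> - e)" using f(2) by linarith
        qed
      qed simp
      finally show "card {xs \<in> perms m. ln (matching_count d l m n xs) \<ge> m * (\<Phi> - e)} \<ge> exp (- (e * m)) * fact (l * m)" .
    qed
  qed
qed

lemma matching_count_lower_tail:
  fixes e :: real
  assumes "e > 0"
  obtains \<gamma> :: real where "\<gamma> > 0" "eventually (\<lambda>m. \<forall>n. d * n = l * m \<longrightarrow>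
    card {xs \<in> perms m. ln (matching_count d l m n xs) < m * (\<Phi> - e)} \<le> exp (- (\<gamma> * m)) * fact (l * m)) sequentially"
proof -
  \<comment> \<open>Three losses of \<open>h\<close> each: the slack \<open>e' \<le> h\<close> in
    \<open>matching_count_large\<close>, the upward deviation that bounds the mean from below by
    \<open>m * (\<Phi> - 2 * h)\<close>, and the downward deviation from that mean. The rate
    \<open>\<gamma>\<close> is the one of \<open>permutation_tail\<close> for deviation
    \<open>h * m\<close>, differences at most \<open>ln 4\<close> and \<open>l * m\<close>
    entries.\<close>
  define h where "h = e / 3"
  define \<gamma> where "\<gamma> = h\<^sup>2 / (4 * (ln 4)\<^sup>2 * l)"
  define e' where "e' = min h (\<gamma> / 2)"
  have h: "h > 0" using assms by (simp add: h_def)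
  have \<gamma>: "\<gamma> > 0" using h dl by (simp add: \<gamma>_def)
  have e': "e' > 0" "e' \<le> h" "e' < \<gamma>" using h \<gamma> by (auto simp: e'_def min_def)
  have "eventually (\<lambda>m. \<forall>n. d * n = l * m \<longrightarrow>
    card {xs \<in> perms m. ln (matching_count d l m n xs) < m * (\<Phi> - e)} \<le> exp (- (\<gamma> * m)) * fact (l * m)) sequentially"
    using matching_count_large[OF e'(1)] eventually_gt_at_top[of 0]
  proof eventually_elim
    case (elim m)
    show ?case
    proof (intro allI impI)
      fix n assume dn: "d * n = l * m"
      define f where "f xs = ln (real (matching_count d l m n xs))" for xs
      define A where "A = {1..l * m}"
      define \<mu> where "\<mu> = (\<Sum>xs\<in>permutations_of_set A. f xs) / fact (card A)"
      have A: "finite A" "A \<noteq> {}" "card A = l * m" using elim(2) dl by (auto simp: A_def)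
      have m: "real m > 0" using elim(2) by simp
      have up: "f xs - f (map (Transposition.transpose x y) xs) \<le> ln 4" for xs x y
      proof -
        define ys where "ys = map (Transposition.transpose x y) xs"
        have "real (matching_count d l m n xs) \<le> 4 * real (matching_count d l m n ys)"
          using matching_count_transpose[of d l m n xs x y] unfolding ys_def by linarith
        then have "f xs \<le> ln (4 * real (matching_count d l m n ys))"
          unfolding f_def using matching_count_pos[of d l m n xs] by (intro ln_mono) auto
        also have "\<dots> = ln 4 + f ys"
          unfolding f_def using matching_count_pos[of d l m n ys] by (simp add: ln_mult)
        finally show ?thesis by (simp add: ys_def)
      qed
      have lip: "\<bar>f xs - f (map (Transposition.transpose x y) xs)\<bar> \<le> ln 4" for xs x y
        using up[of xs x y] up[of "map (Transposition.transpose x y) xs" x y]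
        by (simp add: abs_le_iff comp_def)
      have r: "- (h * m)\<^sup>2 / (4 * (ln 4)\<^sup>2 * card A) = - (\<gamma> * m)"
        using m by (simp add: A(3) \<gamma>_def power2_eq_square)
      have hm: "h * m \<ge> 0" using h by simp
      have tail: "card {xs \<in> permutations_of_set A. f xs - \<mu> \<ge> h * m} \<le> exp (- (\<gamma> * m)) * fact (l * m)"
        using permutation_tail[of A "ln 4" "h * m" f, OF A(1,2) _ hm lip]
        unfolding r unfolding A(3) \<mu>_def by (simp add: mult.commute)
      have lip': "\<bar>- f xs - - f (map (Transposition.transpose x y) xs)\<bar> \<le> ln 4" for xs x y
        using lip[of xs x y] by linarith
      from permutation_tail[of A "ln 4" "h * m" "\<lambda>xs. - f xs", OF A(1,2) _ hm lip']
      have tail': "card {xs \<in> permutations_of_set A. \<mu> - f xs \<ge> h * m} \<le> exp (- (\<gamma> * m)) * fact (l * m)"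
        unfolding r unfolding A(3) \<mu>_def by (simp add: mult.commute sum_negf)
      \<comment> \<open>Otherwise the upper tail bound would contradict \<open>matching_count_large\<close>, as \<open>e' < \<gamma>\<close>.\<close>
      have mu: "\<mu> \<ge> m * (\<Phi> - 2 * h)"
      proof (rule ccontr)
        assume "\<not> \<mu> \<ge> m * (\<Phi> - 2 * h)"
        moreover have "m * (\<Phi> - 2 * h) + h * m = m * (\<Phi> - h)" by (simp add: algebra_simps)
        moreover have "m * (\<Phi> - h) \<le> m * (\<Phi> - e')" using e' by (intro mult_left_mono) auto
        ultimately have "{xs \<in> perms m. f xs \<ge> m * (\<Phi> - e')} \<subseteq> {xs \<in> permutations_of_set A. f xs - \<mu> \<ge> h * m}"
          by (auto simp: A_def)
        then have "card {xs \<in> perms m. f xs \<ge> m * (\<Phi> - e')} \<le> card {xs \<in> permutations_of_set A. f xs - \<mu> \<ge> h * m}"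
          by (intro card_mono) auto
        moreover have "exp (- (e' * m)) * fact (l * m) \<le> card {xs \<in> perms m. f xs \<ge> m * (\<Phi> - e')}"
          using elim(1) dn unfolding f_def by blast
        ultimately have "exp (- (e' * m)) * fact (l * m) \<le> exp (- (\<gamma> * m)) * fact (l * m)"
          using tail by linarith
        then have "e' * m \<ge> \<gamma> * m" by simp
        then show False using e' m by simp
      qed
      have "{xs \<in> perms m. f xs < m * (\<Phi> - e)} \<subseteq> {xs \<in> permutations_of_set A. \<mu> - f xs \<ge> h * m}"
      proof -
        have "m * (\<Phi> - 2 * h) - h * m = m * (\<Phi> - e)" by (simp add: h_def algebra_simps)
        then show ?thesis using mu by (auto simp: A_def)
      qed
      then have "card {xs \<in> perms m. f xs < m * (\<Phi> - e)} \<le> card {xs \<in> permutations_of_set A. \<mu> - f xs \<ge> h * m}"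
        by (intro card_mono) auto
      then show "card {xs \<in> perms m. ln (matching_count d l m n xs) < m * (\<Phi> - e)} \<le> exp (- (\<gamma> * m)) * fact (l * m)"
        using tail' unfolding f_def by linarith
    qed
  qed
  then show ?thesis using that \<gamma> by blast
qed

lemma first_moment_upper:
  assumes "m > 0" "d * n = l * m" "k \<le> m"
  shows "first_moment d l m n k \<le> exp (m * \<Phi> + 9 * (1 + ln (real (l * m) + 1)))"
proof (cases "l * k \<le> n")
  case True
  have dl0: "d > 0" "l > 0" using dl by auto
  note f = first_moment_estimate[OF dl0 assms True]
  have "real (d * (l * k)) \<le> real (d * n)" using True by (simp only: of_nat_le_iff mult_le_mono2)
  then have "l * (d * real k) \<le> l * real m" using assms(2) by (simp add: mult_ac flip: of_nat_mult)
  then have "d * real k \<le> m" using dl by simp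
  then have "Phi d l (k / m) \<le> \<Phi>" using dl assms(1) by (intro Phi_le) (auto simp: field_simps)
  then have "m * Phi d l (k / m) \<le> m * \<Phi>" by (intro mult_left_mono) auto
  then have "ln (first_moment d l m n k) \<le> m * \<Phi> + 9 * (1 + ln (real (l * m) + 1))" using f(2) by linarith
  then have "exp (ln (first_moment d l m n k)) \<le> exp (m * \<Phi> + 9 * (1 + ln (real (l * m) + 1)))"
    by (simp only: exp_le_cancel_iff)
  then show ?thesis using f(1) by simp
next
  case False
  then show ?thesis by (simp add: first_moment_def binomial_eq_0)
qed

text \<open>Markov's inequality for the sum over all sizes. By \<open>Phi_le\<close> no size has an
  exponent above \<open>\<Phi>\<close>, so the summation costs only the factor \<open>m + 1\<close>,
  which half of \<open>e\<close> absorbs along with the logarithmic errors.\<close>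

lemma matching_count_upper_tail:
  fixes e :: real
  assumes "e > 0"
  shows "eventually (\<lambda>m. \<forall>n. d * n = l * m \<longrightarrow>
    card {xs \<in> perms m. ln (matching_count d l m n xs) > m * (\<Phi> + e)} \<le> exp (- (e / 2 * m)) * fact (l * m)) sequentially"
proof -
  have l: "l > 0" using dl by simp
  have "e / 2 > 0" using assms by simp
  from log_term_negligible[OF l this, of 0 9] eventually_gt_at_top[of 0]
  show ?thesis
  proof eventually_elim
    case (elim m)
    show ?case
    proof (intro allI impI)
      fix n assume dn: "d * n = l * m"
      define R where "R = 1 + ln (real (l * m) + 1)"
      define U where "U = {xs \<in> perms m. ln (matching_count d l m n xs) > m * (\<Phi> + e)}"
      have "card U * exp (m * (\<Phi> + e)) = (\<Sum>xs\<in>U. exp (m * (\<Phi> + e)))" by simp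
      also have "\<dots> \<le> (\<Sum>xs\<in>U. real (matching_count d l m n xs))"
      proof (rule sum_mono)
        fix xs assume "xs \<in> U"
        then have "exp (m * (\<Phi> + e)) \<le> exp (ln (matching_count d l m n xs))" by (simp add: U_def)
        then show "exp (m * (\<Phi> + e)) \<le> real (matching_count d l m n xs)"
          using matching_count_pos[of d l m n xs] by simp
      qed
      also have "\<dots> \<le> (\<Sum>xs\<in>perms m. real (matching_count d l m n xs))"
        by (intro sum_mono2) (auto simp: U_def)
      also have "\<dots> = (\<Sum>k\<le>m. \<Sum>xs\<in>perms m. real (size_count d l m n k xs))"
        unfolding matching_count_eq_sum of_nat_sum by (rule sum.swap)
      also have "\<dots> = (\<Sum>k\<le>m. first_moment d l m n k * fact (l * m))"
        by (simp only: sum_size_count[OF l dn])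
      also have "\<dots> \<le> (\<Sum>k\<le>m. exp (m * \<Phi> + 9 * R) * fact (l * m))"
        unfolding R_def using elim(2) dn by (intro sum_mono mult_right_mono first_moment_upper) auto
      also have "\<dots> = exp (ln (real m + 1)) * (exp (m * \<Phi> + 9 * R) * fact (l * m))" by simp
      also have "\<dots> = exp (ln (real m + 1) + (m * \<Phi> + 9 * R)) * fact (l * m)" unfolding exp_add by simp
      finally have "card U \<le> exp (ln (real m + 1) + (m * \<Phi> + 9 * R)) * fact (l * m) / exp (m * (\<Phi> + e))"
        by (simp add: pos_le_divide_eq)
      also have "\<dots> = exp (ln (real m + 1) + (m * \<Phi> + 9 * R) - m * (\<Phi> + e)) * fact (l * m)"
        unfolding exp_diff by simp
      also have "\<dots> \<le> exp (- (e / 2 * m)) * fact (l * m)"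
      proof -
        have "m * (\<Phi> + e) = m * \<Phi> + 2 * (e / 2 * m)" by (simp add: algebra_simps)
        then have "ln (real m + 1) + (m * \<Phi> + 9 * R) - m * (\<Phi> + e) \<le> - (e / 2 * m)"
          using elim(1) unfolding R_def by linarith
        then show ?thesis by (intro mult_right_mono) auto
      qed
      finally show "card {xs \<in> perms m. ln (matching_count d l m n xs) > m * (\<Phi> + e)}
          \<le> exp (- (e / 2 * m)) * fact (l * m)" by (simp add: U_def)
    qed
  qed
qed

lemma free_entropy_in_probability:
  fixes e :: real
  assumes "e > 0"
  shows "((\<lambda>m. measure_pmf.prob (random_hypergraph m d l)
      {P. \<bar>1 / real m * ln (real (num_matchings m l P)) - \<Phi>\<bar> > e})
    \<longlongrightarrow> 0) (inf sequentially (principal {m. d dvd l * m}))"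
proof -
  obtain \<gamma> :: real where \<gamma>: "\<gamma> > 0" and lower: "eventually (\<lambda>m. \<forall>n. d * n = l * m \<longrightarrow>
    card {xs \<in> perms m. ln (matching_count d l m n xs) < m * (\<Phi> - e)} \<le> exp (- (\<gamma> * m)) * fact (l * m)) sequentially"
    by (rule matching_count_lower_tail[OF assms])
  define h where "h m = exp (- (\<gamma> * real m)) + exp (- (e / 2 * real m))" for m
  show ?thesis
  proof (rule tendsto_sandwich[OF _ _ tendsto_const])
    have "h \<longlonglongrightarrow> 0"
    proof -
      have "(\<lambda>m. exp (- (c * real m))) \<longlonglongrightarrow> 0" if "c > 0" for c :: real
        using that by real_asymp
      from tendsto_add[OF this[OF \<gamma>] this[of "e / 2"]] show ?thesis
        unfolding h_def[abs_def] using assms by simp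
    qed
    then show "(h \<longlongrightarrow> 0) (inf sequentially (principal {m. d dvd l * m}))"
      by (rule tendsto_mono[OF inf_le1])
    show "eventually (\<lambda>m. measure_pmf.prob (random_hypergraph m d l)
        {P. \<bar>1 / real m * ln (real (num_matchings m l P)) - \<Phi>\<bar> > e} \<le> h m)
      (inf sequentially (principal {m. d dvd l * m}))"
      unfolding eventually_inf_principal
      using lower matching_count_upper_tail[OF assms] eventually_gt_at_top[of 0]
    proof eventually_elim
      case (elim m)
      show ?case
      proof
        assume "m \<in> {m. d dvd l * m}"
        then obtain n where dn: "d * n = l * m" by (metis dvdE mem_Collect_eq)
        have d: "d > 0" using dl by simp
        define Q where "Q z \<longleftrightarrow> \<bar>1 / real m * z - \<Phi>\<bar> > e" for z
        define f where "f xs = ln (real (matching_count d l m n xs))" for xs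
        have Q: "z < m * (\<Phi> - e) \<or> z > m * (\<Phi> + e)" if "Q z" for z
        proof -
          have "z / m < \<Phi> - e \<or> z / m > \<Phi> + e" using that by (auto simp: Q_def)
          then show ?thesis using elim(3) by (simp add: field_simps)
        qed
        have "measure_pmf.prob (random_hypergraph m d l) {P. Q (ln (real (num_matchings m l P)))}
            = card {xs \<in> perms m. Q (ln (real (num_matchings m l (config d n xs))))} / fact (l * m)"
          by (rule prob_random_hypergraph[OF d dn])
        also have "{xs \<in> perms m. Q (ln (real (num_matchings m l (config d n xs))))} = {xs \<in> perms m. Q (f xs)}"
          using num_matchings_config[OF d dn] by (auto simp: f_def)
        also have "real (card {xs \<in> perms m. Q (f xs)}) / fact (l * m) \<le> h m"
        proof -
          have "card {xs \<in> perms m. Q (f xs)}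
              \<le> card ({xs \<in> perms m. f xs < m * (\<Phi> - e)} \<union> {xs \<in> perms m. f xs > m * (\<Phi> + e)})"
            using Q by (intro card_mono) auto
          also have "\<dots> \<le> card {xs \<in> perms m. f xs < m * (\<Phi> - e)} + card {xs \<in> perms m. f xs > m * (\<Phi> + e)}"
            by (rule card_Un_le)
          finally have "real (card {xs \<in> perms m. Q (f xs)})
              \<le> real (card {xs \<in> perms m. f xs < m * (\<Phi> - e)}) + real (card {xs \<in> perms m. f xs > m * (\<Phi> + e)})"
            by linarith
          moreover have "card {xs \<in> perms m. f xs < m * (\<Phi> - e)} \<le> exp (- (\<gamma> * m)) * fact (l * m)"
            "card {xs \<in> perms m. f xs > m * (\<Phi> + e)} \<le> exp (- (e / 2 * m)) * fact (l * m)"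
            using elim dn unfolding f_def by blast+
          ultimately have "real (card {xs \<in> perms m. Q (f xs)}) \<le> h m * fact (l * m)"
            unfolding h_def distrib_right by linarith
          then show ?thesis by (simp add: pos_divide_le_eq)
        qed
        finally show "measure_pmf.prob (random_hypergraph m d l)
            {P. \<bar>1 / real m * ln (real (num_matchings m l P)) - \<Phi>\<bar> > e} \<le> h m"
          by (simp add: Q_def)
      qed
    qed
  qed simp
qed

end

theorem theorem1p2:
  fixes d l :: nat
  assumes "d \<ge> 2" and "l \<ge> 2"
    and "\<And>s::real. 0 < s \<Longrightarrow> s < beta_star d l - c0 l (beta_star d l)
           \<Longrightarrow> G_fun d l (beta_star d l) s > 0"
  shows "\<forall>\<epsilon>>0. ((\<lambda>m. measure_pmf.prob (random_hypergraph m d l)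
            {P. \<bar>1 / real m * ln (real (num_matchings m l P)) - Phi d l (beta_star d l)\<bar> > \<epsilon>})
          \<longlongrightarrow> 0) (inf sequentially (principal {m. d dvd l * m}))"
proof -
  interpret matching_model d l using assms by unfold_locales
  show ?thesis using free_entropy_in_probability by blast
qed

end
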